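(* Let $k\in\{2,3,4\}$, and let $2p=2$ if $k=2$ and $2p=4$ if $k\in\{3,4\}$. Consider the semi-discrete scheme $$\frac{d \mathbf U_{i,j}}{d t}= -\frac{\hat{\boldsymbol f}^k_{x, i+\frac12, j}-\hat{\boldsymbol f}^k_{x, i-\frac12, j}}{\Delta x}-\frac{\hat{\boldsymbol f}^k_{y, i, j+\frac12}-\hat{\boldsymbol f}^k_{y, i, j-\frac12}}{\Delta y} -\mathbf C_x(\mathbf U_{i,j})\left(\frac{\partial \mathbf U}{\partial x} \right)_{i,j} -\mathbf C_y(\mathbf U_{i,j}) \left(\frac{\partial \mathbf U}{\partial y} \right)_{i,j}$$ with $\mathbf U_{i,j}(t)\in\Omega$, where $\hat{\boldsymbol f}^k_x,\hat{\boldsymbol f}^k_y$ are the numerical fluxes defined in the context, and where $(\partial\mathbf U/\partial x)_{i,j}$, $(\partial\mathbf U/\partial y)_{i,j}$ are approximated by central differences of second order if $k=2$ and of fourth order if $k=3,4$. Then the scheme is a $k$-th order accurate approximation of $$\frac{\partial \mathbf U}{\partial t}+\frac{\partial \mathbf f_{x}}{\partial x} + \frac{\partial \mathbf f_{y}}{\partial y} + \mathbf C_{x}(\mathbf U)\frac{\partial \mathbf U}{\partial x} + \mathbf C_{y}(\mathbf U)\frac{\partial \mathbf U}{\partial y}=0$$ and is entropy stable, i.e. it satisfies $$\frac{d}{dt} \mathcal E(\mathbf U_{i,j}) +\frac{1}{\Delta x} \left( \hat{\mathbf q}^k_{x,i+\frac12,j} - \hat{\mathbf q}^k_{x,i-\frac12,j}\right)+\frac{1}{\Delta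 y}\left( \hat{\mathbf q}^k_{y,i,j+\frac12} - \hat{\mathbf q}^k_{y,i,j-\frac12}\right) \le 0,$$ where $$\hat{\mathbf q}^k_{x,i+\frac12,j}= \tilde{\mathbf q}^{2p}_{x,i+\frac12,j} - \tfrac12\,\bar{\boldsymbol{\mathcal V}}_{i+\frac12,j}^{\top} \mathbf D_{x,i+\frac12,j}[\![ \hat{\boldsymbol{\mathcal V}}]\!]^k_{x,i+\frac12,j},\qquad \hat{\mathbf q}^k_{y,i,j+\frac12}= \tilde{\mathbf q}^{2p}_{y,i,j+\frac12} - \tfrac12\,\bar{\boldsymbol{\mathcal V}}_{i,j+\frac12}^{\top} \mathbf D_{y,i,j+\frac12}[\![ \hat{\boldsymbol{\mathcal V}}]\!]^k_{y,i,j+\frac12}$$ are numerical entropy fluxes consistent with the continuous entropy fluxes $\mathbf q_x$ and $\mathbf q_y$, respectively.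
   Context: **Continuous system.** Constants $\gamma_e>1$, $\gamma_i>1$. The unknown is $\mathbf U=(\rho,\rho v_x,\rho v_y,E,p_i)^\top$, with velocity $\boldsymbol v=(v_x,v_y)$ and electron pressure $p_e$ determined by $E=\frac{p_e}{\gamma_e-1}+\frac{p_i}{\gamma_i-1}+\frac{\rho|\boldsymbol v|^2}{2}$. Admissible set: $\Omega=\{\mathbf U\in\mathbb R^5:\rho>0,\ p_e>0,\ p_i>0\}$. Fluxes: $\mathbf f_x=(\rho v_x,\ \rho v_x^2+2p_e,\ \rho v_xv_y,\ (E+2p_e)v_x,\ p_iv_x)^\top$, $\mathbf f_y=(\rho v_y,\ \rho v_xv_y,\ \rho v_y^2+2p_e,\ (E+2p_e)v_y,\ p_iv_y)^\top$. Non-conservative matrices: $$\mathbf C_x=\begin{pmatrix} 0&0&0&0&0\\ -\frac{(\gamma_e-1)|\boldsymbol v|^2}{2}&(\gamma_e-1)v_x&(\gamma_e-1)v_y&-(\gamma_e-1)&\frac{\gamma_e-1}{\gamma_i-1}+1\\ 0&0&0&0&0\\ -\left(\frac{(\gamma_e-1)|\boldsymbol v|^2}{2}+\frac{p_i-p_e}{\rho}\right)v_x&(\gamma_e-1)v_x^2+\frac{p_i-p_e}{\rho}&(\gamma_e-1)v_xv_y&-(\gamma_e-1)v_x&\left(\frac{\gamma_e-1}{\gamma_i-1}+1\right)v_x\\ -\frac{(\gamma_i-1)p_iv_x}{\rho}&\frac{(\gamma_i-1)p_i}{\rho}&0&0&0\end{pmatrix},$$ $$\mathbf C_y=\begin{pmatrix}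 0&0&0&0&0\\ 0&0&0&0&0\\ -\frac{(\gamma_e-1)|\boldsymbol v|^2}{2}&(\gamma_e-1)v_x&(\gamma_e-1)v_y&-(\gamma_e-1)&\frac{\gamma_e-1}{\gamma_i-1}+1\\ -\left(\frac{(\gamma_e-1)|\boldsymbol v|^2}{2}+\frac{p_i-p_e}{\rho}\right)v_y&(\gamma_e-1)v_xv_y&(\gamma_e-1)v_y^2+\frac{p_i-p_e}{\rho}&-(\gamma_e-1)v_y&\left(\frac{\gamma_e-1}{\gamma_i-1}+1\right)v_y\\ -\frac{(\gamma_i-1)p_iv_y}{\rho}&0&\frac{(\gamma_i-1)p_i}{\rho}&0&0\end{pmatrix}.$$ This is a reformulation of the One-Fluid Two-Temperature Euler (OFTT-Euler) system. **Entropy.** $s=\frac{1}{\gamma_e-1}\ln\frac{p_e}{\rho^{\gamma_e}}+\frac1{\gamma_i-1}\ln\frac{p_i}{\rho^{\gamma_i}}$, $\mathcal E=-\rho s$, $\mathbf q_d=-\rho v_ds$ for $d\in\{x,y\}$. With $\beta_e=\rho/p_e$, $\beta_i=\rho/p_i$, the entropy variable is $$\boldsymbol{\mathcal V}=\frac{\partial\mathcal E}{\partial\mathbf U}=\Big(\tfrac{\gamma_e}{\gamma_e-1}+\tfrac{\gamma_i}{\gamma_i-1}-s-\tfrac{\beta_e|\boldsymbol v|^2}{2},\ \beta_ev_x,\ \beta_ev_y,\ -\beta_e,\ \tfrac{\beta_e-\beta_i}{\gamma_i-1}\Big)^\top.$$ The entropy potentials are $\mathcal F_d=\boldsymbol{\mathcal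 V}\cdot\mathbf f_d-\mathbf q_d=2\rho v_d$. **Grid notation.** Uniform mesh of size $(\Delta x,\Delta y)$ with grid points $(x_i,y_j)$; statements at $(i,j)$ concern grid indices for which all stencil values are available. A bar with subscript $i+\frac12,j$ (resp. $i,j+\frac12$) is the arithmetic mean of the values at $(i,j)$ and $(i+1,j)$ (resp. $(i,j+1)$). The central differences in $x$ are $\frac{\mathbf U_{i+1,j}-\mathbf U_{i-1,j}}{2\Delta x}$ (second order) and $\frac{-\mathbf U_{i+2,j}+8\mathbf U_{i+1,j}-8\mathbf U_{i-1,j}+\mathbf U_{i-2,j}}{12\Delta x}$ (fourth order), and similarly in $y$. **Two-point entropy conservative fluxes.** For states $\mathbf U_l,\mathbf U_r\in\Omega$ put $\bar a=\frac{a_l+a_r}2$, $a^{\ln}=\frac{a_r-a_l}{\ln a_r-\ln a_l}$ (with $a^{\ln}=a_l$ if $a_l=a_r$); $\overline{|v|^2}$ is the mean of $|\boldsymbol v|^2$. The flux $\tilde{\boldsymbol f}_x(\mathbf U_l,\mathbf U_r)=(\tilde f^{(1)}_x,\dots,\tilde f^{(5)}_x)^\top$ is $$\tilde f_x^{(1)}=\rho^{\ln}\bar v_x,\quad \tilde f_x^{(2)}=\tfrac{2\bar\rho}{\bar\beta_e}+\bar v_x\tilde f_x^{(1)},\quad \tilde f_x^{(3)}=\bar v_y\tilde f_x^{(1)},\quad \tilde f_x^{(5)}=\tfrac{\tilde f_x^{(1)}}{\beta_i^{\ln}},$$ $$\tilde f_x^{(4)}=\Big[\tfrac1{(\gamma_e-1)\beta_e^{\ln}}-\tfrac{\overline{|v|^2}}2\Big]\tilde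 f_x^{(1)}+\bar v_x\tilde f_x^{(2)}+\bar v_y\tilde f_x^{(3)}+\tfrac{\tilde f_x^{(5)}}{\gamma_i-1},$$ and $\tilde{\boldsymbol f}_y(\mathbf U_l,\mathbf U_r)$ is $$\tilde f_y^{(1)}=\rho^{\ln}\bar v_y,\quad \tilde f_y^{(2)}=\bar v_x\tilde f_y^{(1)},\quad \tilde f_y^{(3)}=\tfrac{2\bar\rho}{\bar\beta_e}+\bar v_y\tilde f_y^{(1)},\quad \tilde f_y^{(5)}=\tfrac{\tilde f_y^{(1)}}{\beta_i^{\ln}},$$ $$\tilde f_y^{(4)}=\Big[\tfrac1{(\gamma_e-1)\beta_e^{\ln}}-\tfrac{\overline{|v|^2}}2\Big]\tilde f_y^{(1)}+\bar v_x\tilde f_y^{(2)}+\bar v_y\tilde f_y^{(3)}+\tfrac{\tilde f_y^{(5)}}{\gamma_i-1}.$$ The associated two-point entropy fluxes are $\tilde{\mathbf q}_d(\mathbf U_l,\mathbf U_r)=\bar{\boldsymbol{\mathcal V}}\cdot\tilde{\boldsymbol f}_d(\mathbf U_l,\mathbf U_r)-\bar{\mathcal F}_d$. **Fluxes of order $2p$.** $\tilde{\boldsymbol f}^2_{x,i+\frac12,j}=\tilde{\boldsymbol f}_x(\mathbf U_{i,j},\mathbf U_{i+1,j})$, and $$\tilde{\boldsymbol f}^4_{x,i+\frac12,j}=\tfrac43\tilde{\boldsymbol f}_x(\mathbf U_{i,j},\mathbf U_{i+1,j})-\tfrac16\big(\tilde{\boldsymbol f}_x(\mathbf U_{i-1,j},\mathbf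 U_{i+1,j})+\tilde{\boldsymbol f}_x(\mathbf U_{i,j},\mathbf U_{i+2,j})\big).$$ The entropy fluxes $\tilde{\mathbf q}^{2}_x,\tilde{\mathbf q}^4_x$ are given by the same combinations with $\tilde{\mathbf q}_x$ in place of $\tilde{\boldsymbol f}_x$; in the $y$-direction everything is analogous, with the index $j$ shifted. **Diffusion matrices.** $\mathbf D_{x,i+\frac12,j}=\tilde R_{x,i+\frac12,j}\Lambda_{x,i+\frac12,j}\tilde R_{x,i+\frac12,j}^\top$ and $\mathbf D_{y,i,j+\frac12}=\tilde R_{y,i,j+\frac12}\Lambda_{y,i,j+\frac12}\tilde R_{y,i,j+\frac12}^\top$, evaluated at an interface state in $\Omega$. Here $\Lambda_d=\big(\max_{\lambda}|\lambda|\big)\mathbf I_{5\times5}$, the maximum being over the eigenvalues $v_d,v_d,v_d,v_d\pm\sqrt{2p_e(2\gamma_e-1)/\rho}$ of $\partial\mathbf f_d/\partial\mathbf U$, and $\tilde R_d=\frac{\partial\mathbf U}{\partial\mathbf W}\,S_d$ is the matrix of entropy-scaled right eigenvectors of $\partial\mathbf f_d/\partial\mathbf U$ (so that $\frac{\partial\mathbf U}{\partial\boldsymbol{\mathcal V}}=\tilde R_d\tilde R_d^\top$), where $\mathbf W=(\rho,v_x,v_y,p_e,p_i)$ and $$S_x=\begin{pmatrix} \sqrt{\frac{\rho}{4(2\gamma_e-1)}}&\frac{p_i\Theta_1+\rho(\gamma_e-1)}{(2\gamma_e-1)\Theta}&0&\frac{p_i(\gamma_e-1)}{(2\gamma_e-1)\Theta}&\sqrt{\frac{\rho}{4(2\gamma_e-1)}}\\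 -\frac1\rho\sqrt{\frac{p_e}2}&0&0&0&\frac1\rho\sqrt{\frac{p_e}2}\\ 0&0&\frac{\sqrt{p_e}}\rho&0&0\\ \frac{p_e}2\sqrt{\frac{2\gamma_e-1}\rho}&0&0&0&\frac{p_e}2\sqrt{\frac{2\gamma_e-1}\rho}\\ \frac{p_i}2\sqrt{\frac1{(2\gamma_e-1)\rho}}&\frac{p_i(\gamma_e-1)}{(2\gamma_e-1)\Theta}&0&\frac{p_i^2(-\gamma_i+\gamma_e(2\gamma_i-1))+p_i\rho\Theta_1}{\rho(2\gamma_e-1)\Theta}&\frac{p_i}2\sqrt{\frac1{(2\gamma_e-1)\rho}}\end{pmatrix},$$ $\Theta_1=\sqrt{(\gamma_e-1)(\gamma_i-1)(2\gamma_e-1)}$, $\Theta=\sqrt{\frac{2p_i\rho\Theta_1-p_i^2(\gamma_e+\gamma_i-2\gamma_e\gamma_i)+\rho^2(\gamma_e-1)}{\rho(2\gamma_e-1)}}$; $S_y$ is $S_x$ with its second and third rows interchanged. **Reconstructed jumps.** Let $\mathcal W^\pm_{x,i,j}=\tilde R^\top_{x,i\pm\frac12,j}\boldsymbol{\mathcal V}_{i,j}$ (scaled entropy variables). These are reconstructed componentwise in the $x$-direction (MinMod reconstruction for $k=2$, ENO reconstruction of order $k$ for $k=3,4$) by polynomials $\mathcal P^\pm_{x,i,j}(x)$, and $\hat{\mathcal W}^\pm_{x,i,j}=\mathcal P^\pm_{x,i,j}(x_{i\pm\frac12})$. Set $\hat{\boldsymbol{\mathcal V}}^\pm_{x,i,j}=(\tilde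 R^\top_{x,i\pm\frac12,j})^{-1}\hat{\mathcal W}^\pm_{x,i,j}$ and $[\![\hat{\boldsymbol{\mathcal V}}]\!]^k_{x,i+\frac12,j}=\hat{\boldsymbol{\mathcal V}}^-_{x,i+1,j}-\hat{\boldsymbol{\mathcal V}}^+_{x,i,j}$. These reconstructions have the sign-preserving property: componentwise, the reconstructed jump $\hat{\mathcal W}^-_{x,i+1,j}-\hat{\mathcal W}^+_{x,i,j}$ has the same sign as $\mathcal W^-_{x,i+1,j}-\mathcal W^+_{x,i,j}$ (or vanishes). The $y$-direction is analogous. **Entropy stable fluxes.** $\hat{\boldsymbol f}^k_{x,i+\frac12,j}=\tilde{\boldsymbol f}^{2p}_{x,i+\frac12,j}-\frac12\mathbf D_{x,i+\frac12,j}[\![\hat{\boldsymbol{\mathcal V}}]\!]^k_{x,i+\frac12,j}$ and $\hat{\boldsymbol f}^k_{y,i,j+\frac12}=\tilde{\boldsymbol f}^{2p}_{y,i,j+\frac12}-\frac12\mathbf D_{y,i,j+\frac12}[\![\hat{\boldsymbol{\mathcal V}}]\!]^k_{y,i,j+\frac12}$. A numerical (entropy) flux is consistent with a continuous one if it reduces to it when all its state arguments coincide.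
   Formalization: "k-th order accurate" is taken in flux form: the truncation error is a discrete divergence of O(h^k) interface flux errors plus an O(h^k) term. A pointwise O(h^k) bound fails, e.g. at extrema of scaled entropy variables. Each interface's reconstruction uses its own fixed scaling matrix. *)

theory Defs
  imports "HOL-Analysis.Analysis" "HOL-Computational_Algebra.Polynomial"
begin

text \<open>
  States are conservative vectors \<open>U = (\<rho>, \<rho> v\<^sub>x, \<rho> v\<^sub>y, E, p\<^sub>i)\<close>. The arguments \<open>ge\<close>, \<open>gi\<close> are
  the adiabatic constants of electrons and ions.
\<close>

type_synonym state = "real^5"
type_synonym grid = "int \<Rightarrow> int \<Rightarrow> state"

section \<open>The continuous system\<close>

definition dens :: "state \<Rightarrow> real" where "dens U = U$1"
definition vel_x :: "state \<Rightarrow> real" where "vel_x U = U$2 / U$1"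
definition vel_y :: "state \<Rightarrow> real" where "vel_y U = U$3 / U$1"
definition energy :: "state \<Rightarrow> real" where "energy U = U$4"
definition p_ion :: "state \<Rightarrow> real" where "p_ion U = U$5"
definition speed_sq :: "state \<Rightarrow> real" where "speed_sq U = (vel_x U)\<^sup>2 + (vel_y U)\<^sup>2"

text \<open>Solves \<open>E = p\<^sub>e / (ge - 1) + p\<^sub>i / (gi - 1) + \<rho> \<bar>v\<bar>\<^sup>2 / 2\<close> for \<open>p\<^sub>e\<close>.\<close>

definition p_el :: "real \<Rightarrow> real \<Rightarrow> state \<Rightarrow> real" where
  "p_el ge gi U = (ge - 1) * (energy U - p_ion U / (gi - 1) - dens U * speed_sq U / 2)"

definition admissible :: "real \<Rightarrow> real \<Rightarrow> state set" where
  "admissible ge gi = {U. dens U > 0 \<and> p_el ge gi U > 0 \<and> p_ion U > 0}"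

definition flux_x :: "real \<Rightarrow> real \<Rightarrow> state \<Rightarrow> state" where
  "flux_x ge gi U = vector
    [dens U * vel_x U,
     dens U * (vel_x U)\<^sup>2 + 2 * p_el ge gi U,
     dens U * vel_x U * vel_y U,
     (energy U + 2 * p_el ge gi U) * vel_x U,
     p_ion U * vel_x U]"

definition flux_y :: "real \<Rightarrow> real \<Rightarrow> state \<Rightarrow> state" where
  "flux_y ge gi U = vector
    [dens U * vel_y U,
     dens U * vel_x U * vel_y U,
     dens U * (vel_y U)\<^sup>2 + 2 * p_el ge gi U,
     (energy U + 2 * p_el ge gi U) * vel_y U,
     p_ion U * vel_y U]"

definition C_x :: "real \<Rightarrow> real \<Rightarrow> state \<Rightarrow> real^5^5" where
  "C_x ge gi U = (let r = dens U; vx = vel_x U; vy = vel_y U; v2 = speed_sq U;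
      pe = p_el ge gi U; p = p_ion U in vector
    [vector [0, 0, 0, 0, 0],
     vector [- ((ge - 1) * v2 / 2), (ge - 1) * vx, (ge - 1) * vy, - (ge - 1),
       (ge - 1) / (gi - 1) + 1],
     vector [0, 0, 0, 0, 0],
     vector [- (((ge - 1) * v2 / 2 + (p - pe) / r) * vx),
       (ge - 1) * vx\<^sup>2 + (p - pe) / r, (ge - 1) * vx * vy, - ((ge - 1) * vx),
       ((ge - 1) / (gi - 1) + 1) * vx],
     vector [- ((gi - 1) * p * vx / r), (gi - 1) * p / r, 0, 0, 0]])"

definition C_y :: "real \<Rightarrow> real \<Rightarrow> state \<Rightarrow> real^5^5" where
  "C_y ge gi U = (let r = dens U; vx = vel_x U; vy = vel_y U; v2 = speed_sq U;
      pe = p_el ge gi U; p = p_ion U in vector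
    [vector [0, 0, 0, 0, 0],
     vector [0, 0, 0, 0, 0],
     vector [- ((ge - 1) * v2 / 2), (ge - 1) * vx, (ge - 1) * vy, - (ge - 1),
       (ge - 1) / (gi - 1) + 1],
     vector [- (((ge - 1) * v2 / 2 + (p - pe) / r) * vy),
       (ge - 1) * vx * vy, (ge - 1) * vy\<^sup>2 + (p - pe) / r, - ((ge - 1) * vy),
       ((ge - 1) / (gi - 1) + 1) * vy],
     vector [- ((gi - 1) * p * vy / r), 0, (gi - 1) * p / r, 0, 0]])"

section \<open>Entropy\<close>

definition spec_entropy :: "real \<Rightarrow> real \<Rightarrow> state \<Rightarrow> real" where
  "spec_entropy ge gi U =
     1 / (ge - 1) * ln (p_el ge gi U / dens U powr ge) +
     1 / (gi - 1) * ln (p_ion U / dens U powr gi)"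

definition entropy :: "real \<Rightarrow> real \<Rightarrow> state \<Rightarrow> real" where
  "entropy ge gi U = - dens U * spec_entropy ge gi U"

definition entropy_flux_x :: "real \<Rightarrow> real \<Rightarrow> state \<Rightarrow> real" where
  "entropy_flux_x ge gi U = - dens U * vel_x U * spec_entropy ge gi U"

definition entropy_flux_y :: "real \<Rightarrow> real \<Rightarrow> state \<Rightarrow> real" where
  "entropy_flux_y ge gi U = - dens U * vel_y U * spec_entropy ge gi U"

definition beta_e :: "real \<Rightarrow> real \<Rightarrow> state \<Rightarrow> real" where
  "beta_e ge gi U = dens U / p_el ge gi U"

definition beta_i :: "state \<Rightarrow> real" where
  "beta_i U = dens U / p_ion U"

definition entropy_var :: "real \<Rightarrow> real \<Rightarrow> state \<Rightarrow> state" where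
  "entropy_var ge gi U = vector
    [ge / (ge - 1) + gi / (gi - 1) - spec_entropy ge gi U - beta_e ge gi U * speed_sq U / 2,
     beta_e ge gi U * vel_x U,
     beta_e ge gi U * vel_y U,
     - beta_e ge gi U,
     (beta_e ge gi U - beta_i U) / (gi - 1)]"

definition potential_x :: "real \<Rightarrow> real \<Rightarrow> state \<Rightarrow> real" where
  "potential_x ge gi U = entropy_var ge gi U \<bullet> flux_x ge gi U - entropy_flux_x ge gi U"

definition potential_y :: "real \<Rightarrow> real \<Rightarrow> state \<Rightarrow> real" where
  "potential_y ge gi U = entropy_var ge gi U \<bullet> flux_y ge gi U - entropy_flux_y ge gi U"

section \<open>Two-point entropy conservative fluxes\<close>

definition log_mean :: "real \<Rightarrow> real \<Rightarrow> real" where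
  "log_mean a b = (if a = b then a else (b - a) / (ln b - ln a))"

definition ec_flux_x :: "real \<Rightarrow> real \<Rightarrow> state \<Rightarrow> state \<Rightarrow> state" where
  "ec_flux_x ge gi Ul Ur =
    (let vx = midpoint (vel_x Ul) (vel_x Ur);
         vy = midpoint (vel_y Ul) (vel_y Ur);
         v2 = midpoint (speed_sq Ul) (speed_sq Ur);
         f1 = log_mean (dens Ul) (dens Ur) * vx;
         f2 = 2 * midpoint (dens Ul) (dens Ur) / midpoint (beta_e ge gi Ul) (beta_e ge gi Ur)
              + vx * f1;
         f3 = vy * f1;
         f5 = f1 / log_mean (beta_i Ul) (beta_i Ur);
         f4 = (1 / ((ge - 1) * log_mean (beta_e ge gi Ul) (beta_e ge gi Ur)) - v2 / 2) * f1
              + vx * f2 + vy * f3 + f5 / (gi - 1)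
     in vector [f1, f2, f3, f4, f5])"

definition ec_flux_y :: "real \<Rightarrow> real \<Rightarrow> state \<Rightarrow> state \<Rightarrow> state" where
  "ec_flux_y ge gi Ul Ur =
    (let vx = midpoint (vel_x Ul) (vel_x Ur);
         vy = midpoint (vel_y Ul) (vel_y Ur);
         v2 = midpoint (speed_sq Ul) (speed_sq Ur);
         f1 = log_mean (dens Ul) (dens Ur) * vy;
         f2 = vx * f1;
         f3 = 2 * midpoint (dens Ul) (dens Ur) / midpoint (beta_e ge gi Ul) (beta_e ge gi Ur)
              + vy * f1;
         f5 = f1 / log_mean (beta_i Ul) (beta_i Ur);
         f4 = (1 / ((ge - 1) * log_mean (beta_e ge gi Ul) (beta_e ge gi Ur)) - v2 / 2) * f1
              + vx * f2 + vy * f3 + f5 / (gi - 1)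
     in vector [f1, f2, f3, f4, f5])"

definition ec_entropy_flux_x :: "real \<Rightarrow> real \<Rightarrow> state \<Rightarrow> state \<Rightarrow> real" where
  "ec_entropy_flux_x ge gi Ul Ur =
     midpoint (entropy_var ge gi Ul) (entropy_var ge gi Ur) \<bullet> ec_flux_x ge gi Ul Ur
     - midpoint (potential_x ge gi Ul) (potential_x ge gi Ur)"

definition ec_entropy_flux_y :: "real \<Rightarrow> real \<Rightarrow> state \<Rightarrow> state \<Rightarrow> real" where
  "ec_entropy_flux_y ge gi Ul Ur =
     midpoint (entropy_var ge gi Ul) (entropy_var ge gi Ur) \<bullet> ec_flux_y ge gi Ul Ur
     - midpoint (potential_y ge gi Ul) (potential_y ge gi Ur)"

section \<open>Order of the central part\<close>

text \<open>
  One-dimensional operators act on a grid line \<open>u :: int \<Rightarrow> state\<close>; index \<open>i\<close> of an interface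
  quantity stands for \<open>i + 1/2\<close>. The order \<open>2p\<close> is \<open>2\<close> for \<open>k = 2\<close> and \<open>4\<close> for \<open>k = 3, 4\<close>.
\<close>

definition central_flux ::
  "nat \<Rightarrow> (state \<Rightarrow> state \<Rightarrow> 'b::real_vector) \<Rightarrow> (int \<Rightarrow> state) \<Rightarrow> int \<Rightarrow> 'b" where
  "central_flux k F u i =
     (if k = 2 then F (u i) (u (i + 1))
      else (4/3) *\<^sub>R F (u i) (u (i + 1))
           - (1/6) *\<^sub>R (F (u (i - 1)) (u (i + 1)) + F (u i) (u (i + 2))))"

definition central_diff :: "nat \<Rightarrow> real \<Rightarrow> (int \<Rightarrow> state) \<Rightarrow> int \<Rightarrow> state" where
  "central_diff k h u i =
     (if k = 2 then (1 / (2 * h)) *\<^sub>R (u (i + 1) - u (i - 1))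
      else (1 / (12 * h)) *\<^sub>R (- u (i + 2) + 8 *\<^sub>R u (i + 1) - 8 *\<^sub>R u (i - 1) + u (i - 2)))"

section \<open>Diffusion matrices\<close>

text \<open>The conservative vector as a function of \<open>W = (\<rho>, v\<^sub>x, v\<^sub>y, p\<^sub>e, p\<^sub>i)\<close>.\<close>

definition prim_to_cons :: "real \<Rightarrow> real \<Rightarrow> state \<Rightarrow> state" where
  "prim_to_cons ge gi W = vector
    [W$1, W$1 * W$2, W$1 * W$3,
     W$4 / (ge - 1) + W$5 / (gi - 1) + W$1 * ((W$2)\<^sup>2 + (W$3)\<^sup>2) / 2,
     W$5]"

definition cons_to_prim :: "real \<Rightarrow> real \<Rightarrow> state \<Rightarrow> state" where
  "cons_to_prim ge gi U = vector [dens U, vel_x U, vel_y U, p_el ge gi U, p_ion U]"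

definition Theta1 :: "real \<Rightarrow> real \<Rightarrow> real" where
  "Theta1 ge gi = sqrt ((ge - 1) * (gi - 1) * (2 * ge - 1))"

definition Theta :: "real \<Rightarrow> real \<Rightarrow> state \<Rightarrow> real" where
  "Theta ge gi U = (let r = dens U; p = p_ion U in
     sqrt ((2 * p * r * Theta1 ge gi - p\<^sup>2 * (ge + gi - 2 * ge * gi) + r\<^sup>2 * (ge - 1))
           / (r * (2 * ge - 1))))"

definition S_x :: "real \<Rightarrow> real \<Rightarrow> state \<Rightarrow> real^5^5" where
  "S_x ge gi U = (let r = dens U; pe = p_el ge gi U; p = p_ion U; g = 2 * ge - 1;
      T1 = Theta1 ge gi; T = Theta ge gi U in vector
    [vector [sqrt (r / (4 * g)), (p * T1 + r * (ge - 1)) / (g * T), 0,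
       p * (ge - 1) / (g * T), sqrt (r / (4 * g))],
     vector [- (1 / r * sqrt (pe / 2)), 0, 0, 0, 1 / r * sqrt (pe / 2)],
     vector [0, 0, sqrt pe / r, 0, 0],
     vector [pe / 2 * sqrt (g / r), 0, 0, 0, pe / 2 * sqrt (g / r)],
     vector [p / 2 * sqrt (1 / (g * r)), p * (ge - 1) / (g * T), 0,
       (p\<^sup>2 * (- gi + ge * (2 * gi - 1)) + p * r * T1) / (r * g * T),
       p / 2 * sqrt (1 / (g * r))]])"

definition S_y :: "real \<Rightarrow> real \<Rightarrow> state \<Rightarrow> real^5^5" where
  "S_y ge gi U = (let S = S_x ge gi U in vector [S$1, S$3, S$2, S$4, S$5])"

definition R_x :: "real \<Rightarrow> real \<Rightarrow> state \<Rightarrow> real^5^5" where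
  "R_x ge gi U = jacobian (prim_to_cons ge gi) (at (cons_to_prim ge gi U)) ** S_x ge gi U"

definition R_y :: "real \<Rightarrow> real \<Rightarrow> state \<Rightarrow> real^5^5" where
  "R_y ge gi U = jacobian (prim_to_cons ge gi) (at (cons_to_prim ge gi U)) ** S_y ge gi U"

text \<open>
  The maximum of \<open>\<bar>\<lambda>\<bar>\<close> over the eigenvalues \<open>\<lambda> = v, v + c, v - c\<close> of the flux Jacobian, where
  \<open>v\<close> is the velocity component in the direction considered.
\<close>

definition max_speed :: "real \<Rightarrow> real \<Rightarrow> state \<Rightarrow> real \<Rightarrow> real" where
  "max_speed ge gi U v = (let c = sqrt (2 * p_el ge gi U * (2 * ge - 1) / dens U) in
     Max {\<bar>v\<bar>, \<bar>v + c\<bar>, \<bar>v - c\<bar>})"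

definition D_x :: "real \<Rightarrow> real \<Rightarrow> state \<Rightarrow> real^5^5" where
  "D_x ge gi U = R_x ge gi U ** mat (max_speed ge gi U (vel_x U)) ** transpose (R_x ge gi U)"

definition D_y :: "real \<Rightarrow> real \<Rightarrow> state \<Rightarrow> real^5^5" where
  "D_y ge gi U = R_y ge gi U ** mat (max_speed ge gi U (vel_y U)) ** transpose (R_y ge gi U)"

section \<open>Reconstruction\<close>

text \<open>
  Scalar reconstructions of grid data \<open>g :: int \<Rightarrow> real\<close>. Polynomials are written in the index
  coordinate \<open>\<xi>\<close>, in which the mesh points are the integers, cell \<open>m\<close> is \<open>[m - 1/2, m + 1/2]\<close>
  and \<open>x\<^bsub>i+1/2\<^esub>\<close> is \<open>i + 1/2\<close>. On a uniform mesh this is an affine change of variable and affects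
  neither the interface values nor the stencil selection.
\<close>

definition minmod :: "real \<Rightarrow> real \<Rightarrow> real" where
  "minmod a b = (if a * b > 0 then sgn a * min \<bar>a\<bar> \<bar>b\<bar> else 0)"

definition minmod_poly :: "(int \<Rightarrow> real) \<Rightarrow> int \<Rightarrow> real poly" where
  "minmod_poly g i = (let \<sigma> = minmod (g i - g (i - 1)) (g (i + 1) - g i) in
     [:g i - \<sigma> * of_int i, \<sigma>:])"

primrec undiv_diff :: "nat \<Rightarrow> (int \<Rightarrow> real) \<Rightarrow> int \<Rightarrow> real" where
  "undiv_diff 0 g m = g m"
| "undiv_diff (Suc n) g m = undiv_diff n g (m + 1) - undiv_diff n g m"

text \<open>
  Leftmost cell of the stencil of \<open>n + 1\<close> cells that the ENO procedure selects for cell \<open>i\<close>: starting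
  from cell \<open>i\<close> alone, the stencil is extended to the left if the undivided difference over the
  left-extended stencil is strictly smaller in modulus, and to the right otherwise.
\<close>

primrec eno_left :: "(int \<Rightarrow> real) \<Rightarrow> int \<Rightarrow> nat \<Rightarrow> int" where
  "eno_left g i 0 = i"
| "eno_left g i (Suc n) = (let s = eno_left g i n in
     if \<bar>undiv_diff (Suc n) g (s - 1)\<bar> < \<bar>undiv_diff (Suc n) g s\<bar> then s - 1 else s)"

definition cell_average :: "real poly \<Rightarrow> int \<Rightarrow> real" where
  "cell_average P m = integral {of_int m - 1/2 .. of_int m + 1/2} (poly P)"

text \<open>
  ENO reconstruction of order \<open>k\<close>: the unique polynomial of degree less than \<open>k\<close> whose averages
  over the \<open>k\<close> cells of the ENO stencil are the given data.
\<close>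

definition eno_poly :: "nat \<Rightarrow> (int \<Rightarrow> real) \<Rightarrow> int \<Rightarrow> real poly" where
  "eno_poly k g i = (let s = eno_left g i (k - 1) in
     (THE P. degree P < k \<and> (\<forall>m\<in>{s..<s + int k}. cell_average P m = g m)))"

definition recon_poly :: "nat \<Rightarrow> (int \<Rightarrow> real) \<Rightarrow> int \<Rightarrow> real poly" where
  "recon_poly k g i = (if k = 2 then minmod_poly g i else eno_poly k g i)"

text \<open>
  \<open>recon_entropy_var k ge gi R u i \<xi>\<close> reconstructs the scaled entropy variables \<open>R\<^sup>T V(u m)\<close> of the
  line \<open>u\<close> componentwise in cell \<open>i\<close>, evaluates at \<open>\<xi>\<close> and scales back. The matrix \<open>R\<close> belongs
  to the interface at which the polynomial is evaluated and is the same for all points \<open>m\<close> of the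
  stencil; both one-sided values at an interface thus reconstruct the same grid data, which is
  what makes the reconstructed jump keep the sign of \<open>R\<^sup>T (V(u (i + 1)) - V(u i))\<close>.
\<close>

definition recon_entropy_var ::
  "nat \<Rightarrow> real \<Rightarrow> real \<Rightarrow> real^5^5 \<Rightarrow> (int \<Rightarrow> state) \<Rightarrow> int \<Rightarrow> real \<Rightarrow> state" where
  "recon_entropy_var k ge gi R u i \<xi> = matrix_inv (transpose R) *v
     (\<chi> c. poly (recon_poly k (\<lambda>m. (transpose R *v entropy_var ge gi (u m)) $ c) i) \<xi>)"

definition recon_jump ::
  "nat \<Rightarrow> real \<Rightarrow> real \<Rightarrow> real^5^5 \<Rightarrow> (int \<Rightarrow> state) \<Rightarrow> int \<Rightarrow> state" where
  "recon_jump k ge gi R u i =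
     recon_entropy_var k ge gi R u (i + 1) (of_int i + 1/2)
     - recon_entropy_var k ge gi R u i (of_int i + 1/2)"

section \<open>Entropy stable fluxes and the scheme\<close>

text \<open>
  The argument \<open>s\<close> is the state at which the diffusion matrix of the interface \<open>(i + 1/2, j)\<close>,
  respectively \<open>(i, j + 1/2)\<close>, is evaluated.
\<close>

definition es_flux_x :: "nat \<Rightarrow> real \<Rightarrow> real \<Rightarrow> state \<Rightarrow> grid \<Rightarrow> int \<Rightarrow> int \<Rightarrow> state" where
  "es_flux_x k ge gi s U i j =
     central_flux k (ec_flux_x ge gi) (\<lambda>m. U m j) i
     - (1/2) *\<^sub>R (D_x ge gi s *v recon_jump k ge gi (R_x ge gi s) (\<lambda>m. U m j) i)"

definition es_flux_y :: "nat \<Rightarrow> real \<Rightarrow> real \<Rightarrow> state \<Rightarrow> grid \<Rightarrow> int \<Rightarrow> int \<Rightarrow> state" where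
  "es_flux_y k ge gi s U i j =
     central_flux k (ec_flux_y ge gi) (\<lambda>m. U i m) j
     - (1/2) *\<^sub>R (D_y ge gi s *v recon_jump k ge gi (R_y ge gi s) (\<lambda>m. U i m) j)"

definition es_entropy_flux_x ::
  "nat \<Rightarrow> real \<Rightarrow> real \<Rightarrow> state \<Rightarrow> grid \<Rightarrow> int \<Rightarrow> int \<Rightarrow> real" where
  "es_entropy_flux_x k ge gi s U i j =
     central_flux k (ec_entropy_flux_x ge gi) (\<lambda>m. U m j) i
     - 1/2 * (midpoint (entropy_var ge gi (U i j)) (entropy_var ge gi (U (i + 1) j))
         \<bullet> (D_x ge gi s *v recon_jump k ge gi (R_x ge gi s) (\<lambda>m. U m j) i))"

definition es_entropy_flux_y ::
  "nat \<Rightarrow> real \<Rightarrow> real \<Rightarrow> state \<Rightarrow> grid \<Rightarrow> int \<Rightarrow> int \<Rightarrow> real" where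
  "es_entropy_flux_y k ge gi s U i j =
     central_flux k (ec_entropy_flux_y ge gi) (\<lambda>m. U i m) j
     - 1/2 * (midpoint (entropy_var ge gi (U i j)) (entropy_var ge gi (U i (j + 1)))
         \<bullet> (D_y ge gi s *v recon_jump k ge gi (R_y ge gi s) (\<lambda>m. U i m) j))"

text \<open>
  In the following \<open>sx i j\<close> and \<open>sy i j\<close> are the interface states at \<open>(i + 1/2, j)\<close> and
  \<open>(i, j + 1/2)\<close>.
\<close>

definition scheme_rhs ::
  "nat \<Rightarrow> real \<Rightarrow> real \<Rightarrow> real \<Rightarrow> real \<Rightarrow> grid \<Rightarrow> grid \<Rightarrow> grid \<Rightarrow> int \<Rightarrow> int \<Rightarrow> state" where
  "scheme_rhs k ge gi dx dy sx sy U i j =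
     - ((1 / dx) *\<^sub>R (es_flux_x k ge gi (sx i j) U i j - es_flux_x k ge gi (sx (i - 1) j) U (i - 1) j))
     - (1 / dy) *\<^sub>R (es_flux_y k ge gi (sy i j) U i j - es_flux_y k ge gi (sy i (j - 1)) U i (j - 1))
     - C_x ge gi (U i j) *v central_diff k dx (\<lambda>m. U m j) i
     - C_y ge gi (U i j) *v central_diff k dy (\<lambda>m. U i m) j"

text \<open>Grid indices that the scheme at \<open>(i, j)\<close> can access, including the search for the ENO stencils.\<close>

definition stencil :: "nat \<Rightarrow> int \<Rightarrow> int \<Rightarrow> (int \<times> int) set" where
  "stencil k i j = {i - int k..i + int k} \<times> {j} \<union> {i} \<times> {j - int k..j + int k}"

text \<open>
  \<open>U\<close> solves the semi-discrete scheme for times in \<open>T\<close> on a mesh with index set \<open>G\<close>. The equation is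
  imposed where the stencil is available; all other mesh values are unconstrained boundary data.
\<close>

definition scheme_solution ::
  "nat \<Rightarrow> real \<Rightarrow> real \<Rightarrow> real \<Rightarrow> real \<Rightarrow> (int \<times> int) set \<Rightarrow> real set
     \<Rightarrow> (real \<Rightarrow> grid) \<Rightarrow> (real \<Rightarrow> grid) \<Rightarrow> (real \<Rightarrow> grid) \<Rightarrow> bool" where
  "scheme_solution k ge gi dx dy G T sx sy U \<longleftrightarrow>
     (\<forall>t\<in>T. \<forall>(i, j)\<in>G. U t i j \<in> admissible ge gi) \<and>
     (\<forall>t\<in>T. \<forall>i j. sx t i j \<in> admissible ge gi \<and> sy t i j \<in> admissible ge gi) \<and>
     (\<forall>t\<in>T. \<forall>i j. stencil k i j \<subseteq> G \<longrightarrow>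
        ((\<lambda>\<tau>. U \<tau> i j) has_vector_derivative
           scheme_rhs k ge gi dx dy (sx t) (sy t) (U t) i j) (at t within T))"

section \<open>Order of accuracy\<close>

primrec C_n_on :: "nat \<Rightarrow> 'a::real_normed_vector set \<Rightarrow> ('a \<Rightarrow> 'b::real_normed_vector) \<Rightarrow> bool" where
  "C_n_on 0 Q f \<longleftrightarrow> continuous_on Q f"
| "C_n_on (Suc n) Q f \<longleftrightarrow>
     (\<exists>f'. (\<forall>z\<in>Q. (f has_derivative f' z) (at z)) \<and> (\<forall>v. C_n_on n Q (\<lambda>z. f' z v)))"

definition smooth_field :: "'a::real_normed_vector set \<Rightarrow> ('a \<Rightarrow> 'b::real_normed_vector) \<Rightarrow> bool" where
  "smooth_field Q f \<longleftrightarrow> (\<forall>n. C_n_on n Q f)"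

text \<open>Fields are functions of \<open>(t, x, y)\<close>.\<close>

definition pde_lhs ::
  "real \<Rightarrow> real \<Rightarrow> (real \<times> real \<times> real \<Rightarrow> state) \<Rightarrow> real \<Rightarrow> real \<Rightarrow> real \<Rightarrow> state" where
  "pde_lhs ge gi w t x y =
     vector_derivative (\<lambda>\<tau>. w (\<tau>, x, y)) (at t)
     + vector_derivative (\<lambda>\<xi>. flux_x ge gi (w (t, \<xi>, y))) (at x)
     + vector_derivative (\<lambda>\<eta>. flux_y ge gi (w (t, x, \<eta>))) (at y)
     + C_x ge gi (w (t, x, y)) *v vector_derivative (\<lambda>\<xi>. w (t, \<xi>, y)) (at x)
     + C_y ge gi (w (t, x, y)) *v vector_derivative (\<lambda>\<eta>. w (t, x, \<eta>)) (at y)"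

text \<open>
  The mesh points are \<open>(x0 + i dx, y0 + j dy)\<close>. The local truncation error at \<open>(i, j)\<close> is the scheme
  minus the differential equation, both applied to \<open>w\<close>; if \<open>w\<close> solves the system, it is the residual
  of \<open>w\<close> in the scheme.
\<close>

definition truncation_error ::
  "nat \<Rightarrow> real \<Rightarrow> real \<Rightarrow> real \<Rightarrow> real \<Rightarrow> real \<Rightarrow> real \<Rightarrow> grid \<Rightarrow> grid
     \<Rightarrow> (real \<times> real \<times> real \<Rightarrow> state) \<Rightarrow> real \<Rightarrow> int \<Rightarrow> int \<Rightarrow> state" where
  "truncation_error k ge gi dx dy x0 y0 sx sy w t i j =
     (let x = (\<lambda>m. x0 + of_int m * dx); y = (\<lambda>m. y0 + of_int m * dy) in
       (vector_derivative (\<lambda>\<tau>. w (\<tau>, x i, y j)) (at t)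
          - scheme_rhs k ge gi dx dy sx sy (\<lambda>i j. w (t, x i, y j)) i j)
       - pde_lhs ge gi w t (x i) (y j))"

text \<open>
  Accuracy of order \<open>k\<close>, in the sense used for schemes in flux form with nonlinear reconstructions:
  up to errors of order \<open>k\<close> in the equation at the mesh points, the truncation error is caused
  by errors \<open>ax i j\<close>, \<open>ay i j\<close> of order \<open>k\<close> in the numerical fluxes at \<open>(i + 1/2, j)\<close> and
  \<open>(i, j + 1/2)\<close>. (The flux errors are one grid function on all interfaces; each is shared by its two
  adjacent cells.) A pointwise bound of the truncation error by the \<open>k\<close>-th powers of the mesh sizes
  does not hold in general, since MinMod slopes and ENO stencils change abruptly even for smooth
  data, e.g. at an extremum, where the flux errors are of order \<open>k\<close> but their differences not of
  order \<open>k + 1\<close>.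

  The bounds are uniform over compact sets of points \<open>(t, x, y)\<close> and over all choices of interface
  states from a compact set of admissible states.
\<close>

definition accurate_of_order :: "nat \<Rightarrow> real \<Rightarrow> real \<Rightarrow> bool" where
  "accurate_of_order k ge gi \<longleftrightarrow>
     (\<forall>Q w K Ks. open Q \<and> smooth_field Q w \<and> w ` Q \<subseteq> admissible ge gi \<and>
        compact K \<and> K \<subseteq> Q \<and> compact Ks \<and> Ks \<subseteq> admissible ge gi \<longrightarrow>
        (\<exists>B h0. h0 > 0 \<and>
          (\<forall>dx dy x0 y0 t sx sy. 0 < dx \<and> dx < h0 \<and> 0 < dy \<and> dy < h0 \<and>
             (\<forall>i j. sx i j \<in> Ks \<and> sy i j \<in> Ks) \<longrightarrow>
             (\<exists>ax ay :: grid. \<forall>i j. (t, x0 + of_int i * dx, y0 + of_int j * dy) \<in> K \<longrightarrow>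
                norm (ax i j) \<le> B * dx ^ k \<and> norm (ax (i - 1) j) \<le> B * dx ^ k \<and>
                norm (ay i j) \<le> B * dy ^ k \<and> norm (ay i (j - 1)) \<le> B * dy ^ k \<and>
                norm (truncation_error k ge gi dx dy x0 y0 sx sy w t i j
                      - (1 / dx) *\<^sub>R (ax i j - ax (i - 1) j)
                      - (1 / dy) *\<^sub>R (ay i j - ay i (j - 1)))
                  \<le> B * (dx ^ k + dy ^ k)))))"

end

theory Submission
  imports Defs
begin

text \<open>
  The proof combines an entropy balance, a sign property and a Taylor expansion.

  \<^bold>\<open>Entropy.\<close> By the chain rule the entropy changes at the rate \<open>V \<bullet> dU/dt\<close>. The nonconservative
  products drop out because \<open>V\<close> annihilates the ranges of both matrices (\<open>entropy_var_C_x\<close>). For the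
  two-point flux \<open>f\<close>, the identity \<open>(V r - V l) \<bullet> f l r = \<Phi> r - \<Phi> l\<close> with the entropy potential
  \<open>\<Phi>\<close> (\<open>ec_flux_x_jump\<close>) turns \<open>V \<bullet> f\<close> at either end into the two-point entropy flux plus the potential there, so that flux differences
  become entropy flux differences (\<open>line_entropy_balance\<close>). Since \<open>R\<^sup>T\<close> undoes the back-scaling
  by its inverse, the diffusion contributes \<open>\<lambda>\<close> times the inner product of the jump of the
  scaled entropy variables with their reconstructed jump. This has a sign because the
  reconstructions preserve signs.

  \<^bold>\<open>Reconstruction.\<close> Two interpolants of \<open>k\<close> cell averages whose stencils are shifted by one cell have
  interface values that differ by a multiple of the \<open>k\<close>-th undivided difference over the union of
  the stencils, with a coefficient whose sign alternates with the position of the stencil. The jump at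
  an interface is thus a sum of such terms between the stencils of its two cells (\<open>eno_jump_eq_sum\<close>).
  The ENO selection makes the differences in this range alternate as well (\<open>eno_left_sign\<close>),
  and hence all terms have the sign of the jump of the data. The same formula bounds the
  jump by \<open>k\<close>-th undivided differences, which are \<open>O(h^k)\<close> for smooth data and zero for constant data.
  For the MinMod slopes both properties follow directly from \<open>minmod_bounds\<close>.

  \<^bold>\<open>Accuracy.\<close> For smooth \<open>w\<close> and a symmetric two-point flux \<open>F\<close>, let \<open>G z h = F (w z) (w (z + h e))\<close>.
  The difference of central fluxes is a combination of \<open>G z h - G z (- h)\<close> and
  \<open>G z (2 h) - G z (- 2 h)\<close>, so only odd terms of the Taylor expansion in \<open>h\<close> survive, and the weights
  cancel the cubic one at fourth order. Symmetry also gives \<open>2 \<partial>\<^sub>h G z 0\<close> as the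
  derivative of the flux \<open>F (w z) (w z)\<close> along \<open>e\<close>. The central differences are the same
  construction with the arithmetic mean in place of \<open>F\<close>. The remaining diffusion terms are
  interface quantities of order \<open>k\<close> and serve as the flux errors.

  The \<open>y\<close>-direction follows from the \<open>x\<close>-direction by exchanging the two momentum components.
\<close>

section \<open>Vectors with five components and exchange of the momenta\<close>

lemma exhaust_5:
  fixes x :: 5
  shows "x = 1 \<or> x = 2 \<or> x = 3 \<or> x = 4 \<or> x = 5"
proof (induct x)
  case (of_int z)
  then have "0 \<le> z" and "z < 5" by simp_all
  then have "z = 0 \<or> z = 1 \<or> z = 2 \<or> z = 3 \<or> z = 4" by arith
  then show ?case by auto
qed

lemma forall_5: "(\<forall>i::5. P i) \<longleftrightarrow> P 1 \<and> P 2 \<and> P 3 \<and> P 4 \<and> P 5"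
  by (metis exhaust_5)

lemma UNIV_5: "(UNIV :: 5 set) = {1, 2, 3, 4, 5}"
  using exhaust_5 by auto

lemma sum_5: "sum f (UNIV :: 5 set) = f 1 + f 2 + f 3 + f 4 + f 5"
  unfolding UNIV_5 by (simp add: add.assoc)

lemma vector_5 [simp]:
  "(vector [a, b, c, d, e] :: 'a::zero^5) $ 1 = a"
  "(vector [a, b, c, d, e] :: 'a::zero^5) $ 2 = b"
  "(vector [a, b, c, d, e] :: 'a::zero^5) $ 3 = c"
  "(vector [a, b, c, d, e] :: 'a::zero^5) $ 4 = d"
  "(vector [a, b, c, d, e] :: 'a::zero^5) $ 5 = e"
  unfolding vector_def by auto

lemma inner_5: "(x :: real^5) \<bullet> y = x$1 * y$1 + x$2 * y$2 + x$3 * y$3 + x$4 * y$4 + x$5 * y$5"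
  by (simp add: inner_vec_def sum_5)

lemma vec_eq_5:
  "(x :: 'a^5) = y \<longleftrightarrow> x$1 = y$1 \<and> x$2 = y$2 \<and> x$3 = y$3 \<and> x$4 = y$4 \<and> x$5 = y$5"
  by (simp add: vec_eq_iff forall_5)

text \<open>
  Reflection at the diagonal. It exchanges the velocity components and leaves all scalar
  thermodynamic quantities unchanged; every \<open>y\<close>-object is the conjugate of its \<open>x\<close>-counterpart.
\<close>

definition swap :: "state \<Rightarrow> state" where
  "swap U = vector [U$1, U$3, U$2, U$4, U$5]"

lemma swap_nth [simp]:
  "swap U $ 1 = U$1" "swap U $ 2 = U$3" "swap U $ 3 = U$2" "swap U $ 4 = U$4" "swap U $ 5 = U$5"
  by (simp_all add: swap_def)

lemma swap_swap [simp]: "swap (swap U) = U"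
  by (simp add: vec_eq_5)

lemma inner_swap: "swap x \<bullet> swap y = x \<bullet> y"
  by (simp add: inner_5)

lemma inner_swap_left: "x \<bullet> swap y = swap x \<bullet> y"
  by (simp add: inner_5)

lemma swap_add: "swap (x + y) = swap x + swap y"
  and swap_diff: "swap (x - y) = swap x - swap y"
  and swap_scaleR: "swap (c *\<^sub>R x) = c *\<^sub>R swap x"
  by (simp_all add: vec_eq_5)

lemma swap_midpoint: "swap (midpoint x y) = midpoint (swap x) (swap y)"
  by (simp add: midpoint_def swap_add swap_scaleR)

lemma primitive_swap [simp]:
  "dens (swap U) = dens U" "vel_x (swap U) = vel_y U" "vel_y (swap U) = vel_x U"
  "energy (swap U) = energy U" "p_ion (swap U) = p_ion U" "speed_sq (swap U) = speed_sq U"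
  "p_el ge gi (swap U) = p_el ge gi U" "beta_e ge gi (swap U) = beta_e ge gi U"
  "beta_i (swap U) = beta_i U" "spec_entropy ge gi (swap U) = spec_entropy ge gi U"
  by (simp_all add: dens_def vel_x_def vel_y_def energy_def p_ion_def speed_sq_def p_el_def
      beta_e_def beta_i_def spec_entropy_def add.commute)

lemma swap_admissible [simp]: "swap U \<in> admissible ge gi \<longleftrightarrow> U \<in> admissible ge gi"
  by (simp add: admissible_def)

lemma entropy_var_swap: "entropy_var ge gi (swap U) = swap (entropy_var ge gi U)"
  by (simp add: vec_eq_5 entropy_var_def)

lemma flux_y_swap: "flux_y ge gi U = swap (flux_x ge gi (swap U))"
  by (simp add: vec_eq_5 flux_x_def flux_y_def mult.commute mult.left_commute)

lemma entropy_flux_y_swap: "entropy_flux_y ge gi U = entropy_flux_x ge gi (swap U)"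
  by (simp add: entropy_flux_x_def entropy_flux_y_def)

lemma potential_y_swap: "potential_y ge gi U = potential_x ge gi (swap U)"
  by (simp add: potential_x_def potential_y_def entropy_var_swap flux_y_swap entropy_flux_y_swap
      inner_swap_left)

lemma ec_flux_y_swap: "ec_flux_y ge gi Ul Ur = swap (ec_flux_x ge gi (swap Ul) (swap Ur))"
  by (simp add: vec_eq_5 ec_flux_x_def ec_flux_y_def Let_def)

lemma ec_entropy_flux_y_swap:
  "ec_entropy_flux_y ge gi Ul Ur = ec_entropy_flux_x ge gi (swap Ul) (swap Ur)"
  by (simp add: ec_entropy_flux_x_def ec_entropy_flux_y_def potential_y_swap ec_flux_y_swap
      entropy_var_swap inner_swap_left swap_midpoint)

lemma C_y_swap: "C_y ge gi U *v a = swap (C_x ge gi (swap U) *v swap a)"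
  by (simp add: vec_eq_5 matrix_vector_mult_def sum_5 C_x_def C_y_def Let_def algebra_simps)

section \<open>Entropy identities of the two-point fluxes\<close>

lemma admissible_pos:
  assumes "U \<in> admissible ge gi"
  shows "dens U > 0" "p_el ge gi U > 0" "p_ion U > 0" "beta_e ge gi U > 0" "beta_i U > 0"
  using assms by (auto simp: admissible_def beta_e_def beta_i_def)

lemma log_mean_pos:
  assumes "a > 0" "b > 0"
  shows "log_mean a b > 0"
proof (cases "a < b")
  case True
  then show ?thesis using assms by (simp add: log_mean_def)
next
  case False
  then show ?thesis using assms
    by (cases "a = b") (auto simp: log_mean_def intro!: divide_neg_neg)
qed

lemma log_mean_commute: "log_mean a b = log_mean b a"
  unfolding log_mean_def by (metis minus_diff_eq minus_divide_divide)

text \<open>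
  This is what the logarithmic mean is made for: it exchanges the jump of a logarithm for the jump
  of its argument.
\<close>

lemma ln_jump:
  assumes "a > 0" "b > 0"
  shows "(ln b - ln a) * log_mean a b = b - a"
  using assms by (simp add: log_mean_def)

lemma ec_flux_x_commute: "ec_flux_x ge gi Ul Ur = ec_flux_x ge gi Ur Ul"
  unfolding ec_flux_x_def Let_def by (simp only: midpoint_sym log_mean_commute)

context
  fixes ge gi :: real
  assumes ge: "ge > 1" and gi: "gi > 1"
begin

lemma energy_eq: "energy U = p_el ge gi U / (ge - 1) + p_ion U / (gi - 1) + dens U * speed_sq U / 2"
  using ge by (simp add: p_el_def)

text \<open>
  In the variables \<open>\<rho>\<close>, \<open>\<beta>\<^sub>e\<close>, \<open>\<beta>\<^sub>i\<close> the entropy is a sum of logarithms with constant coefficients, so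
  its jump is a combination of the jumps in the denominators of the logarithmic means.
\<close>

lemma spec_entropy_beta:
  assumes "U \<in> admissible ge gi"
  shows "spec_entropy ge gi U =
    - (ln (beta_e ge gi U) / (ge - 1) + ln (beta_i U) / (gi - 1) + 2 * ln (dens U))"
proof -
  note pos = admissible_pos[OF assms]
  have "ln (p_el ge gi U / dens U powr ge) = - ln (beta_e ge gi U) - (ge - 1) * ln (dens U)"
    using pos by (simp add: beta_e_def ln_div ln_powr algebra_simps)
  moreover have "ln (p_ion U / dens U powr gi) = - ln (beta_i U) - (gi - 1) * ln (dens U)"
    using pos by (simp add: beta_i_def ln_div ln_powr algebra_simps)
  ultimately show ?thesis
    using ge gi by (simp add: spec_entropy_def diff_divide_distrib)
qed

lemma potential_x_eq:
  assumes "U \<in> admissible ge gi"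
  shows "potential_x ge gi U = 2 * dens U * vel_x U"
proof -
  note pos = admissible_pos[OF assms]
  define r vx vy pe p s where defs: "r = dens U" "vx = vel_x U" "vy = vel_y U"
    "pe = p_el ge gi U" "p = p_ion U" "s = spec_entropy ge gi U"
  define be bi where b: "be = beta_e ge gi U" "bi = beta_i U"
  define G H where GH: "G = 1 / (ge - 1)" "H = 1 / (gi - 1)"
  have c: "ge / (ge - 1) = 1 + G" "gi / (gi - 1) = 1 + H"
    using ge gi by (simp_all add: GH field_simps)
  have r: "be * pe = r" "bi * p = r" using pos by (simp_all add: defs b beta_e_def beta_i_def)
  have "entropy_var ge gi U \<bullet> flux_x ge gi U =
     (2 + G + H - s - be * (vx\<^sup>2 + vy\<^sup>2) / 2) * (r * vx)
     + be * vx * (r * vx\<^sup>2 + 2 * pe) + be * vy * (r * vx * vy)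
     - be * ((pe * G + p * H + r * (vx\<^sup>2 + vy\<^sup>2) / 2 + 2 * pe) * vx)
     + (be - bi) * H * (p * vx)"
    unfolding inner_5 entropy_var_def flux_x_def
    by (simp add: energy_eq c defs b GH speed_sq_def)
  also have "\<dots> = 2 * r * vx - s * (r * vx) + G * vx * (r - be * pe) + H * vx * (r - bi * p)"
    by (simp add: field_simps power2_eq_square)
  also have "\<dots> = 2 * r * vx - s * (r * vx)"
    by (simp add: r)
  finally show ?thesis by (simp add: potential_x_def entropy_flux_x_def defs)
qed

text \<open>
  Tadmor's condition for entropy conservation. Each of the means in the flux matches one
  jump: the logarithmic means absorb \<open>ln \<rho>\<close>, \<open>ln \<beta>\<^sub>e\<close>, \<open>ln \<beta>\<^sub>i\<close>, and the momentum flux is chosen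
  so that the terms with \<open>\<beta>\<^sub>e v\<close> and \<open>\<beta>\<^sub>e \<bar>v\<bar>\<^sup>2\<close> leave only \<open>2 \<rho> v\<^sub>x\<close>, the potential.
\<close>

lemma ec_flux_x_jump:
  assumes "Ul \<in> admissible ge gi" "Ur \<in> admissible ge gi"
  shows "(entropy_var ge gi Ur - entropy_var ge gi Ul) \<bullet> ec_flux_x ge gi Ul Ur
         = potential_x ge gi Ur - potential_x ge gi Ul"
proof -
  note posl = admissible_pos[OF assms(1)] and posr = admissible_pos[OF assms(2)]
  define rl rr bl br cl cr where d1: "rl = dens Ul" "rr = dens Ur"
    "bl = beta_e ge gi Ul" "br = beta_e ge gi Ur" "cl = beta_i Ul" "cr = beta_i Ur"
  define xl xr yl yr where d2: "xl = vel_x Ul" "xr = vel_x Ur" "yl = vel_y Ul" "yr = vel_y Ur"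
  define f1 where "f1 = log_mean rl rr * ((xl + xr) / 2)"
  define f2 where "f2 = 2 * ((rl + rr) / 2) / ((bl + br) / 2) + (xl + xr) / 2 * f1"
  define f5 where "f5 = f1 / log_mean cl cr"
  define A where "A = 1 / ((ge - 1) * log_mean bl br)"
  define gi' where "gi' = 1 / (gi - 1)"
  define X Y Z where "X = ln rr - ln rl" "Y = (ln br - ln bl) / (ge - 1)"
    "Z = (ln cr - ln cl) / (gi - 1)"
  have g: "ge - 1 \<noteq> 0" "gi - 1 \<noteq> 0" using ge gi by auto
  have L: "log_mean rl rr \<noteq> 0" "log_mean bl br \<noteq> 0" "log_mean cl cr \<noteq> 0"
    using log_mean_pos[of rl rr] log_mean_pos[of bl br] log_mean_pos[of cl cr] posl posr
    by (auto simp: d1)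
  have X: "f1 * X = (xl + xr) / 2 * (rr - rl)"
    using ln_jump[of rl rr] posl posr unfolding f1_def X_Y_Z_def d1[symmetric]
    by (metis mult.assoc mult.commute)
  have "ln br - ln bl = (br - bl) / log_mean bl br"
    using ln_jump[of bl br] posl posr L unfolding d1[symmetric] by (simp add: field_simps)
  then have Y: "Y = (br - bl) * A" by (simp add: X_Y_Z_def A_def)
  have "ln cr - ln cl = (cr - cl) / log_mean cl cr"
    using ln_jump[of cl cr] posl posr L unfolding d1[symmetric] by (simp add: field_simps)
  then have Z: "f1 * Z = (cr - cl) * gi' * f5" by (simp add: X_Y_Z_def f5_def gi'_def mult_ac)
  have "bl + br > 0" using posl posr by (simp add: d1)
  then have f2: "(bl + br) * (f2 - (xl + xr) / 2 * f1) = 2 * (rl + rr)"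
    unfolding f2_def by (simp add: divide_simps) (simp add: algebra_simps)
  have flux: "ec_flux_x ge gi Ul Ur $ 1 = f1" "ec_flux_x ge gi Ul Ur $ 2 = f2"
    "ec_flux_x ge gi Ul Ur $ 3 = (yl + yr) / 2 * f1" "ec_flux_x ge gi Ul Ur $ 5 = f5"
    "ec_flux_x ge gi Ul Ur $ 4 = (A - (xl\<^sup>2 + yl\<^sup>2 + (xr\<^sup>2 + yr\<^sup>2)) / 2 / 2) * f1
       + (xl + xr) / 2 * f2 + (yl + yr) / 2 * ((yl + yr) / 2 * f1) + f5 * gi'"
  proof -
    have mid: "midpoint a b = (a + b) / 2" for a b :: real by (simp add: midpoint_def)
    show "ec_flux_x ge gi Ul Ur $ 1 = f1" "ec_flux_x ge gi Ul Ur $ 2 = f2"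
      "ec_flux_x ge gi Ul Ur $ 3 = (yl + yr) / 2 * f1" "ec_flux_x ge gi Ul Ur $ 5 = f5"
      "ec_flux_x ge gi Ul Ur $ 4 = (A - (xl\<^sup>2 + yl\<^sup>2 + (xr\<^sup>2 + yr\<^sup>2)) / 2 / 2) * f1
       + (xl + xr) / 2 * f2 + (yl + yr) / 2 * ((yl + yr) / 2 * f1) + f5 * gi'"
      unfolding ec_flux_x_def Let_def vector_5 mid speed_sq_def d1[symmetric] d2[symmetric]
      unfolding f1_def[symmetric]
      unfolding f2_def[symmetric] f5_def[symmetric] A_def[symmetric] gi'_def
      by simp_all
  qed
  have jump: "entropy_var ge gi Ur $ 1 - entropy_var ge gi Ul $ 1
      = 2 * X + Y + Z - (br * (xr\<^sup>2 + yr\<^sup>2) / 2 - bl * (xl\<^sup>2 + yl\<^sup>2) / 2)"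
    "entropy_var ge gi Ur $ 5 - entropy_var ge gi Ul $ 5 = ((br - cr) - (bl - cl)) * gi'"
    unfolding entropy_var_def vector_5 spec_entropy_beta[OF assms(1)] spec_entropy_beta[OF assms(2)]
      speed_sq_def d1[symmetric] d2[symmetric] X_Y_Z_def gi'_def
    by (simp_all add: diff_divide_distrib)
  have "(entropy_var ge gi Ur - entropy_var ge gi Ul) \<bullet> ec_flux_x ge gi Ul Ur
     = (2 * X + Y + Z - (br * (xr\<^sup>2 + yr\<^sup>2) / 2 - bl * (xl\<^sup>2 + yl\<^sup>2) / 2)) * f1
       + (br * xr - bl * xl) * f2 + (br * yr - bl * yl) * ((yl + yr) / 2 * f1)
       - (br - bl) * ((A - (xl\<^sup>2 + yl\<^sup>2 + (xr\<^sup>2 + yr\<^sup>2)) / 2 / 2) * f1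
            + (xl + xr) / 2 * f2 + (yl + yr) / 2 * ((yl + yr) / 2 * f1) + f5 * gi')
       + ((br - cr) - (bl - cl)) * gi' * f5"
  proof -
    have *: "entropy_var ge gi Ur $ 2 - entropy_var ge gi Ul $ 2 = br * xr - bl * xl"
      "entropy_var ge gi Ur $ 3 - entropy_var ge gi Ul $ 3 = br * yr - bl * yl"
      "entropy_var ge gi Ur $ 4 - entropy_var ge gi Ul $ 4 = - (br - bl)"
      unfolding entropy_var_def vector_5 d1 d2 by simp_all
    show ?thesis
      unfolding inner_5 vector_minus_component jump * flux by (simp only: mult_minus_left diff_conv_add_uminus)
  qed
  also have "\<dots> = 2 * (f1 * X) + (f1 * Z - (cr - cl) * gi' * f5) + f1 * (Y - (br - bl) * A)
       + (xr - xl) / 2 * ((bl + br) * (f2 - (xl + xr) / 2 * f1))"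
    by (simp add: field_simps power2_eq_square)
  also have "\<dots> = 2 * rr * xr - 2 * rl * xl"
    unfolding X Y Z f2 by (simp add: field_simps)
  finally show ?thesis
    by (simp add: potential_x_eq assms d1 d2)
qed

lemma ec_flux_x_consistent:
  assumes "U \<in> admissible ge gi"
  shows "ec_flux_x ge gi U U = flux_x ge gi U"
proof -
  note pos = admissible_pos[OF assms]
  define A where "A = 1 / ((ge - 1) * beta_e ge gi U)"
  have A: "A * dens U = p_el ge gi U / (ge - 1)"
    using pos by (simp add: A_def beta_e_def)
  have "(A - speed_sq U / 2) * (dens U * vel_x U)
       + vel_x U * (2 * p_el ge gi U + dens U * (vel_x U)\<^sup>2) + vel_y U * (dens U * vel_x U * vel_y U)
       + p_ion U * vel_x U / (gi - 1)
     = (A * dens U + p_ion U / (gi - 1) + dens U * speed_sq U / 2 + 2 * p_el ge gi U) * vel_x U"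
    by (simp add: speed_sq_def field_simps power2_eq_square)
  then have "(A - speed_sq U / 2) * (dens U * vel_x U)
       + vel_x U * (2 * p_el ge gi U + dens U * (vel_x U)\<^sup>2) + vel_y U * (dens U * vel_x U * vel_y U)
       + p_ion U * vel_x U / (gi - 1) = (energy U + 2 * p_el ge gi U) * vel_x U"
    by (simp add: energy_eq A)
  then show ?thesis using pos
    unfolding vec_eq_5 ec_flux_x_def flux_x_def Let_def
    by (simp add: log_mean_def A_def beta_e_def beta_i_def algebra_simps power2_eq_square)
qed

text \<open>
  The energy row of the matrix is \<open>v\<^sub>x\<close> times the momentum row plus \<open>(p\<^sub>i - p\<^sub>e) / \<rho>\<close> times
  \<open>a\<^sub>2 - v\<^sub>x a\<^sub>1\<close>, and the pressure row is a multiple of this velocity increment too. Hence the product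
  is a multiple of \<open>\<beta>\<^sub>e p\<^sub>e - \<beta>\<^sub>i p\<^sub>i = \<rho> - \<rho>\<close>.
\<close>

lemma entropy_var_C_x:
  assumes "U \<in> admissible ge gi"
  shows "entropy_var ge gi U \<bullet> (C_x ge gi U *v a) = 0"
proof -
  note pos = admissible_pos[OF assms]
  define vx where "vx = vel_x U"
  define m where "m = (p_ion U - p_el ge gi U) / dens U"
  define c where "c = (C_x ge gi U *v a) $ 2"
  have rows: "(C_x ge gi U *v a) $ 1 = 0" "(C_x ge gi U *v a) $ 3 = 0"
    "(C_x ge gi U *v a) $ 4 = vx * c + m * (a$2 - vx * a$1)"
    "(C_x ge gi U *v a) $ 5 = (gi - 1) * (p_ion U / dens U * (a$2 - vx * a$1))"
    using pos by (simp_all add: c_def matrix_vector_mult_def sum_5 C_x_def Let_def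
        vx_def[symmetric] m_def field_simps power2_eq_square)
  have "entropy_var ge gi U \<bullet> (C_x ge gi U *v a) =
      (a$2 - vx * a$1) * ((beta_e ge gi U - beta_i U) * (p_ion U / dens U) - beta_e ge gi U * m)"
  proof -
    define w where "w = a$2 - vx * a$1"
    define P where "P = p_ion U / dens U"
    have e: "(beta_e ge gi U - beta_i U) / (gi - 1) * ((gi - 1) * (P * w))
        = (beta_e ge gi U - beta_i U) * (P * w)"
      using gi by simp
    show ?thesis
      unfolding inner_5 rows c_def[symmetric] w_def[symmetric] P_def[symmetric] entropy_var_def vector_5
        vx_def[symmetric] e
      by (simp add: algebra_simps)
  qed
  also have "(beta_e ge gi U - beta_i U) * (p_ion U / dens U) - beta_e ge gi U * m = 0"
    using pos by (simp add: m_def beta_e_def beta_i_def field_simps)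
  finally show ?thesis by simp
qed

end

section \<open>Sign and size of reconstructed jumps\<close>

lemma mult_diff_nonneg_if_abs_le:
  fixes e a b :: real
  assumes "\<bar>a\<bar> \<le> \<bar>b\<bar>" "e * b \<ge> 0"
  shows "e * (b - a) \<ge> 0"
proof -
  have "e * a \<le> \<bar>e\<bar> * \<bar>a\<bar>" by (metis abs_ge_self abs_mult)
  also have "\<dots> \<le> \<bar>e\<bar> * \<bar>b\<bar>" using assms by (simp add: mult_left_mono)
  also have "\<dots> = e * b" using assms(2) by (metis abs_mult abs_of_nonneg)
  finally show ?thesis by (simp add: algebra_simps)
qed

text \<open>
  Between the stencils of two neighbouring cells the undivided differences alternate in sign, starting
  from the sign of the jump itself; this is the heart of the sign property of ENO. In the induction
  step a new difference is that of two old ones. If both lie in the old range they have opposite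
  signs and reinforce each other. At an end of the range one of them may lie outside, but the
  selection rule then ensures that it is the smaller one in modulus. If the two old
  stencils coincide, both cells compare the same differences and the new stencils coincide as well.
  The factor \<open>e\<close> stands for the sign of the jump; any number of that sign will do, for example the
  jump itself.
\<close>

lemma eno_left_sign:
  assumes "e * (g (i + 1) - g i) \<ge> 0"
  shows "eno_left g i n \<le> eno_left g (i + 1) n \<and>
    (\<forall>s. eno_left g i n \<le> s \<longrightarrow> s < eno_left g (i + 1) n \<longrightarrow>
        e * (if even (int n + (i - s)) then 1 else -1) * undiv_diff (Suc n) g s \<ge> 0)"
proof (induction n)
  case 0
  then show ?case using assms by auto
next
  case (Suc n)
  define a b where "a = eno_left g i n" "b = eno_left g (i + 1) n"
  define a' b' where "a' = eno_left g i (Suc n)" "b' = eno_left g (i + 1) (Suc n)"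
  define D where "D = undiv_diff (Suc n) g"
  define \<epsilon> where "\<epsilon> n s = e * (if even (int n + (i - s)) then 1 else -1 :: real)" for n s
  have \<epsilon>: "\<epsilon> (Suc n) s = \<epsilon> n (s + 1)" "\<epsilon> (Suc n) s = - \<epsilon> n s" for s
    by (auto simp: \<epsilon>_def)
  have a': "a' = (if \<bar>D (a - 1)\<bar> < \<bar>D a\<bar> then a - 1 else a)"
    and b': "b' = (if \<bar>D (b - 1)\<bar> < \<bar>D b\<bar> then b - 1 else b)"
    by (simp_all add: a'_b'_def a_b_def D_def Let_def)
  have le: "a \<le> b" and IH: "\<And>s. a \<le> s \<Longrightarrow> s < b \<Longrightarrow> \<epsilon> n s * D s \<ge> 0"
    using Suc by (auto simp: a_b_def \<epsilon>_def D_def)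
  show ?case
  proof (cases "a = b")
    case True
    then have "a' = b'" using a' b' by simp
    then show ?thesis by (simp add: a'_b'_def)
  next
    case False
    then have lt: "a < b" using le by simp
    have "\<epsilon> (Suc n) s * (D (s + 1) - D s) \<ge> 0" if s: "a' \<le> s" "s < b'" for s
    proof -
      \<comment> \<open>new on the left, interior, or new on the right\<close>
      consider "s < a" | "a \<le> s" "s + 1 < b" | "s + 1 \<ge> b" "a \<le> s" by linarith
      then show ?thesis
      proof cases
        case 1
        then have *: "s = a - 1" "\<bar>D (a - 1)\<bar> < \<bar>D a\<bar>"
          using s a' by (auto split: if_splits)
        have "\<epsilon> n a * D a \<ge> 0" using IH lt by simp
        from mult_diff_nonneg_if_abs_le[OF _ this, of "D (a - 1)"] show ?thesis
          using * by (simp add: \<epsilon>(1))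
      next
        case 2
        then have "\<epsilon> n (s + 1) * D (s + 1) \<ge> 0" "\<epsilon> n s * D s \<ge> 0" using IH by simp_all
        moreover have "\<epsilon> n s = - \<epsilon> n (s + 1)" using \<epsilon>[of s] by linarith
        ultimately show ?thesis using \<epsilon>(1)[of s] by (simp add: right_diff_distrib)
      next
        case 3
        then have *: "s = b - 1" "\<not> \<bar>D (b - 1)\<bar> < \<bar>D b\<bar>"
          using s b' by (auto split: if_splits)
        have "\<epsilon> n (b - 1) * D (b - 1) \<ge> 0" using IH lt by simp
        from mult_diff_nonneg_if_abs_le[OF _ this, of "D b"] show ?thesis
          using * by (simp add: \<epsilon>(2) right_diff_distrib)
      qed
    qed
    moreover have "a' \<le> b'" using lt a' b' by auto
    ultimately show ?thesis by (simp add: a'_b'_def \<epsilon>_def D_def)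
  qed
qed

lemma eno_left_bounds: "i - int n \<le> eno_left g i n \<and> eno_left g i n \<le> i"
  by (induction n) (auto simp: Let_def)

lemma cell_average_cubic:
  "cell_average [:a, b, c, d:] m =
    a + b * of_int m + c * ((of_int m)\<^sup>2 + 1 / 12) + d * ((of_int m)^3 + of_int m / 4)"
proof -
  define F where "F y = a * y + b * y\<^sup>2 / 2 + c * y^3 / 3 + d * y^4 / 4" for y :: real
  have "(poly [:a, b, c, d:] has_integral F (of_int m + 1/2) - F (of_int m - 1/2))
     {of_int m - 1/2 .. of_int m + 1/2}"
  proof (rule fundamental_theorem_of_calculus)
    fix x :: real
    show "(F has_vector_derivative poly [:a, b, c, d:] x) (at x within {of_int m - 1/2 .. of_int m + 1/2})"
      unfolding F_def has_real_derivative_iff_has_vector_derivative[symmetric]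
      by (auto intro!: derivative_eq_intros simp: algebra_simps power2_eq_square power3_eq_cube)
  qed simp
  then show ?thesis
    by (simp add: cell_average_def integral_unique F_def field_simps power2_eq_square
        power3_eq_cube power4_eq_xxxx)
qed

lemma degree_less_4_cases:
  assumes "degree (P :: 'a::comm_ring_1 poly) < 4"
  shows "P = [:coeff P 0, coeff P 1, coeff P 2, coeff P 3:]"
proof (rule poly_eqI)
  fix n
  have "coeff P n = 0" if "n \<ge> 4" using assms that by (simp add: coeff_eq_0)
  then show "coeff P n = coeff [:coeff P 0, coeff P 1, coeff P 2, coeff P 3:] n"
    by (auto simp: coeff_pCons split: nat.split)
      (metis One_nat_def Suc_1 eval_nat_numeral(3) numeral_3_eq_3)+
qed


lemma degree_less_3_cases:
  assumes "degree (P :: 'a::comm_ring_1 poly) < 3"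
  shows "P = [:coeff P 0, coeff P 1, coeff P 2:]"
proof -
  have "coeff P 3 = 0" using assms by (simp add: coeff_eq_0)
  then show ?thesis using degree_less_4_cases[of P] assms by simp
qed

lemma cell_average_quadratic:
  "cell_average [:a, b, c:] m = a + b * of_int m + c * ((of_int m)\<^sup>2 + 1 / 12)"
  using cell_average_cubic[of a b c 0 m] by simp

definition interpolates :: "nat \<Rightarrow> (int \<Rightarrow> real) \<Rightarrow> int \<Rightarrow> real poly \<Rightarrow> bool" where
  "interpolates k g s P \<longleftrightarrow> degree P < k \<and> (\<forall>m\<in>{s..<s + int k}. cell_average P m = g m)"

lemma int_interval_4: "{s..<s + 4} = {s, s + 1, s + 2, s + 3 :: int}"
  by auto

lemma int_interval_3: "{s..<s + 3} = {s, s + 1, s + 2 :: int}"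
  by auto

lemma undiv_diff_simps:
  "undiv_diff 2 g s = g (s + 2) - 2 * g (s + 1) + g s"
  "undiv_diff 3 g s = g (s + 3) - 3 * g (s + 2) + 3 * g (s + 1) - g s"
  "undiv_diff 4 g s = g (s + 4) - 4 * g (s + 3) + 6 * g (s + 2) - 4 * g (s + 1) + g s"
  by (simp_all add: numeral_eq_Suc algebra_simps)

text \<open>
  Newton interpolation at the shifted origin \<open>s\<close>, corrected for the averages of \<open>\<xi>\<^sup>2\<close> and \<open>\<xi>\<^sup>3\<close>, which
  exceed the midpoint values by \<open>1/12\<close> and \<open>\<xi>/4\<close>.
\<close>

lemma interpolates_exists:
  assumes "k \<in> {3, 4}"
  shows "\<exists>P. interpolates k g s P"
proof -
  define D1 D2 where "D1 = g (s + 1) - g s" and "D2 = undiv_diff 2 g s"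
  define D3 where "D3 = (if k = 4 then undiv_diff 3 g s else 0)"
  define d where "d = D3 / 6"
  define c where "c = D2 / 2 - D3 / 2"
  define b where "b = D1 - D2 / 2 + D3 / 3 - d / 4"
  define a where "a = g s - c / 12"
  define x :: real where "x = of_int s"
  \<comment> \<open>the polynomial \<open>a + b y + c y^2 + d y^3\<close> in \<open>y = \<xi> - s\<close>, expanded in \<open>\<xi>\<close>\<close>
  define P where "P = [:a - b * x + c * x\<^sup>2 - d * x^3, b - 2 * c * x + 3 * d * x\<^sup>2, c - 3 * d * x, d:]"
  have avg: "cell_average P (s + n) =
      a + b * of_int n + c * ((of_int n)\<^sup>2 + 1 / 12) + d * ((of_int n)^3 + of_int n / 4)" for n
    unfolding P_def cell_average_cubic of_int_add x_def[symmetric]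
    by (simp add: field_simps power2_eq_square power3_eq_cube)
  have "cell_average P s = g s" "cell_average P (s + 1) = g (s + 1)"
    "cell_average P (s + 2) = g (s + 2)"
    using avg[of 0] avg[of 1] avg[of 2]
    by (simp_all add: a_def b_def c_def d_def D1_def D2_def undiv_diff_simps field_simps)
  moreover have "k = 4 \<Longrightarrow> cell_average P (s + 3) = g (s + 3)"
    using avg[of 3]
    by (simp add: a_def b_def c_def d_def D1_def D2_def D3_def undiv_diff_simps field_simps)
  moreover have "degree P < k"
    using assms by (auto simp: P_def d_def D3_def)
  ultimately have "interpolates k g s P"
    using assms by (auto simp: interpolates_def int_interval_3 int_interval_4)
  then show ?thesis ..
qed

text \<open>
  With the coefficients recentred at cell \<open>i\<close>, the averages over its neighbours and the values nearby are
  combinations of them with numerical weights, independent of \<open>i\<close>.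
\<close>

lemma cell_average_centred:
  fixes i :: int
  assumes "degree P < 4"
  shows "\<exists>p q r t.
    (\<forall>n. cell_average P (i + n) =
       p + q * of_int n + r * ((of_int n)\<^sup>2 + 1 / 12) + t * ((of_int n)^3 + of_int n / 4)) \<and>
    (\<forall>y. poly P (of_int i + y) = p + q * y + r * y\<^sup>2 + t * y^3) \<and> (degree P < 3 \<longrightarrow> t = 0)"
proof -
  obtain a b c d where P: "P = [:a, b, c, d:]" and d: "d = coeff P 3"
    using degree_less_4_cases[OF assms] by blast
  define x :: real where "x = of_int i"
  show ?thesis
  proof (rule exI[of _ "a + b * x + c * x\<^sup>2 + d * x^3"], rule exI[of _ "b + 2 * c * x + 3 * d * x\<^sup>2"],
      rule exI[of _ "c + 3 * d * x"], rule exI[of _ d], intro conjI allI impI)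
    show "d = 0" if "degree P < 3" using that unfolding d by (rule coeff_eq_0)
  qed (unfold P cell_average_cubic of_int_add x_def[symmetric],
      simp_all add: field_simps power2_eq_square power3_eq_cube)
qed

text \<open>
  The classical finite volume weights: value at the right interface of cell \<open>i\<close> in terms of the
  averages over four cells, for each position of the stencil that can occur on either side.
\<close>

lemma interface_value_4:
  fixes i :: int
  assumes "degree P < 4"
  defines "A \<equiv> cell_average P" and "x \<equiv> poly P (of_int i + 1 / 2)"
  shows "x = (25 * A (i + 1) - 23 * A (i + 2) + 13 * A (i + 3) - 3 * A (i + 4)) / 12"
    "x = (3 * A i + 13 * A (i + 1) - 5 * A (i + 2) + A (i + 3)) / 12"
    "x = (- A (i - 1) + 7 * A i + 7 * A (i + 1) - A (i + 2)) / 12"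
    "x = (A (i - 2) - 5 * A (i - 1) + 13 * A i + 3 * A (i + 1)) / 12"
    "x = (- 3 * A (i - 3) + 13 * A (i - 2) - 23 * A (i - 1) + 25 * A i) / 12"
proof -
  obtain p q r t where avg: "\<forall>n. cell_average P (i + n) =
       p + q * of_int n + r * ((of_int n)\<^sup>2 + 1 / 12) + t * ((of_int n)^3 + of_int n / 4)"
    and val: "\<forall>y. poly P (of_int i + y) = p + q * y + r * y\<^sup>2 + t * y^3"
    using cell_average_centred[OF assms(1), of i] by (elim exE conjE) (rule that)
  have x: "x = p + q / 2 + r / 4 + t / 8"
    unfolding x_def val[rule_format] by (simp add: power2_eq_square power3_eq_cube)
  have A: "A (i - 3) = p - 3 * q + 109 / 12 * r - 111 / 4 * t" "A (i - 2) = p - 2 * q + 49 / 12 * r - 17 / 2 * t"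
    "A (i - 1) = p - q + 13 / 12 * r - 5 / 4 * t" "A i = p + r / 12" "A (i + 1) = p + q + 13 / 12 * r + 5 / 4 * t"
    "A (i + 2) = p + 2 * q + 49 / 12 * r + 17 / 2 * t" "A (i + 3) = p + 3 * q + 109 / 12 * r + 111 / 4 * t"
    "A (i + 4) = p + 4 * q + 193 / 12 * r + 65 * t"
    using avg[THEN spec, of "- 3"] avg[THEN spec, of "- 2"] avg[THEN spec, of "- 1"] avg[THEN spec, of 0] avg[THEN spec, of 1] avg[THEN spec, of 2] avg[THEN spec, of 3] avg[THEN spec, of 4]
    by (simp_all add: A_def)
  show "x = (25 * A (i + 1) - 23 * A (i + 2) + 13 * A (i + 3) - 3 * A (i + 4)) / 12"
    "x = (3 * A i + 13 * A (i + 1) - 5 * A (i + 2) + A (i + 3)) / 12"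
    "x = (- A (i - 1) + 7 * A i + 7 * A (i + 1) - A (i + 2)) / 12"
    "x = (A (i - 2) - 5 * A (i - 1) + 13 * A i + 3 * A (i + 1)) / 12"
    "x = (- 3 * A (i - 3) + 13 * A (i - 2) - 23 * A (i - 1) + 25 * A i) / 12"
    unfolding x A by (simp_all add: field_simps)
qed

lemma interface_value_3:
  fixes i :: int
  assumes "degree P < 3"
  defines "A \<equiv> cell_average P" and "x \<equiv> poly P (of_int i + 1 / 2)"
  shows "x = (11 * A (i + 1) - 7 * A (i + 2) + 2 * A (i + 3)) / 6"
    "x = (2 * A i + 5 * A (i + 1) - A (i + 2)) / 6"
    "x = (- A (i - 1) + 5 * A i + 2 * A (i + 1)) / 6"
    "x = (2 * A (i - 2) - 7 * A (i - 1) + 11 * A i) / 6"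
proof -
  have "degree P < 4" using assms(1) by simp
  from cell_average_centred[OF this, of i] obtain p q r t where avg: "\<forall>n. cell_average P (i + n) =
       p + q * of_int n + r * ((of_int n)\<^sup>2 + 1 / 12) + t * ((of_int n)^3 + of_int n / 4)"
    and val: "\<forall>y. poly P (of_int i + y) = p + q * y + r * y\<^sup>2 + t * y^3"
    and "degree P < 3 \<longrightarrow> t = 0"
    by (elim exE conjE) (rule that)
  then have t: "t = 0" using assms(1) by blast
  have x: "x = p + q / 2 + r / 4"
    unfolding x_def val[rule_format] t by (simp add: power2_eq_square)
  have A: "A (i - 2) = p - 2 * q + 49 / 12 * r" "A (i - 1) = p - q + 13 / 12 * r" "A i = p + r / 12"
    "A (i + 1) = p + q + 13 / 12 * r" "A (i + 2) = p + 2 * q + 49 / 12 * r" "A (i + 3) = p + 3 * q + 109 / 12 * r"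
    using avg[THEN spec, of "- 2"] avg[THEN spec, of "- 1"] avg[THEN spec, of 0] avg[THEN spec, of 1] avg[THEN spec, of 2] avg[THEN spec, of 3]
    by (simp_all add: A_def t)
  show "x = (11 * A (i + 1) - 7 * A (i + 2) + 2 * A (i + 3)) / 6"
    "x = (2 * A i + 5 * A (i + 1) - A (i + 2)) / 6"
    "x = (- A (i - 1) + 5 * A i + 2 * A (i + 1)) / 6"
    "x = (2 * A (i - 2) - 7 * A (i - 1) + 11 * A i) / 6"
    unfolding x A by (simp_all add: field_simps)
qed

lemma cell_average_diff_cubic:
  assumes "degree P < 4" "degree Q < 4"
  shows "cell_average (P - Q) m = cell_average P m - cell_average Q m"
proof -
  obtain a b c d where P: "P = [:a, b, c, d:]" using degree_less_4_cases[OF assms(1)] by blast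
  obtain a' b' c' d' where Q: "Q = [:a', b', c', d':]"
    using degree_less_4_cases[OF assms(2)] by blast
  show ?thesis by (simp add: P Q cell_average_cubic field_simps)
qed

text \<open>
  The third, second and first differences of the averages determine the coefficients one after the
  other, from the leading one down.
\<close>

lemma interpolates_unique:
  assumes k: "k \<in> {3, 4}" and P: "interpolates k g s P" and Q: "interpolates k g s Q"
  shows "P = Q"
proof -
  define R where "R = P - Q"
  define x :: real where "x = of_int s"
  have "degree P < 4" "degree Q < 4" using P Q k by (auto simp: interpolates_def)
  then have z: "cell_average R m = 0" if "m \<in> {s..<s + int k}" for m
    using cell_average_diff_cubic P Q that by (auto simp: R_def interpolates_def)
  have deg: "degree R < k" using P Q by (auto simp: R_def interpolates_def intro: degree_diff_less)
  obtain a b c d where R: "R = [:a, b, c, d:]" and d: "k = 3 \<Longrightarrow> d = 0"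
    using degree_less_4_cases[of R] degree_less_3_cases[of R] deg k by auto
  define A where "A y = a + b * y + c * (y\<^sup>2 + 1 / 12) + d * (y^3 + y / 4)" for y
  have A: "A x = 0" "A (x + 1) = 0" "A (x + 2) = 0" "k = 4 \<Longrightarrow> A (x + 3) = 0"
    using z[of s] z[of "s + 1"] z[of "s + 2"] z[of "s + 3"] k
    by (auto simp: R cell_average_cubic A_def x_def)
  have "A (x + 3) - 3 * A (x + 2) + 3 * A (x + 1) - A x = 6 * d"
    by (simp add: A_def field_simps power2_eq_square power3_eq_cube)
  then have d: "d = 0" using A d k by auto
  have "A (x + 2) - 2 * A (x + 1) + A x = 2 * c"
    by (simp add: A_def d field_simps power2_eq_square)
  then have c: "c = 0" using A by simp
  have "A (x + 1) - A x = b" by (simp add: A_def c d algebra_simps)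
  then have b: "b = 0" using A by simp
  have "a = 0" using A(1) by (simp add: A_def b c d)
  with b show ?thesis using R c d by (simp add: R_def)
qed

lemma eno_poly_interpolates:
  assumes "k \<in> {3, 4}"
  shows "interpolates k g (eno_left g i (k - 1)) (eno_poly k g i)"
proof -
  have "\<exists>!P. interpolates k g (eno_left g i (k - 1)) P"
    using interpolates_exists interpolates_unique assms by blast
  from theI'[OF this] show ?thesis
    unfolding eno_poly_def Let_def interpolates_def .
qed

text \<open>
  Moving the stencil by one cell changes the interface value by a multiple of the undivided difference
  over the union of both stencils. The coefficient is \<open>1/3, 1/6, 1/3\<close> for order three and
  \<open>1/4, 1/12, 1/12, 1/4\<close> for order four, up to a sign that matches the one in \<open>eno_left_sign\<close>.
\<close>

lemma interface_value_shift:
  assumes k: "k \<in> {3, 4}" and s: "s \<in> {i - int k + 1..i}"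
  shows "\<exists>c. 0 \<le> c \<and> c \<le> 1 \<and> (\<forall>P Q. interpolates k g s P \<longrightarrow> interpolates k g (s + 1) Q \<longrightarrow>
     poly Q (of_int i + 1 / 2) - poly P (of_int i + 1 / 2) =
       c * ((if even (int (k - 1) + (i - s)) then 1 else -1) * undiv_diff k g s))"
proof -
  obtain r where r: "i = s + r" "0 \<le> r" "r < int k"
    using s by (intro that[of "i - s"]) auto
  have arith: "s + 1 + 1 = s + 2" "s + 1 + 2 = s + 3" "s + 1 + 3 = s + 4" "s + 2 - 1 = s + 1"
    "s + 2 + 1 = s + 3" "s + 2 + 2 = s + 4" "s + 3 - 1 = s + 2" "s + 3 - 2 = s + 1"
    "s + 3 + 1 = s + 4" by simp_all
  from k consider "k = 3" | "k = 4" by auto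
  then show ?thesis
  proof cases
    case 1
    let ?c = "if r = 1 then 1/6 else 1/3 :: real"
    have "poly Q (of_int i + 1 / 2) - poly P (of_int i + 1 / 2) =
       ?c * ((if even (int (k - 1) + (i - s)) then 1 else -1) * undiv_diff k g s)"
      if P: "interpolates k g s P" and Q: "interpolates k g (s + 1) Q" for P Q
    proof -
      have P': "degree P < 3" "cell_average P s = g s" "cell_average P (s + 1) = g (s + 1)"
        "cell_average P (s + 2) = g (s + 2)"
        using P 1 by (auto simp: interpolates_def)
      have Q': "degree Q < 3" "cell_average Q (s + 1) = g (s + 1)"
        "cell_average Q (s + 2) = g (s + 2)" "cell_average Q (s + 3) = g (s + 3)"
        using Q 1 by (auto simp: interpolates_def)
      have "r = 0 \<or> r = 1 \<or> r = 2" using r(2,3) 1 by linarith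
      then consider "i = s" "r = 0" | "i = s + 1" "r = 1" | "i = s + 2" "r = 2"
        using r(1) by auto
      then show ?thesis
      proof cases
        case a: 1
        show ?thesis unfolding a interface_value_3(1)[OF Q'(1)] interface_value_3(2)[OF P'(1)] P' Q'
          by (simp add: 1 undiv_diff_simps field_simps)
      next
        case a: 2
        show ?thesis
          unfolding a interface_value_3(2)[OF Q'(1)] interface_value_3(3)[OF P'(1)] arith add_diff_cancel_right' P' Q'
          by (simp add: 1 undiv_diff_simps field_simps)
      next
        case a: 3
        show ?thesis
          unfolding a interface_value_3(3)[OF Q'(1)] interface_value_3(4)[OF P'(1)] arith add_diff_cancel_right' P' Q'
          by (simp add: 1 undiv_diff_simps field_simps)
      qed
    qed
    then show ?thesis by (intro exI[of _ ?c]) auto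
  next
    case 2
    let ?c = "if r = 0 \<or> r = 3 then 1/4 else 1/12 :: real"
    have "poly Q (of_int i + 1 / 2) - poly P (of_int i + 1 / 2) =
       ?c * ((if even (int (k - 1) + (i - s)) then 1 else -1) * undiv_diff k g s)"
      if P: "interpolates k g s P" and Q: "interpolates k g (s + 1) Q" for P Q
    proof -
      have P': "degree P < 4" "cell_average P s = g s" "cell_average P (s + 1) = g (s + 1)"
        "cell_average P (s + 2) = g (s + 2)" "cell_average P (s + 3) = g (s + 3)"
        using P 2 by (auto simp: interpolates_def)
      have Q': "degree Q < 4" "cell_average Q (s + 1) = g (s + 1)"
        "cell_average Q (s + 2) = g (s + 2)" "cell_average Q (s + 3) = g (s + 3)"
        "cell_average Q (s + 4) = g (s + 4)"
        using Q 2 by (auto simp: interpolates_def)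
      have "r = 0 \<or> r = 1 \<or> r = 2 \<or> r = 3" using r(2,3) 2 by linarith
      then consider "i = s" "r = 0" | "i = s + 1" "r = 1" | "i = s + 2" "r = 2" | "i = s + 3" "r = 3"
        using r(1) by auto
      then show ?thesis
      proof cases
        case a: 1
        show ?thesis unfolding a interface_value_4(1)[OF Q'(1)] interface_value_4(2)[OF P'(1)] P' Q'
          by (simp add: 2 undiv_diff_simps field_simps)
      next
        case a: 2
        show ?thesis
          unfolding a interface_value_4(2)[OF Q'(1)] interface_value_4(3)[OF P'(1)] arith add_diff_cancel_right' P' Q'
          by (simp add: 2 undiv_diff_simps field_simps)
      next
        case a: 3
        show ?thesis
          unfolding a interface_value_4(3)[OF Q'(1)] interface_value_4(4)[OF P'(1)] arith add_diff_cancel_right' P' Q'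
          by (simp add: 2 undiv_diff_simps field_simps)
      next
        case a: 4
        show ?thesis
          unfolding a interface_value_4(4)[OF Q'(1)] interface_value_4(5)[OF P'(1)] arith add_diff_cancel_right' P' Q'
          by (simp add: 2 undiv_diff_simps field_simps)
      qed
    qed
    then show ?thesis by (intro exI[of _ ?c]) auto
  qed
qed

text \<open>
  Moving the stencil of cell \<open>i\<close> to that of cell \<open>i + 1\<close> one cell at a time gives a telescoping sum.
\<close>

lemma eno_jump_eq_sum:
  assumes k: "k \<in> {3, 4}"
  shows "\<exists>c. (\<forall>s. 0 \<le> c s \<and> c s \<le> 1) \<and>
    poly (eno_poly k g (i + 1)) (of_int i + 1 / 2) - poly (eno_poly k g i) (of_int i + 1 / 2) =
    (\<Sum>s\<in>{eno_left g i (k - 1)..<eno_left g (i + 1) (k - 1)}.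
      c s * ((if even (int (k - 1) + (i - s)) then 1 else -1) * undiv_diff k g s))"
proof -
  define a b where "a = eno_left g i (k - 1)" and "b = eno_left g (i + 1) (k - 1)"
  have "\<exists>I. \<forall>s. interpolates k g s (I s)"
    by (intro choice allI interpolates_exists[OF k])
  then obtain I where I: "\<And>s. interpolates k g s (I s)" by blast
  have "eno_poly k g i = I a" "eno_poly k g (i + 1) = I b"
    using interpolates_unique[OF k eno_poly_interpolates[OF k] I] by (auto simp: a_def b_def)
  then have eno: "poly (eno_poly k g (i + 1)) (of_int i + 1 / 2) - poly (eno_poly k g i) (of_int i + 1 / 2)
     = poly (I b) (of_int i + 1 / 2) - poly (I a) (of_int i + 1 / 2)" by simp
  define E where "E s = poly (I s) (of_int i + 1 / 2)" for s
  have bds: "i - int k + 1 \<le> a" "b \<le> i + 1"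
    using eno_left_bounds[of i "k - 1" g] eno_left_bounds[of "i + 1" "k - 1" g] k
    by (auto simp: a_def b_def)
  have ab: "a \<le> b"
    using eno_left_sign[of 0 g i "k - 1"] by (simp add: a_def b_def)
  have "\<forall>s. \<exists>c. 0 \<le> c \<and> c \<le> 1 \<and> (s \<in> {i - int k + 1..i} \<longrightarrow> E (s + 1) - E s =
       c * ((if even (int (k - 1) + (i - s)) then 1 else -1) * undiv_diff k g s))"
  proof
    fix s
    show "\<exists>c. 0 \<le> c \<and> c \<le> 1 \<and> (s \<in> {i - int k + 1..i} \<longrightarrow> E (s + 1) - E s =
       c * ((if even (int (k - 1) + (i - s)) then 1 else -1) * undiv_diff k g s))"
    proof (cases "s \<in> {i - int k + 1..i}")
      case True
      show ?thesis using interface_value_shift[OF k True, of g] I unfolding E_def by blast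
    next
      case False
      then show ?thesis by (intro exI[of _ 0]) auto
    qed
  qed
  then obtain c where c: "\<And>s. 0 \<le> c s \<and> c s \<le> 1" "\<And>s. s \<in> {i - int k + 1..i} \<Longrightarrow>
     E (s + 1) - E s = c s * ((if even (int (k - 1) + (i - s)) then 1 else -1) * undiv_diff k g s)"
    using choice[of "\<lambda>s c. 0 \<le> c \<and> c \<le> 1 \<and> (s \<in> {i - int k + 1..i} \<longrightarrow> E (s + 1) - E s =
       c * ((if even (int (k - 1) + (i - s)) then 1 else -1) * undiv_diff k g s))"] by blast
  have "E b - E a = (\<Sum>s\<in>{a..<b}. E (s + 1) - E s)" using ab
  proof (induction b rule: int_ge_induct)
    case (step j)
    have "{a..<j + 1} = insert j {a..<j}" using step by auto
    then show ?case using step by simp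
  qed simp
  also have "\<dots> = (\<Sum>s\<in>{a..<b}. c s * ((if even (int (k - 1) + (i - s)) then 1 else -1) * undiv_diff k g s))"
    using bds by (intro sum.cong c(2)) auto
  finally show ?thesis
    using c(1) unfolding eno by (intro exI[of _ c] conjI allI) (auto simp: E_def a_def b_def)
qed

text \<open>
  For the reconstruction of second order, the slope never exceeds the central jump \<open>b\<close> in modulus, which
  yields the sign property, and deviates from it by no more than a second difference, which yields the size.
\<close>

lemma minmod_bounds:
  "\<bar>minmod a b\<bar> \<le> \<bar>b\<bar>" "\<bar>b - minmod a b\<bar> \<le> \<bar>b - a\<bar>"
proof -
  consider "a > 0" "b > 0" | "a < 0" "b < 0" | "a * b \<le> 0"
    using mult_le_0_iff[of a b] by linarith
  then have "\<bar>minmod a b\<bar> \<le> \<bar>b\<bar> \<and> \<bar>b - minmod a b\<bar> \<le> \<bar>b - a\<bar>"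
  proof cases
    case 3
    then have "\<bar>b\<bar> \<le> \<bar>b - a\<bar>" by (auto simp: mult_le_0_iff)
    with 3 show ?thesis by (simp add: minmod_def)
  qed (auto simp: minmod_def zero_less_mult_iff min_def mult_nonpos_nonpos)
  then show "\<bar>minmod a b\<bar> \<le> \<bar>b\<bar>" "\<bar>b - minmod a b\<bar> \<le> \<bar>b - a\<bar>" by auto
qed

lemma minmod_commute: "minmod a b = minmod b a"
proof -
  have "sgn a = sgn b" if "a * b > 0" using that by (auto simp: zero_less_mult_iff)
  then show ?thesis by (simp add: minmod_def mult.commute min.commute)
qed

definition scalar_jump :: "nat \<Rightarrow> (int \<Rightarrow> real) \<Rightarrow> int \<Rightarrow> real" where
  "scalar_jump k g i =
     poly (recon_poly k g (i + 1)) (of_int i + 1 / 2) - poly (recon_poly k g i) (of_int i + 1 / 2)"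

lemma scalar_jump_minmod:
  "scalar_jump 2 g i = ((g (i + 1) - g i - minmod (g i - g (i - 1)) (g (i + 1) - g i))
     + (g (i + 1) - g i - minmod (g (i + 2) - g (i + 1)) (g (i + 1) - g i))) / 2"
proof -
  have 2: "i + 1 + 1 = i + 2" by simp
  show ?thesis
    unfolding scalar_jump_def recon_poly_def minmod_poly_def Let_def add_diff_cancel_right' 2
      minmod_commute[of "g (i + 2) - g (i + 1)"]
    by (simp add: field_simps)
qed

text \<open>
  At second order the jump is the mean of two terms \<open>b - \<sigma>\<close>, where \<open>b\<close> is the jump of the data and the
  slope satisfies \<open>\<bar>\<sigma>\<bar> \<le> \<bar>b\<bar>\<close>. At higher order \<open>eno_left_sign\<close>, with \<open>e\<close> the jump of the data, makes each
  term of the sum in \<open>eno_jump_eq_sum\<close> nonnegative.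
\<close>

lemma scalar_jump_sign:
  assumes "k \<in> {2, 3, 4}"
  shows "(g (i + 1) - g i) * scalar_jump k g i \<ge> 0"
proof (cases "k = 2")
  case True
  define e where "e = g (i + 1) - g i"
  have "e * (e - minmod a e) \<ge> 0" for a
    by (rule mult_diff_nonneg_if_abs_le) (auto simp: minmod_bounds)
  from this[of "g i - g (i - 1)"] this[of "g (i + 2) - g (i + 1)"]
  show ?thesis unfolding True scalar_jump_minmod e_def[symmetric]
    by (simp add: field_simps)
next
  case False
  then have k: "k \<in> {3, 4}" using assms by auto
  define e where "e = g (i + 1) - g i"
  obtain c where c: "\<forall>s. 0 \<le> c s \<and> c s \<le> 1" and j: "scalar_jump k g i =
    (\<Sum>s\<in>{eno_left g i (k - 1)..<eno_left g (i + 1) (k - 1)}.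
      c s * ((if even (int (k - 1) + (i - s)) then 1 else -1) * undiv_diff k g s))"
    using eno_jump_eq_sum[OF k, of g i] False by (auto simp: scalar_jump_def recon_poly_def)
  have "e * (g (i + 1) - g i) \<ge> 0" by (simp add: e_def)
  note sgn = eno_left_sign[OF this, of "k - 1"]
  have "Suc (k - 1) = k" using k by auto
  have *: "0 \<le> c s * (e * (if even (int (k - 1) + (i - s)) then 1 else -1) * undiv_diff k g s)"
    if "s \<in> {eno_left g i (k - 1)..<eno_left g (i + 1) (k - 1)}" for s
  proof (rule mult_nonneg_nonneg)
    show "0 \<le> c s" using c by blast
    have "eno_left g i (k - 1) \<le> s" "s < eno_left g (i + 1) (k - 1)" using that by auto
    with sgn have "0 \<le> e * (if even (int (k - 1) + (i - s)) then 1 else -1) *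
        undiv_diff (Suc (k - 1)) g s" by blast
    then show "0 \<le> e * (if even (int (k - 1) + (i - s)) then 1 else -1) * undiv_diff k g s"
      unfolding \<open>Suc (k - 1) = k\<close> .
  qed
  have "e * scalar_jump k g i = (\<Sum>s\<in>{eno_left g i (k - 1)..<eno_left g (i + 1) (k - 1)}.
      c s * (e * (if even (int (k - 1) + (i - s)) then 1 else -1) * undiv_diff k g s))"
    unfolding j sum_distrib_left by (intro sum.cong) (auto simp: algebra_simps)
  also have "\<dots> \<ge> 0" using * by (rule sum_nonneg)
  finally show ?thesis by (simp add: e_def)
qed

text \<open>
  For smooth data this shows that the diffusion is of order \<open>k\<close>, and for constant data that it vanishes.
\<close>

lemma scalar_jump_le:
  assumes k: "k \<in> {2, 3, 4}" and M: "\<And>s. s \<in> {i - int k + 1..i} \<Longrightarrow> \<bar>undiv_diff k g s\<bar> \<le> M"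
  shows "\<bar>scalar_jump k g i\<bar> \<le> real k * M"
proof (cases "k = 2")
  case True
  have "\<bar>g (i + 1) - g i - minmod (g i - g (i - 1)) (g (i + 1) - g i)\<bar> \<le> \<bar>undiv_diff 2 g (i - 1)\<bar>"
  proof -
    have "undiv_diff 2 g (i - 1) = g (i + 1) - g i - (g i - g (i - 1))"
      using undiv_diff_simps(1)[of g "i - 1"] by (simp add: add.commute)
    then show ?thesis by (simp only: minmod_bounds(2))
  qed
  moreover have "\<bar>g (i + 1) - g i - minmod (g (i + 2) - g (i + 1)) (g (i + 1) - g i)\<bar>
      \<le> \<bar>undiv_diff 2 g i\<bar>"
    using minmod_bounds(2)[of "g (i + 1) - g i" "g (i + 2) - g (i + 1)"]
    by (simp add: undiv_diff_simps)
  moreover have "\<bar>undiv_diff 2 g (i - 1)\<bar> \<le> M" "\<bar>undiv_diff 2 g i\<bar> \<le> M"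
    using M True by auto
  moreover have "\<bar>(x + y) / 2\<bar> \<le> 2 * M"
    if "\<bar>x\<bar> \<le> p" "\<bar>y\<bar> \<le> q" "p \<le> M" "q \<le> M" for x y p q :: real
    using that by (simp add: field_simps)
  ultimately show ?thesis unfolding True scalar_jump_minmod of_nat_numeral by blast
next
  case False
  then have k': "k \<in> {3, 4}" using k by auto
  define S where "S = {eno_left g i (k - 1)..<eno_left g (i + 1) (k - 1)}"
  obtain c where c: "\<forall>s. 0 \<le> c s \<and> c s \<le> 1" and j: "scalar_jump k g i =
    (\<Sum>s\<in>S. c s * ((if even (int (k - 1) + (i - s)) then 1 else -1) * undiv_diff k g s))"
    using eno_jump_eq_sum[OF k', of g i] False
    by (auto simp: scalar_jump_def recon_poly_def S_def)
  have sub: "S \<subseteq> {i - int k + 1..i}"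
    using eno_left_bounds[of i "k - 1" g] eno_left_bounds[of "i + 1" "k - 1" g] k'
    by (auto simp: S_def)
  have "\<bar>M\<bar> = M" using M[of i] k by auto
  have "\<bar>scalar_jump k g i\<bar> \<le> (\<Sum>s\<in>S. \<bar>c s * ((if even (int (k - 1) + (i - s)) then 1 else -1) * undiv_diff k g s)\<bar>)"
    unfolding j by (rule sum_abs)
  also have "\<dots> \<le> (\<Sum>s\<in>S. M)"
  proof (rule sum_mono)
    fix s assume "s \<in> S"
    then have "\<bar>undiv_diff k g s\<bar> \<le> M" using M sub by blast
    then have "\<bar>c s\<bar> * \<bar>undiv_diff k g s\<bar> \<le> 1 * M" using c by (intro mult_mono) auto
    then show "\<bar>c s * ((if even (int (k - 1) + (i - s)) then 1 else -1) * undiv_diff k g s)\<bar> \<le> M"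
      by (simp add: abs_mult)
  qed
  also have "\<dots> = real (card S) * M" by simp
  also have "\<dots> \<le> real k * M"
  proof (rule mult_right_mono)
    have "card S \<le> card {i - int k + 1..i}" by (rule card_mono[OF _ sub]) simp
    then show "real (card S) \<le> real k" by simp
  qed (use \<open>\<bar>M\<bar> = M\<close> in linarith)
  finally show ?thesis .
qed

section \<open>Calculus of smooth fields\<close>

lemma C_n_on_Suc_imp: "C_n_on (Suc n) Q f \<Longrightarrow> C_n_on n Q f"
proof (induction n arbitrary: f)
  case 0
  then show ?case
    by (auto intro!: continuous_at_imp_continuous_on dest: has_derivative_continuous)
next
  case (Suc n)
  then obtain f' where "\<forall>z\<in>Q. (f has_derivative f' z) (at z)" "\<forall>v. C_n_on (Suc n) Q (\<lambda>z. f' z v)"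
    using C_n_on.simps(2)[of "Suc n"] by blast
  then show ?case using Suc.IH by (auto intro!: exI[of _ f'])
qed

lemma C_n_on_SucD:
  assumes "C_n_on (Suc n) Q f"
  obtains f' where "\<And>z. z \<in> Q \<Longrightarrow> (f has_derivative f' z) (at z)" "\<And>v. C_n_on n Q (\<lambda>z. f' z v)"
  using assms by auto

lemma C_n_on_SucI:
  assumes "\<And>z. z \<in> Q \<Longrightarrow> (f has_derivative f' z) (at z)" "\<And>v. C_n_on n Q (\<lambda>z. f' z v)"
  shows "C_n_on (Suc n) Q f"
  using assms by auto

lemma C_n_on_const: "C_n_on n Q (\<lambda>_. c)"
proof (induction n arbitrary: c)
  case (Suc n)
  show ?case by (rule C_n_on_SucI[OF has_derivative_const Suc])
qed simp

lemma C_n_on_bounded_linear: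
  assumes L: "bounded_linear L" and f: "C_n_on n Q f"
  shows "C_n_on n Q (\<lambda>z. L (f z))"
  using f
proof (induction n arbitrary: f)
  case 0
  then show ?case by (auto intro: bounded_linear.continuous_on[OF L])
next
  case (Suc n)
  from C_n_on_SucD[OF Suc.prems] obtain f' where
    f': "\<And>z. z \<in> Q \<Longrightarrow> (f has_derivative f' z) (at z)" "\<And>v. C_n_on n Q (\<lambda>z. f' z v)" by blast
  show ?case
    by (rule C_n_on_SucI[OF bounded_linear.has_derivative[OF L f'(1)] Suc.IH[OF f'(2)]])
qed

lemma C_n_on_add:
  assumes "C_n_on n Q f" "C_n_on n Q g"
  shows "C_n_on n Q (\<lambda>z. f z + g z)"
  using assms
proof (induction n arbitrary: f g)
  case 0
  then show ?case by (auto intro: continuous_on_add)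
next
  case (Suc n)
  from C_n_on_SucD[OF Suc.prems(1)] obtain f' where
    f': "\<And>z. z \<in> Q \<Longrightarrow> (f has_derivative f' z) (at z)" "\<And>v. C_n_on n Q (\<lambda>z. f' z v)" by blast
  from C_n_on_SucD[OF Suc.prems(2)] obtain g' where
    g': "\<And>z. z \<in> Q \<Longrightarrow> (g has_derivative g' z) (at z)" "\<And>v. C_n_on n Q (\<lambda>z. g' z v)" by blast
  show ?case
    by (rule C_n_on_SucI[OF has_derivative_add[OF f'(1) g'(1)] Suc.IH[OF f'(2) g'(2)]])
qed

lemma C_n_on_mult:
  fixes f g :: "'a::real_normed_vector \<Rightarrow> real"
  assumes "C_n_on n Q f" "C_n_on n Q g"
  shows "C_n_on n Q (\<lambda>z. f z * g z)"
  using assms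
proof (induction n arbitrary: f g)
  case 0
  then show ?case by (auto intro: continuous_on_mult)
next
  case (Suc n)
  note f = C_n_on_Suc_imp[OF Suc.prems(1)] and g = C_n_on_Suc_imp[OF Suc.prems(2)]
  from C_n_on_SucD[OF Suc.prems(1)] obtain f' where
    f': "\<And>z. z \<in> Q \<Longrightarrow> (f has_derivative f' z) (at z)" "\<And>v. C_n_on n Q (\<lambda>z. f' z v)" by blast
  from C_n_on_SucD[OF Suc.prems(2)] obtain g' where
    g': "\<And>z. z \<in> Q \<Longrightarrow> (g has_derivative g' z) (at z)" "\<And>v. C_n_on n Q (\<lambda>z. g' z v)" by blast
  show ?case
    by (rule C_n_on_SucI[OF has_derivative_mult[OF f'(1) g'(1)]
          C_n_on_add[OF Suc.IH[OF f g'(2)] Suc.IH[OF f'(2) g]]])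
qed

lemma C_n_on_linear_compose:
  assumes A: "bounded_linear A" and w: "C_n_on n Q w" and sub: "A ` P \<subseteq> Q"
  shows "C_n_on n P (\<lambda>z. w (A z))"
  using w
proof (induction n arbitrary: w)
  case 0
  then show ?case using sub
    using continuous_on_compose2[OF _ linear_continuous_on[OF A], of Q w P] by simp
next
  case (Suc n)
  from C_n_on_SucD[OF Suc.prems] obtain w' where
    w': "\<And>z. z \<in> Q \<Longrightarrow> (w has_derivative w' z) (at z)" "\<And>v. C_n_on n Q (\<lambda>z. w' z v)" by blast
  have "((\<lambda>z. w (A z)) has_derivative (\<lambda>v. w' (A z) (A v))) (at z)" if "z \<in> P" for z
    using has_derivative_compose[OF bounded_linear_imp_has_derivative[OF A] w'(1)[of "A z"]] that sub
    by auto
  note d = this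
  show ?case
    by (rule C_n_on_SucI, rule d, assumption) (rule Suc.IH[OF w'(2)])
qed

lemma C_n_on_cong:
  assumes "open Q" "\<And>z. z \<in> Q \<Longrightarrow> f z = g z" "C_n_on n Q f"
  shows "C_n_on n Q g"
proof (cases n)
  case 0
  then show ?thesis using assms continuous_on_cong[of Q Q f g] by simp
next
  case (Suc m)
  from C_n_on_SucD[OF assms(3)[unfolded Suc]] obtain f' where
    f': "\<And>z. z \<in> Q \<Longrightarrow> (f has_derivative f' z) (at z)" "\<And>v. C_n_on m Q (\<lambda>z. f' z v)" by blast
  have "(g has_derivative f' z) (at z)" if "z \<in> Q" for z
    by (rule has_derivative_transform_within_open[OF f'(1)[OF that] assms(1) that assms(2)])
  note d = this
  show ?thesis unfolding Suc
    by (rule C_n_on_SucI, rule d, assumption) (rule f'(2))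
qed

lemma C_n_on_inverse:
  fixes f :: "'a::real_normed_vector \<Rightarrow> real"
  assumes "C_n_on n Q f" and nz: "\<And>z. z \<in> Q \<Longrightarrow> f z \<noteq> 0"
  shows "C_n_on n Q (\<lambda>z. inverse (f z))"
  using assms(1)
proof (induction n)
  case 0
  then show ?case using nz by (auto intro!: continuous_on_inverse)
next
  case (Suc n)
  from C_n_on_SucD[OF Suc.prems] obtain f' where
    f': "\<And>z. z \<in> Q \<Longrightarrow> (f has_derivative f' z) (at z)" "\<And>v. C_n_on n Q (\<lambda>z. f' z v)" by blast
  note i = Suc.IH[OF C_n_on_Suc_imp[OF Suc.prems]]
  have "((\<lambda>z. inverse (f z)) has_derivative (\<lambda>v. -1 * (inverse (f z) * f' z v * inverse (f z)))) (at z)"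
    if "z \<in> Q" for z
    using Deriv.has_derivative_inverse[OF nz[OF that] f'(1)[OF that]] by simp
  note d = this
  show ?case
    by (rule C_n_on_SucI, rule d, assumption) (intro C_n_on_mult C_n_on_const i f'(2))
qed

lemma C_n_on_ln:
  fixes f :: "'a::real_normed_vector \<Rightarrow> real"
  assumes f: "C_n_on n Q f" and pos: "\<And>z. z \<in> Q \<Longrightarrow> f z > 0"
  shows "C_n_on n Q (\<lambda>z. ln (f z))"
proof -
  have nz: "f z \<noteq> 0" if "z \<in> Q" for z using pos[OF that] by simp
  show ?thesis
proof (cases n)
  case 0
  then show ?thesis using f nz by (auto intro!: continuous_on_ln)
next
  case (Suc m)
  from C_n_on_SucD[OF f[unfolded Suc]] obtain f' where
    f': "\<And>z. z \<in> Q \<Longrightarrow> (f has_derivative f' z) (at z)" "\<And>v. C_n_on m Q (\<lambda>z. f' z v)" by blast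
  have i: "C_n_on m Q (\<lambda>z. inverse (f z))"
    by (rule C_n_on_inverse[OF C_n_on_Suc_imp[OF f[unfolded Suc]] nz])
  have "((\<lambda>z. ln (f z)) has_derivative (\<lambda>v. f' z v * inverse (f z))) (at z)"
    if "z \<in> Q" for z
    using has_derivative_ln[OF pos[OF that] f'(1)[OF that]] .
  note d = this
  show ?thesis unfolding Suc
    by (rule C_n_on_SucI, rule d, assumption) (intro C_n_on_mult i f'(2))
qed
qed

text \<open>
  The outer function comes with all its derivatives \<open>\<phi> m\<close>, since the induction on the order of
  differentiability needs the claim for the next derivative of it.
\<close>

lemma C_n_on_compose_real:
  fixes f :: "'a::real_normed_vector \<Rightarrow> real" and \<phi> :: "nat \<Rightarrow> real \<Rightarrow> real"
  assumes \<phi>: "\<And>m x. (\<phi> m has_real_derivative \<phi> (Suc m) x) (at x)" and f: "C_n_on n Q f"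
  shows "C_n_on n Q (\<lambda>z. \<phi> m (f z))"
  using f
proof (induction n arbitrary: m)
  case 0
  have "continuous_on UNIV (\<phi> m)"
    using \<phi> by (auto intro!: continuous_at_imp_continuous_on DERIV_isCont)
  then show ?case using 0 by (auto intro: continuous_on_compose2)
next
  case (Suc n)
  from C_n_on_SucD[OF Suc.prems] obtain f' where
    f': "\<And>z. z \<in> Q \<Longrightarrow> (f has_derivative f' z) (at z)" "\<And>v. C_n_on n Q (\<lambda>z. f' z v)" by blast
  have "((\<lambda>z. \<phi> m (f z)) has_derivative (\<lambda>v. f' z v * \<phi> (Suc m) (f z))) (at z)"
    if "z \<in> Q" for z
    using has_derivative_compose[OF f'(1)[OF that] \<phi>[unfolded has_field_derivative_def]]
    by (simp add: mult.commute)
  note d = this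
  show ?case
    by (rule C_n_on_SucI, rule d, assumption) (intro C_n_on_mult Suc.IH f'(2) C_n_on_Suc_imp[OF Suc.prems])
qed

lemma smooth_const: "smooth_field Q (\<lambda>_. c)"
  and smooth_add: "smooth_field Q f \<Longrightarrow> smooth_field Q g \<Longrightarrow> smooth_field Q (\<lambda>z. f z + g z)"
  by (auto simp: smooth_field_def intro: C_n_on_const C_n_on_add)

lemma smooth_cong:
  "open Q \<Longrightarrow> (\<And>z. z \<in> Q \<Longrightarrow> f z = g z) \<Longrightarrow> smooth_field Q f \<Longrightarrow> smooth_field Q g"
  unfolding smooth_field_def by (blast intro: C_n_on_cong)

lemma smooth_bounded_linear: "bounded_linear L \<Longrightarrow> smooth_field Q f \<Longrightarrow> smooth_field Q (\<lambda>z. L (f z))"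
  by (auto simp: smooth_field_def intro: C_n_on_bounded_linear)

lemma smooth_linear_compose:
  "bounded_linear A \<Longrightarrow> smooth_field Q w \<Longrightarrow> A ` P \<subseteq> Q \<Longrightarrow> smooth_field P (\<lambda>z. w (A z))"
  by (auto simp: smooth_field_def intro: C_n_on_linear_compose)

lemma smooth_minus: "smooth_field Q f \<Longrightarrow> smooth_field Q (\<lambda>z. - f z)"
  by (rule smooth_bounded_linear[OF bounded_linear_minus[OF bounded_linear_ident]])

lemma smooth_diff:
  "smooth_field Q f \<Longrightarrow> smooth_field Q g \<Longrightarrow> smooth_field Q (\<lambda>z. f z - g z)"
  using smooth_add[OF _ smooth_minus] by fastforce

lemma smooth_nth: "smooth_field Q f \<Longrightarrow> smooth_field Q (\<lambda>z. f z $ c)"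
  by (rule smooth_bounded_linear[OF bounded_linear_vec_nth])

context
  fixes f g :: "'a::real_normed_vector \<Rightarrow> real" and Q
  assumes f: "smooth_field Q f" and g: "smooth_field Q g"
begin

lemma smooth_mult: "smooth_field Q (\<lambda>z. f z * g z)"
  using f g by (auto simp: smooth_field_def intro: C_n_on_mult)

lemma smooth_divide: "(\<And>z. z \<in> Q \<Longrightarrow> g z \<noteq> 0) \<Longrightarrow> smooth_field Q (\<lambda>z. f z / g z)"
  using f g unfolding divide_inverse smooth_field_def by (intro allI impI C_n_on_mult C_n_on_inverse) auto

end

lemma smooth_ln:
  fixes f :: "'a::real_normed_vector \<Rightarrow> real"
  shows "smooth_field Q f \<Longrightarrow> (\<And>z. z \<in> Q \<Longrightarrow> f z > 0) \<Longrightarrow> smooth_field Q (\<lambda>z. ln (f z))"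
  unfolding smooth_field_def by (intro allI impI C_n_on_ln) auto

lemma smooth_power2:
  "smooth_field Q f \<Longrightarrow> smooth_field Q (\<lambda>z. (f z)\<^sup>2)" for f :: "'a::real_normed_vector \<Rightarrow> real"
  unfolding power2_eq_square by (rule smooth_mult)

section \<open>Smoothness of the logarithmic mean\<close>

definition expq_coeff :: "nat \<Rightarrow> real" where
  "expq_coeff n = 1 / fact (Suc n)"

text \<open>
  The \<open>m\<close>-th derivative of the entire function \<open>(exp x - 1) / x\<close>, given by its power series. It
  provides a smooth form of the logarithmic mean across the diagonal, where the defining quotient
  is singular.
\<close>

definition expq :: "nat \<Rightarrow> real \<Rightarrow> real" where
  "expq m x = (\<Sum>n. (diffs ^^ m) expq_coeff n * x ^ n)"

lemma expq_summable_0: "summable (\<lambda>n. expq_coeff n * x ^ n)"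
proof (rule summable_comparison_test')
  show "summable (\<lambda>n. \<bar>x\<bar> ^ n / fact n)" using summable_exp[of "\<bar>x\<bar>"] by (simp add: divide_inverse mult.commute)
  fix n :: nat assume "n \<ge> 0"
  have "(fact n :: real) \<le> fact (Suc n)" by (rule fact_mono) simp
  then show "norm (expq_coeff n * x ^ n) \<le> \<bar>x\<bar> ^ n / fact n"
    by (simp add: expq_coeff_def abs_mult power_abs frac_le del: fact_Suc)
qed

lemma expq_summable: "summable (\<lambda>n. (diffs ^^ m) expq_coeff n * x ^ n)"
proof (induction m arbitrary: x)
  case (Suc m)
  then show ?case using termdiff_converges_all[of "(diffs ^^ m) expq_coeff"] by simp
qed (simp add: expq_summable_0)

lemma expq_deriv: "(expq m has_real_derivative expq (Suc m) x) (at x)"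
  unfolding expq_def funpow.simps o_def
  by (rule termdiffs_strong_converges_everywhere) (rule expq_summable)

lemma expq_0: "x * expq 0 x = exp x - 1"
proof -
  have "(\<lambda>n. x ^ n / fact n) sums exp x"
    using exp_converges[of x] by (simp add: divide_inverse mult.commute)
  then have "(\<lambda>n. x ^ Suc n / fact (Suc n)) sums (exp x - 1)"
    by (subst sums_Suc_iff) (simp del: fact_Suc)
  moreover have "(\<lambda>n. x * (expq_coeff n * x ^ n)) sums (x * expq 0 x)"
    unfolding expq_def funpow_0 using expq_summable_0 by (intro sums_mult summable_sums)
  ultimately show ?thesis
    by (simp add: expq_coeff_def sums_unique2 del: fact_Suc)
qed

lemma expq_0_0: "expq 0 0 = 1"
  unfolding expq_def powser_zero by (simp add: expq_coeff_def)

text \<open>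
  With \<open>z = ln b - ln a\<close> one has \<open>(b - a) / z = a (exp z - 1) / z\<close>.
\<close>

lemma log_mean_expq:
  assumes "a > 0" "b > 0"
  shows "log_mean a b = a * expq 0 (ln b - ln a)"
proof (cases "a = b")
  case False
  define z where "z = ln b - ln a"
  have z: "z \<noteq> 0" using False assms by (simp add: z_def)
  have "a * expq 0 z * z = a * (exp z - 1)" using expq_0[of z] by (simp add: mult_ac)
  also have "\<dots> = b - a" using assms by (simp add: z_def exp_diff field_simps)
  finally show ?thesis using z False by (simp add: log_mean_def z_def[symmetric] field_simps)
qed (simp add: log_mean_def expq_0_0)

lemma smooth_log_mean:
  fixes f g :: "'a::real_normed_vector \<Rightarrow> real"
  assumes "open Q" "smooth_field Q f" "smooth_field Q g"
    and pos: "\<And>z. z \<in> Q \<Longrightarrow> f z > 0" "\<And>z. z \<in> Q \<Longrightarrow> g z > 0"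
  shows "smooth_field Q (\<lambda>z. log_mean (f z) (g z))"
proof (rule smooth_cong[OF \<open>open Q\<close>])
  have "smooth_field Q (\<lambda>z. ln (g z) - ln (f z))"
    using assms by (intro smooth_diff smooth_ln)
  then have "smooth_field Q (\<lambda>z. expq 0 (ln (g z) - ln (f z)))"
    unfolding smooth_field_def by (auto intro!: C_n_on_compose_real[where \<phi> = expq] expq_deriv)
  then show "smooth_field Q (\<lambda>z. f z * expq 0 (ln (g z) - ln (f z)))"
    using assms by (intro smooth_mult)
qed (simp add: log_mean_expq pos)

section \<open>Taylor expansion and differences of smooth fields\<close>

text \<open>
  The derivative in the definition of smoothness is chosen for each order separately; on an open
  set derivatives are unique, so one choice serves all orders.
\<close>

lemma smooth_field_derivative:
  assumes "open Q" and f: "smooth_field Q f"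
  obtains f' where "\<And>z. z \<in> Q \<Longrightarrow> (f has_derivative f' z) (at z)"
    "\<And>v. smooth_field Q (\<lambda>z. f' z v)"
proof -
  have C: "C_n_on (Suc n) Q f" for n using f by (simp add: smooth_field_def del: C_n_on.simps)
  from C_n_on_SucD[OF C[of 0]] obtain f' where
    f': "\<And>z. z \<in> Q \<Longrightarrow> (f has_derivative f' z) (at z)" "\<And>v. C_n_on 0 Q (\<lambda>z. f' z v)" by blast
  have "C_n_on n Q (\<lambda>z. f' z v)" for n v
  proof -
    from C_n_on_SucD[OF C[of n]] obtain g' where
      g': "\<And>z. z \<in> Q \<Longrightarrow> (f has_derivative g' z) (at z)" "\<And>v. C_n_on n Q (\<lambda>z. g' z v)" by blast
    have "g' z = f' z" if "z \<in> Q" for z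
      using has_derivative_unique[OF g'(1)[OF that] f'(1)[OF that]] .
    then show ?thesis using C_n_on_cong[OF \<open>open Q\<close> _ g'(2)[of v]] by simp
  qed
  then show ?thesis by (intro that[OF f'(1)]) (auto simp: smooth_field_def)
qed

text \<open>
  The sequence of all partial derivatives in the last variable, for Taylor expansions that are uniform
  in the first one.
\<close>

lemma smooth_field_line_derivatives:
  fixes G :: "'a::real_normed_vector \<times> real \<Rightarrow> real"
  assumes "open P" and G: "smooth_field P G"
  obtains D where "D 0 = G" "\<And>n. smooth_field P (D n)"
    "\<And>n z s. (z, s) \<in> P \<Longrightarrow> ((\<lambda>s. D n (z, s)) has_real_derivative D (Suc n) (z, s)) (at s)"
proof -
  define R where "R H H' \<longleftrightarrow> (\<forall>z s. (z, s) \<in> P \<longrightarrow>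
      ((\<lambda>s. H (z, s)) has_real_derivative H' (z, s)) (at s))" for H H' :: "'a \<times> real \<Rightarrow> real"
  have "\<exists>D. \<forall>n. (smooth_field P (D n) \<and> (n = 0 \<longrightarrow> D n = G)) \<and> R (D n) (D (Suc n))"
  proof (rule dependent_nat_choice)
    fix H :: "'a \<times> real \<Rightarrow> real" and n :: nat
    assume "smooth_field P H \<and> (n = 0 \<longrightarrow> H = G)"
    then obtain H' where H': "\<And>z. z \<in> P \<Longrightarrow> (H has_derivative H' z) (at z)"
      "\<And>v. smooth_field P (\<lambda>z. H' z v)"
      using smooth_field_derivative[OF \<open>open P\<close>] by metis
    have "R H (\<lambda>p. H' p (0, 1))"
      unfolding R_def
    proof (intro allI impI)
      fix z s assume p: "(z, s) \<in> P"
      have "((\<lambda>s. (z, s)) has_derivative (\<lambda>t. (0, t))) (at s)"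
        by (auto intro!: derivative_eq_intros)
      from has_derivative_compose[OF this H'(1)[OF p]]
      have "((\<lambda>s. H (z, s)) has_derivative (\<lambda>t. H' (z, s) (0, t))) (at s)" .
      moreover have "H' (z, s) (0, t) = H' (z, s) (0, 1) * t" for t
      proof -
        have "linear (H' (z, s))"
          using H'(1)[OF p] has_derivative_bounded_linear bounded_linear.linear by blast
        from linear_scale[OF this, of t "(0, 1)"] show ?thesis by simp
      qed
      then have "(\<lambda>t. H' (z, s) (0, t)) = (*) (H' (z, s) (0, 1))" by blast
      ultimately show "((\<lambda>s. H (z, s)) has_real_derivative H' (z, s) (0, 1)) (at s)"
        by (simp only: has_field_derivative_def)
    qed
    then show "\<exists>H'. (smooth_field P H' \<and> (Suc n = 0 \<longrightarrow> H' = G)) \<and> R H H'"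
      using H'(2) by (intro exI[of _ "\<lambda>p. H' p (0, 1)"]) auto
  qed (use G in auto)
  then obtain D where D: "\<forall>n. (smooth_field P (D n) \<and> (n = 0 \<longrightarrow> D n = G)) \<and> R (D n) (D (Suc n))" ..
  show ?thesis
  proof (rule that[of D])
    show "D 0 = G" using D[THEN spec, THEN conjunct1, THEN conjunct2] by blast
    show "smooth_field P (D n)" for n by (rule D[THEN spec, THEN conjunct1, THEN conjunct1])
    show "((\<lambda>s. D n (z, s)) has_real_derivative D (Suc n) (z, s)) (at s)" if "(z, s) \<in> P" for n z s
      using D[THEN spec, THEN conjunct2, of n] that unfolding R_def by blast
  qed
qed

lemma smooth_field_bounded:
  fixes G :: "'a::real_normed_vector \<Rightarrow> 'b::real_normed_vector"
  assumes "smooth_field P G" "compact K" "K \<subseteq> P"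
  shows "\<exists>B. \<forall>z\<in>K. norm (G z) \<le> B"
proof -
  have "continuous_on P G" using assms(1) unfolding smooth_field_def by (auto dest: spec[of _ 0])
  then have "compact (G ` K)" using assms by (meson compact_continuous_image continuous_on_subset)
  from compact_imp_bounded[OF this] show ?thesis by (auto simp: bounded_iff)
qed

text \<open>
  The combination of values that differences of the central fluxes of order two and four produce.
\<close>

definition odd_combination :: "nat \<Rightarrow> (real \<Rightarrow> real) \<Rightarrow> real \<Rightarrow> real" where
  "odd_combination k g h = (if k = 2 then g h - g (- h)
     else 4 / 3 * (g h - g (- h)) - 1 / 6 * (g (2 * h) - g (- (2 * h))))"

lemma taylor_remainder:
  fixes \<phi> :: "nat \<Rightarrow> real \<Rightarrow> real"
  assumes "\<And>m s. \<bar>s\<bar> \<le> \<bar>x\<bar> \<Longrightarrow> (\<phi> m has_real_derivative \<phi> (Suc m) s) (at s)"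
    and M: "\<And>s. \<bar>s\<bar> \<le> \<bar>x\<bar> \<Longrightarrow> \<bar>\<phi> n s\<bar> \<le> M"
  shows "\<bar>\<phi> 0 x - (\<Sum>m<n. \<phi> m 0 / fact m * x ^ m)\<bar> \<le> M / fact n * \<bar>x\<bar> ^ n"
proof -
  obtain t where t: "\<bar>t\<bar> \<le> \<bar>x\<bar>"
    "\<phi> 0 x = (\<Sum>m<n. \<phi> m 0 / fact m * x ^ m) + \<phi> n t / fact n * x ^ n"
    using Maclaurin_bi_le[of \<phi> "\<phi> 0" n x] assms(1) by auto
  have "\<bar>\<phi> n t\<bar> / fact n * \<bar>x\<bar> ^ n \<le> M / fact n * \<bar>x\<bar> ^ n"
    using M[OF t(1)] by (intro mult_right_mono divide_right_mono) auto
  then show ?thesis using t(2) by (simp add: abs_mult power_abs)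
qed

text \<open>
  Even Taylor terms cancel. In the second case the cubic term is weighted by
  \<open>4/3 - 2\<^sup>3 / 6 = 0\<close>, while the linear one keeps the weight \<open>4/3 - 2/6 = 1\<close>. For \<open>k = 3\<close> the error is of
  fourth order, which \<open>h \<le> 1\<close> reduces to the stated one.
\<close>

lemma odd_combination_error:
  fixes \<phi> :: "nat \<Rightarrow> real \<Rightarrow> real"
  assumes k: "k \<in> {2, 3, 4}" and h: "0 < h" "h \<le> 1"
    and \<phi>: "\<And>m s. \<bar>s\<bar> \<le> 2 * h \<Longrightarrow> (\<phi> m has_real_derivative \<phi> (Suc m) s) (at s)"
    and M: "\<And>s. \<bar>s\<bar> \<le> 2 * h \<Longrightarrow> \<bar>\<phi> 3 s\<bar> \<le> M" "\<And>s. \<bar>s\<bar> \<le> 2 * h \<Longrightarrow> \<bar>\<phi> 5 s\<bar> \<le> M"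
  shows "\<bar>odd_combination k (\<phi> 0) h - 2 * h * \<phi> 1 0\<bar> \<le> M * h ^ Suc k"
proof (cases "k = 2")
  case True
  have "(\<Sum>m<3. \<phi> m 0 / fact m * x ^ m) = \<phi> 0 0 + \<phi> 1 0 * x + \<phi> 2 0 / 2 * x^2" for x
    by (simp add: lessThan_nat_numeral fact_numeral)
  then have R: "\<bar>\<phi> 0 x - (\<phi> 0 0 + \<phi> 1 0 * x + \<phi> 2 0 / 2 * x^2)\<bar> \<le> M / 6 * \<bar>x\<bar> ^ 3"
    if "\<bar>x\<bar> \<le> 2 * h" for x
    using that taylor_remainder[of x \<phi> 3 M] \<phi> M by (simp add: fact_numeral)
  have M0: "M * h ^ 3 \<ge> 0" using M(1)[of 0] h by (simp add: zero_le_mult_iff)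
  have "\<bar>\<phi> 0 h - (\<phi> 0 0 + \<phi> 1 0 * h + \<phi> 2 0 / 2 * h^2)\<bar> \<le> M * h ^ 3 / 6"
    "\<bar>\<phi> 0 (- h) - (\<phi> 0 0 - \<phi> 1 0 * h + \<phi> 2 0 / 2 * h^2)\<bar> \<le> M * h ^ 3 / 6"
    using R[of h] R[of "- h"] h by simp_all
  then have "\<bar>\<phi> 0 h - \<phi> 0 (- h) - 2 * (\<phi> 1 0 * h)\<bar> \<le> M * h ^ 3"
    using M0 by linarith
  then show ?thesis by (simp add: odd_combination_def True mult_ac numeral_3_eq_3[symmetric])
next
  case False
  have "(\<Sum>m<5. \<phi> m 0 / fact m * x ^ m)
      = \<phi> 0 0 + \<phi> 1 0 * x + \<phi> 2 0 / 2 * x^2 + \<phi> 3 0 / 6 * x^3 + \<phi> 4 0 / 24 * x^4" for x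
    by (simp add: lessThan_nat_numeral fact_numeral)
  then have R: "\<bar>\<phi> 0 x - (\<phi> 0 0 + \<phi> 1 0 * x + \<phi> 2 0 / 2 * x^2 + \<phi> 3 0 / 6 * x^3 + \<phi> 4 0 / 24 * x^4)\<bar>
      \<le> M / 120 * \<bar>x\<bar> ^ 5" if "\<bar>x\<bar> \<le> 2 * h" for x
    using that taylor_remainder[of x \<phi> 5 M] \<phi> M by (simp add: fact_numeral)
  have M0: "M * h ^ 5 \<ge> 0" using M(1)[of 0] h by (simp add: zero_le_mult_iff)
  define a b c d where "a = \<phi> 1 0 * h" and "b = \<phi> 2 0 * h^2" and "c = \<phi> 3 0 * h^3"
    and "d = \<phi> 4 0 * h^4"
  have "\<bar>\<phi> 0 h - (\<phi> 0 0 + a + b / 2 + c / 6 + d / 24)\<bar> \<le> M * h ^ 5 / 120"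
    "\<bar>\<phi> 0 (- h) - (\<phi> 0 0 - a + b / 2 - c / 6 + d / 24)\<bar> \<le> M * h ^ 5 / 120"
    using R[of h] R[of "- h"] h by (simp_all add: a_def b_def c_def d_def)
  moreover have "\<bar>\<phi> 0 (2 * h) - (\<phi> 0 0 + 2 * a + 2 * b + 4 / 3 * c + 2 / 3 * d)\<bar> \<le> 4 / 15 * (M * h ^ 5)"
    "\<bar>\<phi> 0 (- (2 * h)) - (\<phi> 0 0 - 2 * a + 2 * b - 4 / 3 * c + 2 / 3 * d)\<bar> \<le> 4 / 15 * (M * h ^ 5)"
    using R[of "2 * h"] R[of "- (2 * h)"] h
    by (simp_all add: a_def b_def c_def d_def power_mult_distrib mult_ac)
  moreover have "\<bar>4 / 3 * (u1 - u2) - 1 / 6 * (u3 - u4) - 2 * a\<bar> \<le> m"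
    if "\<bar>u1 - (u0 + a + b / 2 + c / 6 + d / 24)\<bar> \<le> m / 120" "\<bar>u2 - (u0 - a + b / 2 - c / 6 + d / 24)\<bar> \<le> m / 120"
      "\<bar>u3 - (u0 + 2 * a + 2 * b + 4 / 3 * c + 2 / 3 * d)\<bar> \<le> 4 / 15 * m"
      "\<bar>u4 - (u0 - 2 * a + 2 * b - 4 / 3 * c + 2 / 3 * d)\<bar> \<le> 4 / 15 * m" "m \<ge> 0"
    for u0 u1 u2 u3 u4 m :: real
  proof -
    define e1 e2 e3 e4 where "e1 = u1 - (u0 + a + b / 2 + c / 6 + d / 24)"
      and "e2 = u2 - (u0 - a + b / 2 - c / 6 + d / 24)"
      and "e3 = u3 - (u0 + 2 * a + 2 * b + 4 / 3 * c + 2 / 3 * d)"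
      and "e4 = u4 - (u0 - 2 * a + 2 * b - 4 / 3 * c + 2 / 3 * d)"
    have "4 / 3 * (u1 - u2) - 1 / 6 * (u3 - u4) - 2 * a = 4 / 3 * e1 - 4 / 3 * e2 - 1 / 6 * e3 + 1 / 6 * e4"
      by (simp add: e1_def e2_def e3_def e4_def field_simps)
    moreover have "\<bar>e1\<bar> \<le> m / 120" "\<bar>e2\<bar> \<le> m / 120" "\<bar>e3\<bar> \<le> 4 / 15 * m" "\<bar>e4\<bar> \<le> 4 / 15 * m"
      using that by (simp_all add: e1_def e2_def e3_def e4_def)
    ultimately show ?thesis using \<open>m \<ge> 0\<close> unfolding abs_le_iff by linarith
  qed
  ultimately have "\<bar>4 / 3 * (\<phi> 0 h - \<phi> 0 (- h)) - 1 / 6 * (\<phi> 0 (2 * h) - \<phi> 0 (- (2 * h))) - 2 * a\<bar>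
      \<le> M * h ^ 5"
    using M0 by blast
  also have "\<dots> \<le> M * h ^ Suc k"
    using k h M(1)[of 0] by (intro mult_left_mono power_decreasing) auto
  finally show ?thesis by (simp add: odd_combination_def False a_def mult_ac)
qed

lemma undiv_diff_Suc_right: "undiv_diff (Suc n) g s = undiv_diff n (\<lambda>m. g (m + 1) - g m) s"
proof (induction n arbitrary: s)
  case (Suc n)
  have "undiv_diff (Suc (Suc n)) g s = undiv_diff (Suc n) g (s + 1) - undiv_diff (Suc n) g s"
    by (rule undiv_diff.simps)
  then show ?case unfolding Suc.IH by simp
qed simp

text \<open>
  The discrete analogue of repeated differentiation: by the mean value theorem a single difference
  of \<open>\<phi>\<close> has an \<open>n\<close>-th derivative that is at most \<open>h\<close> times the bound on the next derivative of \<open>\<phi>\<close>.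
\<close>

lemma undiv_diff_bound:
  fixes \<phi> :: "nat \<Rightarrow> real \<Rightarrow> real"
  assumes "0 < h"
    and "\<And>j y. of_int s * h + a \<le> y \<Longrightarrow> y \<le> of_int (s + int n) * h + a \<Longrightarrow>
      (\<phi> j has_real_derivative \<phi> (Suc j) y) (at y)"
    and "\<And>y. of_int s * h + a \<le> y \<Longrightarrow> y \<le> of_int (s + int n) * h + a \<Longrightarrow> \<bar>\<phi> n y\<bar> \<le> M"
  shows "\<bar>undiv_diff n (\<lambda>m. \<phi> 0 (of_int m * h + a)) s\<bar> \<le> M * h ^ n"
  using assms
proof (induction n arbitrary: \<phi> M)
  case 0
  then show ?case by simp
next
  case (Suc n)
  define \<psi> where "\<psi> j y = \<phi> j (y + h) - \<phi> j y" for j y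
  have hn: "of_int (s + int (Suc n)) * h = of_int (s + int n) * h + h" by (simp add: algebra_simps)
  have "undiv_diff (Suc n) (\<lambda>m. \<phi> 0 (of_int m * h + a)) s
      = undiv_diff n (\<lambda>m. \<psi> 0 (of_int m * h + a)) s"
    unfolding undiv_diff_Suc_right \<psi>_def by (simp add: algebra_simps)
  moreover have "\<bar>undiv_diff n (\<lambda>m. \<psi> 0 (of_int m * h + a)) s\<bar> \<le> (h * M) * h ^ n"
  proof (rule Suc.IH[OF \<open>0 < h\<close>])
    fix j y assume y: "of_int s * h + a \<le> y" "y \<le> of_int (s + int n) * h + a"
    have "((\<lambda>y. \<phi> j (y + h)) has_real_derivative \<phi> (Suc j) (y + h)) (at y)"
      using Suc.prems(2)[of "y + h" j] y \<open>0 < h\<close> unfolding hn by (simp add: DERIV_shift)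
    moreover have "(\<phi> j has_real_derivative \<phi> (Suc j) y) (at y)"
      using Suc.prems(2)[of y j] y \<open>0 < h\<close> unfolding hn by simp
    ultimately show "(\<psi> j has_real_derivative \<psi> (Suc j) y) (at y)"
      unfolding \<psi>_def by (rule DERIV_diff)
  next
    fix y assume y: "of_int s * h + a \<le> y" "y \<le> of_int (s + int n) * h + a"
    obtain \<xi> where \<xi>: "y < \<xi>" "\<xi> < y + h" "\<phi> n (y + h) - \<phi> n y = (y + h - y) * \<phi> (Suc n) \<xi>"
      using MVT2[of y "y + h" "\<phi> n" "\<phi> (Suc n)"] Suc.prems(2) y \<open>0 < h\<close> unfolding hn by auto
    have "\<bar>\<phi> (Suc n) \<xi>\<bar> \<le> M"
      by (rule Suc.prems(3)) (use \<xi>(1,2) y in \<open>unfold hn, linarith+\<close>)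
    then show "\<bar>\<psi> n y\<bar> \<le> h * M" using \<xi> \<open>0 < h\<close> by (simp add: \<psi>_def abs_mult)
  qed
  ultimately show ?case by (simp add: mult_ac)
qed

section \<open>Smoothness of the fluxes\<close>

lemma bounded_linear_swap: "bounded_linear swap"
  unfolding linear_conv_bounded_linear[symmetric]
  by (rule linearI) (simp_all add: swap_add swap_scaleR)

lemma norm_swap: "norm (swap x) = norm x"
  by (simp add: norm_eq_sqrt_inner inner_swap)

lemma smooth_swap: "smooth_field P u \<Longrightarrow> smooth_field P (\<lambda>z. swap (u z))"
  by (rule smooth_bounded_linear[OF bounded_linear_swap])

lemma smooth_midpoint:
  "smooth_field P f \<Longrightarrow> smooth_field P g \<Longrightarrow> smooth_field P (\<lambda>z. midpoint (f z) (g z))"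
  for f g :: "'a::real_normed_vector \<Rightarrow> real"
  unfolding midpoint_def real_scaleR_def by (intro smooth_mult smooth_add smooth_const)

lemma smooth_vector_5:
  assumes "smooth_field P a" "smooth_field P b" "smooth_field P c" "smooth_field P d" "smooth_field P e"
  shows "smooth_field P (\<lambda>z. (vector [a z, b z, c z, d z, e z] :: real^5) $ i)"
proof -
  have "\<forall>i. smooth_field P (\<lambda>z. (vector [a z, b z, c z, d z, e z] :: real^5) $ i)"
    using assms unfolding forall_5 vector_5 by blast
  then show ?thesis ..
qed

lemma midpoint_pos: "a > 0 \<Longrightarrow> b > 0 \<Longrightarrow> midpoint a b > (0::real)"
  by (simp add: midpoint_def)

context
  fixes ge gi :: real
  assumes ge: "ge > 1" and gi: "gi > 1"
begin

lemma smooth_primitive: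
  assumes P: "open P" and u: "smooth_field P u" and adm: "\<And>z. z \<in> P \<Longrightarrow> u z \<in> admissible ge gi"
  shows "smooth_field P (\<lambda>z. dens (u z))" "smooth_field P (\<lambda>z. vel_x (u z))"
    "smooth_field P (\<lambda>z. vel_y (u z))" "smooth_field P (\<lambda>z. energy (u z))"
    "smooth_field P (\<lambda>z. p_ion (u z))" "smooth_field P (\<lambda>z. speed_sq (u z))"
    "smooth_field P (\<lambda>z. p_el ge gi (u z))" "smooth_field P (\<lambda>z. beta_e ge gi (u z))"
    "smooth_field P (\<lambda>z. beta_i (u z))" "smooth_field P (\<lambda>z. spec_entropy ge gi (u z))"
proof -
  note pos = admissible_pos[OF adm]
  have nz: "u z $ 1 \<noteq> 0" "p_el ge gi (u z) \<noteq> 0" "p_ion (u z) \<noteq> 0" if "z \<in> P" for z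
    using pos[OF that] by (auto simp: dens_def)
  show d: "smooth_field P (\<lambda>z. dens (u z))" unfolding dens_def by (intro smooth_nth u)
  show x: "smooth_field P (\<lambda>z. vel_x (u z))" unfolding vel_x_def
    by (intro smooth_divide smooth_nth u nz)
  show y: "smooth_field P (\<lambda>z. vel_y (u z))" unfolding vel_y_def
    by (intro smooth_divide smooth_nth u nz)
  show e: "smooth_field P (\<lambda>z. energy (u z))" unfolding energy_def by (intro smooth_nth u)
  show p: "smooth_field P (\<lambda>z. p_ion (u z))" unfolding p_ion_def by (intro smooth_nth u)
  show s: "smooth_field P (\<lambda>z. speed_sq (u z))" unfolding speed_sq_def
    by (intro smooth_add smooth_power2 x y)
  have "gi - 1 \<noteq> 0" using gi by simp
  then show pe: "smooth_field P (\<lambda>z. p_el ge gi (u z))" unfolding p_el_def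
    by (intro smooth_mult smooth_diff smooth_divide smooth_const d s e p) auto
  show be: "smooth_field P (\<lambda>z. beta_e ge gi (u z))" unfolding beta_e_def
    by (intro smooth_divide d pe nz)
  show bi: "smooth_field P (\<lambda>z. beta_i (u z))" unfolding beta_i_def
    by (intro smooth_divide d p nz)
  have "smooth_field P (\<lambda>z. - (ln (beta_e ge gi (u z)) / (ge - 1) + ln (beta_i (u z)) / (gi - 1)
      + 2 * ln (dens (u z))))"
    using ge gi by (intro smooth_minus smooth_add smooth_divide smooth_mult smooth_ln smooth_const d be bi pos) auto
  then show "smooth_field P (\<lambda>z. spec_entropy ge gi (u z))"
    by (rule smooth_cong[OF P, rotated]) (simp add: spec_entropy_beta[OF ge gi adm])
qed

lemma smooth_entropy_var:
  assumes "open P" "smooth_field P u" "\<And>z. z \<in> P \<Longrightarrow> u z \<in> admissible ge gi"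
  shows "smooth_field P (\<lambda>z. entropy_var ge gi (u z) $ c)"
proof -
  note prim = smooth_primitive[OF assms]
  have "gi - 1 \<noteq> 0" using gi by simp
  then show ?thesis unfolding entropy_var_def
    by (intro smooth_vector_5 smooth_diff smooth_minus smooth_mult smooth_divide smooth_const prim) auto
qed

lemma smooth_ec_flux_x:
  assumes P: "open P" and a: "smooth_field P a" and b: "smooth_field P b"
    and adm: "\<And>z. z \<in> P \<Longrightarrow> a z \<in> admissible ge gi" "\<And>z. z \<in> P \<Longrightarrow> b z \<in> admissible ge gi"
  shows "smooth_field P (\<lambda>z. ec_flux_x ge gi (a z) (b z) $ c)"
proof -
  note pa = smooth_primitive[OF P a adm(1)] and pb = smooth_primitive[OF P b adm(2)]
  note posa = admissible_pos[OF adm(1)] and posb = admissible_pos[OF adm(2)]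
  note sm = smooth_log_mean[OF P] smooth_mult smooth_add smooth_diff smooth_divide smooth_midpoint
    smooth_const pa pb posa posb
  have nz: "midpoint (beta_e ge gi (a z)) (beta_e ge gi (b z)) \<noteq> 0"
    "log_mean (beta_i (a z)) (beta_i (b z)) \<noteq> 0"
    "(ge - 1) * log_mean (beta_e ge gi (a z)) (beta_e ge gi (b z)) \<noteq> 0" if "z \<in> P" for z
    using that ge midpoint_pos[OF posa(4) posb(4)] log_mean_pos[OF posa(4) posb(4)]
      log_mean_pos[OF posa(5) posb(5)] by (force, force, force)
  have g: "gi - 1 \<noteq> 0" using gi by simp
  show ?thesis unfolding ec_flux_x_def Let_def
    by (intro smooth_vector_5 sm nz g) auto
qed

lemma smooth_ec_flux_y:
  assumes "open P" "smooth_field P a" "smooth_field P b"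
    and "\<And>z. z \<in> P \<Longrightarrow> a z \<in> admissible ge gi" "\<And>z. z \<in> P \<Longrightarrow> b z \<in> admissible ge gi"
  shows "smooth_field P (\<lambda>z. ec_flux_y ge gi (a z) (b z) $ c)"
proof -
  have "smooth_field P (\<lambda>z. ec_flux_x ge gi (swap (a z)) (swap (b z)) $ c)" for c
    using assms by (intro smooth_ec_flux_x smooth_swap) auto
  then show ?thesis unfolding ec_flux_y_swap swap_def by (intro smooth_vector_5)
qed

lemma smooth_C_x:
  assumes "open P" "smooth_field P u" "\<And>z. z \<in> P \<Longrightarrow> u z \<in> admissible ge gi"
  shows "smooth_field P (\<lambda>z. C_x ge gi (u z) $ i $ j)"
proof -
  note prim = smooth_primitive[OF assms] and pos = admissible_pos[OF assms(3)]
  have nz: "dens (u z) \<noteq> 0" if "z \<in> P" for z using pos(1)[OF that] by simp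
  have g: "gi - 1 \<noteq> 0" using gi by simp
  have "\<forall>i. smooth_field P (\<lambda>z. C_x ge gi (u z) $ i $ j)"
    unfolding forall_5 C_x_def Let_def vector_5
    by (intro conjI smooth_vector_5 smooth_diff smooth_add smooth_minus smooth_mult smooth_power2 smooth_divide
        smooth_const prim nz g) auto
  then show ?thesis ..
qed

end

section \<open>Truncation error along a grid line\<close>

text \<open>
  A margin that leaves room for every stencil centred at a point of the compact set, once the mesh is
  fine enough.
\<close>

lemma compact_margin:
  fixes K :: "'a::heine_borel set"
  assumes "compact K" "open Q" "K \<subseteq> Q"
  obtains \<delta> where "0 < \<delta>" "\<delta> \<le> 1" "\<And>z. z \<in> K \<Longrightarrow> cball z \<delta> \<subseteq> Q"
proof -
  obtain \<epsilon> where \<epsilon>: "\<epsilon> > 0" "(\<Union>x\<in>K. cball x \<epsilon>) \<subseteq> Q"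
    using compact_subset_open_imp_cball_epsilon_subset[OF assms] by blast
  show ?thesis
  proof (rule that[of "min \<epsilon> 1"])
    fix z assume "z \<in> K"
    then show "cball z (min \<epsilon> 1) \<subseteq> Q" using \<epsilon>(2) by force
  qed (use \<epsilon> in auto)
qed

text \<open>
  Pairs of a point and a shift along \<open>e\<close> for which both endpoints lie in the domain of the field.
\<close>

definition shift_domain :: "'a::real_normed_vector \<Rightarrow> 'a set \<Rightarrow> ('a \<times> real) set" where
  "shift_domain e Q = {p. fst p \<in> Q \<and> fst p + snd p *\<^sub>R e \<in> Q}"

lemma open_shift_domain:
  assumes "open Q"
  shows "open (shift_domain e Q)"
proof -
  have "shift_domain e Q = fst -` Q \<inter> (\<lambda>p. fst p + snd p *\<^sub>R e) -` Q"
    by (auto simp: shift_domain_def)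
  then show ?thesis
    by (auto intro!: open_Int open_vimage assms continuous_intros)
qed

lemma shift_domain_margin:
  assumes "\<And>z. z \<in> K \<Longrightarrow> cball z \<delta> \<subseteq> Q" "norm e = 1" "z \<in> K" "\<bar>s\<bar> \<le> \<delta>"
  shows "(z, s) \<in> shift_domain e Q"
proof -
  have "z \<in> cball z \<delta>" "z + s *\<^sub>R e \<in> cball z \<delta>" using assms(2-4) by (auto simp: dist_norm)
  then have "z \<in> Q" "z + s *\<^sub>R e \<in> Q" using assms(1)[OF assms(3)] by blast+
  then show ?thesis by (simp add: shift_domain_def)
qed

lemma smooth_shifted:
  assumes "smooth_field Q v"
  shows "smooth_field (shift_domain e Q) (\<lambda>p. v (fst p))"
    "smooth_field (shift_domain e Q) (\<lambda>p. v (fst p + snd p *\<^sub>R e))"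
proof -
  have "bounded_linear (\<lambda>p :: 'a \<times> real. fst p + snd p *\<^sub>R e)"
    by (intro bounded_linear_add bounded_linear_fst bounded_linear_scaleR_left bounded_linear_compose[OF bounded_linear_scaleR_left bounded_linear_snd])
  then show "smooth_field (shift_domain e Q) (\<lambda>p. v (fst p + snd p *\<^sub>R e))"
    by (rule smooth_linear_compose[OF _ assms]) (auto simp: shift_domain_def)
  show "smooth_field (shift_domain e Q) (\<lambda>p. v (fst p))"
    by (rule smooth_linear_compose[OF bounded_linear_fst assms]) (auto simp: shift_domain_def)
qed

lemma line_derivative_bounds:
  fixes G :: "'a::real_normed_vector \<times> real \<Rightarrow> real"
  assumes Q: "open Q" and G: "smooth_field (shift_domain e Q) G" and K: "compact K"
    and \<delta>: "\<And>z. z \<in> K \<Longrightarrow> cball z \<delta> \<subseteq> Q" and e: "norm e = 1"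
  obtains D B where "D 0 = G"
    "\<And>n z s. (z, s) \<in> shift_domain e Q \<Longrightarrow> ((\<lambda>s. D n (z, s)) has_real_derivative D (Suc n) (z, s)) (at s)"
    "\<And>n z s. z \<in> K \<Longrightarrow> \<bar>s\<bar> \<le> \<delta> \<Longrightarrow> \<bar>D n (z, s)\<bar> \<le> B n"
proof -
  obtain D where D: "D 0 = G" "\<And>n. smooth_field (shift_domain e Q) (D n)"
    "\<And>n z s. (z, s) \<in> shift_domain e Q \<Longrightarrow> ((\<lambda>s. D n (z, s)) has_real_derivative D (Suc n) (z, s)) (at s)"
    using smooth_field_line_derivatives[OF open_shift_domain[OF Q] G] by blast
  have "K \<times> {-\<delta>..\<delta>} \<subseteq> shift_domain e Q"
    using shift_domain_margin[OF \<delta> e] by auto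
  then have "\<forall>n. \<exists>B. \<forall>p\<in>K \<times> {-\<delta>..\<delta>}. norm (D n p) \<le> B"
    using smooth_field_bounded[OF D(2)] K by (blast intro: compact_Times compact_Icc)
  then obtain B where "\<forall>n. \<forall>p\<in>K \<times> {-\<delta>..\<delta>}. norm (D n p) \<le> B n"
    using choice[of "\<lambda>n B. \<forall>p\<in>K \<times> {-\<delta>..\<delta>}. norm (D n p) \<le> B"] by blast
  then have "\<And>n z s. z \<in> K \<Longrightarrow> \<bar>s\<bar> \<le> \<delta> \<Longrightarrow> \<bar>D n (z, s)\<bar> \<le> B n" by force
  with D(1,3) show ?thesis by (rule that)
qed

lemma undiv_diff_smooth:
  fixes v :: "'a::real_normed_vector \<Rightarrow> real"
  assumes Q: "open Q" and v: "smooth_field Q v" and K: "compact K"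
    and \<delta>: "\<And>z. z \<in> K \<Longrightarrow> cball z \<delta> \<subseteq> Q" and e: "norm e = 1"
  shows "\<exists>M. \<forall>z\<in>K. \<forall>h i s. 0 < h \<longrightarrow> real k * h \<le> \<delta> \<longrightarrow> s \<in> {i - int k..i} \<longrightarrow>
    \<bar>undiv_diff k (\<lambda>m. v (z + (of_int (m - i) * h) *\<^sub>R e)) s\<bar> \<le> M * h ^ k"
proof -
  obtain D B where D: "D 0 = (\<lambda>p. v (fst p + snd p *\<^sub>R e))"
    "\<And>n z s. (z, s) \<in> shift_domain e Q \<Longrightarrow> ((\<lambda>s. D n (z, s)) has_real_derivative D (Suc n) (z, s)) (at s)"
    "\<And>n z s. z \<in> K \<Longrightarrow> \<bar>s\<bar> \<le> \<delta> \<Longrightarrow> \<bar>D n (z, s)\<bar> \<le> B n"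
    using line_derivative_bounds[OF Q smooth_shifted(2)[OF v] K \<delta> e] by blast
  have "\<bar>undiv_diff k (\<lambda>m. v (z + (of_int (m - i) * h) *\<^sub>R e)) s\<bar> \<le> B k * h ^ k"
    if z: "z \<in> K" and h: "0 < h" "real k * h \<le> \<delta>" and s: "s \<in> {i - int k..i}" for z h i s
  proof -
    have range: "\<bar>y\<bar> \<le> \<delta>"
      if y: "of_int s * h + - of_int i * h \<le> y" "y \<le> of_int (s + int k) * h + - of_int i * h" for y
    proof -
      have "of_int (s - i) * h \<le> y" "y \<le> of_int (s - i + int k) * h"
        using y by (simp_all add: algebra_simps)
      moreover have "of_int (- int k) * h \<le> of_int (s - i) * h"
        "of_int (s - i + int k) * h \<le> of_int (int k) * h"
        using s h unfolding mult_le_cancel_right_pos[OF h(1)] of_int_le_iff by auto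
      ultimately show ?thesis using h by (simp only: of_int_minus of_int_of_nat_eq)
    qed
    have "\<bar>undiv_diff k (\<lambda>m. D 0 (z, of_int m * h + - of_int i * h)) s\<bar> \<le> B k * h ^ k"
    proof (rule undiv_diff_bound[OF h(1)])
      fix j y assume "of_int s * h + - of_int i * h \<le> y" "y \<le> of_int (s + int k) * h + - of_int i * h"
      then have "\<bar>y\<bar> \<le> \<delta>" by (rule range)
      then show "((\<lambda>y. D j (z, y)) has_real_derivative D (Suc j) (z, y)) (at y)"
        by (intro D(2) shift_domain_margin[OF \<delta> e z])
    qed (intro D(3) z range)
    then show ?thesis by (simp add: D(1) algebra_simps)
  qed
  then show ?thesis by blast
qed

text \<open>
  For a symmetric \<open>F\<close> the function \<open>G (z, s) = F (w z) (w (z + s e))\<close> satisfies the assumption, since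
  exchanging the endpoints means starting from \<open>z + s e\<close> and shifting back. Differentiating the identity
  at \<open>s = 0\<close> relates the derivative along the diagonal to the one in the shift.
\<close>

lemma symmetric_flux_derivative:
  fixes G :: "'a::real_normed_vector \<times> real \<Rightarrow> real"
  assumes G': "(G has_derivative G') (at (z, 0))"
    and sym: "\<And>s. G (z + s *\<^sub>R e, - s) = G (z, s)"
  shows "((\<lambda>s. G (z + s *\<^sub>R e, 0)) has_real_derivative 2 * G' (0, 1)) (at 0)"
proof -
  have lin: "linear G'" using has_derivative_bounded_linear[OF G'] bounded_linear.linear by blast
  have d: "((\<lambda>s. G (z + s *\<^sub>R a, s * b)) has_real_derivative G' (a, b)) (at 0)" for a b
  proof -
    have "((\<lambda>s. (z + s *\<^sub>R a, s * b)) has_derivative (\<lambda>t. (t *\<^sub>R a, t * b))) (at 0)"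
      by (auto intro!: derivative_eq_intros)
    from has_derivative_compose[OF this, of G G'] G'
    have "((\<lambda>s. G (z + s *\<^sub>R a, s * b)) has_derivative (\<lambda>t. G' (t *\<^sub>R a, t * b))) (at 0)" by simp
    moreover have "(\<lambda>t. G' (t *\<^sub>R a, t * b)) = (*) (G' (a, b))"
      using linear_scale[OF lin, of _ "(a, b)"] by (auto simp: fun_eq_iff)
    ultimately show ?thesis by (simp add: has_field_derivative_def)
  qed
  have "(\<lambda>s. G (z + s *\<^sub>R e, s * - 1)) = (\<lambda>s. G (z + s *\<^sub>R 0, s * 1))" by (simp add: sym)
  then have "((\<lambda>s. G (z + s *\<^sub>R e, s * - 1)) has_real_derivative G' (0, 1)) (at 0)"
    using d[of 0 1] by simp
  then have "G' (e, - 1) = G' (0, 1)" by (rule DERIV_unique[OF d])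
  moreover have "G' (e, 0) = G' (e, - 1) + G' (0, 1)" using linear_add[OF lin, of "(e, - 1)" "(0, 1)"] by simp
  ultimately show ?thesis using d[of e 0] by simp
qed

text \<open>
  By symmetry the fluxes to the left of \<open>i\<close> are those to the right with negative shift. At fourth order,
  the flux between \<open>i - 1\<close> and \<open>i + 1\<close> occurs at both interfaces and cancels.
\<close>

lemma central_flux_difference:
  fixes w :: "'a::real_normed_vector \<Rightarrow> state" and F :: "state \<Rightarrow> state \<Rightarrow> real"
  assumes sym: "\<And>a b. F a b = F b a" and u: "\<And>m. u m = w (z + (of_int (m - i) * h) *\<^sub>R e)"
  shows "central_flux k F u i - central_flux k F u (i - 1)
     = odd_combination k (\<lambda>s. F (w z) (w (z + s *\<^sub>R e))) h"
proof -
  have u': "u i = w z" "u (i + 1) = w (z + h *\<^sub>R e)" "u (i + 2) = w (z + (2 * h) *\<^sub>R e)"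
    "u (i - 1) = w (z + (- h) *\<^sub>R e)" "u (i - 2) = w (z + (- (2 * h)) *\<^sub>R e)"
    using u by simp_all
  have i: "i - 1 + 1 = i" "i - 1 - 1 = i - 2" "i - 1 + 2 = i + 1" by simp_all
  show ?thesis
    unfolding central_flux_def odd_combination_def i u'
      sym[of "w (z + - h *\<^sub>R e)" "w z"] sym[of "w (z + - (2 * h) *\<^sub>R e)" "w z"]
    by (simp add: algebra_simps)
qed

text \<open>
  The flux difference is an odd combination of values of \<open>G (z, s) = F (w z) (w (z + s e))\<close>. Its linear
  Taylor term is twice the derivative of \<open>G\<close> in the shift, which by symmetry is the derivative of the
  flux along the line. Uniformity in \<open>z\<close> comes from bounding the derivatives of \<open>G\<close> on a compact set of
  pairs.
\<close>

lemma central_flux_consistency_scalar: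
  fixes w :: "'a::real_normed_vector \<Rightarrow> state" and F :: "state \<Rightarrow> state \<Rightarrow> real"
  assumes Q: "open Q" and K: "compact K"
    and \<delta>: "\<And>z. z \<in> K \<Longrightarrow> cball z \<delta> \<subseteq> Q" "0 < \<delta>" "\<delta> \<le> 1" and e: "norm e = 1"
    and k: "k \<in> {2, 3, 4}"
    and sym: "\<And>a b. F a b = F b a"
    and F: "smooth_field (shift_domain e Q) (\<lambda>p. F (w (fst p)) (w (fst p + snd p *\<^sub>R e)))"
  shows "\<exists>B. \<forall>z\<in>K. \<exists>d. ((\<lambda>s. F (w (z + s *\<^sub>R e)) (w (z + s *\<^sub>R e))) has_real_derivative d) (at 0) \<and>
    (\<forall>h u i. 0 < h \<longrightarrow> 2 * h \<le> \<delta> \<longrightarrow> (\<forall>m. u m = w (z + (of_int (m - i) * h) *\<^sub>R e)) \<longrightarrow>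
      \<bar>(central_flux k F u i - central_flux k F u (i - 1)) / h - d\<bar> \<le> B * h ^ k)"
proof -
  define G where "G p = F (w (fst p)) (w (fst p + snd p *\<^sub>R e))" for p
  obtain D B where D: "D 0 = G"
    "\<And>n z s. (z, s) \<in> shift_domain e Q \<Longrightarrow> ((\<lambda>s. D n (z, s)) has_real_derivative D (Suc n) (z, s)) (at s)"
    "\<And>n z s. z \<in> K \<Longrightarrow> \<bar>s\<bar> \<le> \<delta> \<Longrightarrow> \<bar>D n (z, s)\<bar> \<le> B n"
    using line_derivative_bounds[OF Q F[folded G_def] K \<delta>(1) e] by blast
  obtain G' where G': "\<And>p. p \<in> shift_domain e Q \<Longrightarrow> (G has_derivative G' p) (at p)"
    "\<And>v. smooth_field (shift_domain e Q) (\<lambda>p. G' p v)"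
    using smooth_field_derivative[OF open_shift_domain[OF Q] F[folded G_def]] by blast
  define M where "M = max (B 3) (B 5)"
  have deriv: "((\<lambda>s. F (w (z + s *\<^sub>R e)) (w (z + s *\<^sub>R e))) has_real_derivative 2 * D 1 (z, 0)) (at 0)"
    if z: "z \<in> K" for z
  proof -
    have z0: "(z, 0) \<in> shift_domain e Q" using shift_domain_margin[OF \<delta>(1) e z] \<delta>(2) by simp
    have "((\<lambda>s. (z, s)) has_derivative (\<lambda>t. (0, t))) (at 0)"
      by (auto intro!: derivative_eq_intros)
    from has_derivative_compose[OF this G'(1)[OF z0]]
    have "((\<lambda>s. G (z, s)) has_derivative (\<lambda>t. G' (z, 0) (0, t))) (at 0)" .
    moreover have "((\<lambda>s. G (z, s)) has_derivative (*) (D 1 (z, 0))) (at 0)"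
      using D(2)[OF z0, of 0] by (simp add: D(1) has_field_derivative_def)
    ultimately have "(\<lambda>t. G' (z, 0) (0, t)) = (*) (D 1 (z, 0))"
      by (rule has_derivative_unique)
    from fun_cong[OF this, of 1] have D1: "G' (z, 0) (0, 1) = D 1 (z, 0)" by simp
    have "((\<lambda>s. G (z + s *\<^sub>R e, 0)) has_real_derivative 2 * G' (z, 0) (0, 1)) (at 0)"
      by (rule symmetric_flux_derivative[OF G'(1)[OF z0]]) (simp add: G_def sym)
    then show ?thesis by (simp add: D1 G_def)
  qed
  have error: "\<bar>(central_flux k F u i - central_flux k F u (i - 1)) / h - 2 * D 1 (z, 0)\<bar> \<le> M * h ^ k"
    if z: "z \<in> K" and h: "0 < h" "2 * h \<le> \<delta>" and u: "\<forall>m. u m = w (z + (of_int (m - i) * h) *\<^sub>R e)"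
    for z h u i
  proof -
    have "\<bar>odd_combination k (\<lambda>s. D 0 (z, s)) h - 2 * h * D 1 (z, 0)\<bar> \<le> M * h ^ Suc k"
    proof (rule odd_combination_error[OF k h(1)])
      show "h \<le> 1" using h \<delta> by simp
      fix s assume "\<bar>s\<bar> \<le> 2 * h"
      then have s: "\<bar>s\<bar> \<le> \<delta>" using h by simp
      show "((\<lambda>s. D m (z, s)) has_real_derivative D (Suc m) (z, s)) (at s)" for m
        by (intro D(2) shift_domain_margin[OF \<delta>(1) e z s])
      show "\<bar>D 3 (z, s)\<bar> \<le> M" "\<bar>D 5 (z, s)\<bar> \<le> M"
        using D(3)[OF z s, of 3] D(3)[OF z s, of 5] by (auto simp: M_def)
    qed
    moreover have "odd_combination k (\<lambda>s. D 0 (z, s)) h = central_flux k F u i - central_flux k F u (i - 1)"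
      using central_flux_difference[of F u w z i h e k, OF sym u[rule_format]] by (simp add: D(1) G_def)
    ultimately have "\<bar>(central_flux k F u i - central_flux k F u (i - 1)) - 2 * h * D 1 (z, 0)\<bar> / h \<le> M * h ^ k"
      using h by (simp add: divide_le_eq mult_ac)
    moreover have "\<bar>(central_flux k F u i - central_flux k F u (i - 1)) - 2 * h * D 1 (z, 0)\<bar> / h
       = \<bar>(central_flux k F u i - central_flux k F u (i - 1)) / h - 2 * D 1 (z, 0)\<bar>"
      using h by (simp add: abs_divide[of _ h, unfolded abs_of_pos[OF h(1)], symmetric] diff_divide_distrib)
    ultimately show ?thesis by simp
  qed
  show ?thesis
  proof (rule exI[of _ M], rule ballI)
    fix z assume z: "z \<in> K"
    show "\<exists>d. ((\<lambda>s. F (w (z + s *\<^sub>R e)) (w (z + s *\<^sub>R e))) has_real_derivative d) (at 0) \<and>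
    (\<forall>h u i. 0 < h \<longrightarrow> 2 * h \<le> \<delta> \<longrightarrow> (\<forall>m. u m = w (z + (of_int (m - i) * h) *\<^sub>R e)) \<longrightarrow>
      \<bar>(central_flux k F u i - central_flux k F u (i - 1)) / h - d\<bar> \<le> M * h ^ k)"
      using deriv[OF z] error[OF z] by blast
  qed
qed


lemma has_derivative_vec_componentwise:
  fixes f :: "'a::real_normed_vector \<Rightarrow> real^'n"
  assumes "\<And>c. ((\<lambda>x. f x $ c) has_derivative (\<lambda>h. f' h $ c)) (at a)"
  shows "(f has_derivative f') (at a)"
  unfolding has_derivative_componentwise_within[of f]
proof
  fix b :: "real^'n" assume "b \<in> Basis"
  then obtain c where b: "b = axis c 1" by (auto simp: Basis_vec_def)
  show "((\<lambda>x. f x \<bullet> b) has_derivative (\<lambda>h. f' h \<bullet> b)) (at a)"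
    using assms[of c] by (simp add: b inner_axis)
qed

lemma has_vector_derivative_vec_componentwise:
  fixes f :: "real \<Rightarrow> real^'n"
  assumes "\<And>c. ((\<lambda>s. f s $ c) has_real_derivative d $ c) (at x)"
  shows "(f has_vector_derivative d) (at x)"
  unfolding has_vector_derivative_def
proof (rule has_derivative_vec_componentwise)
  show "((\<lambda>s. f s $ c) has_derivative (\<lambda>s. (s *\<^sub>R d) $ c)) (at x)" for c
    using assms[of c] by (simp add: has_field_derivative_def mult.commute[of _ "d $ c"])
qed

lemma central_flux_nth:
  "central_flux k F u i $ c = central_flux k (\<lambda>a b. F a b $ c) u i"
  by (simp add: central_flux_def)

text \<open>
  The bounds for the five components are added up to one for the norm.
\<close>

lemma central_flux_consistency:
  fixes w :: "'a::real_normed_vector \<Rightarrow> state" and F :: "state \<Rightarrow> state \<Rightarrow> state"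
  assumes Q: "open Q" and K: "compact K"
    and \<delta>: "\<And>z. z \<in> K \<Longrightarrow> cball z \<delta> \<subseteq> Q" "0 < \<delta>" "\<delta> \<le> 1" and e: "norm e = 1"
    and k: "k \<in> {2, 3, 4}"
    and sym: "\<And>a b. F a b = F b a"
    and F: "\<And>c. smooth_field (shift_domain e Q) (\<lambda>p. F (w (fst p)) (w (fst p + snd p *\<^sub>R e)) $ c)"
  shows "\<exists>B. \<forall>z\<in>K. \<exists>d. ((\<lambda>s. F (w (z + s *\<^sub>R e)) (w (z + s *\<^sub>R e))) has_vector_derivative d) (at 0) \<and>
    (\<forall>h u i. 0 < h \<longrightarrow> 2 * h \<le> \<delta> \<longrightarrow> (\<forall>m. u m = w (z + (of_int (m - i) * h) *\<^sub>R e)) \<longrightarrow>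
      norm ((1 / h) *\<^sub>R (central_flux k F u i - central_flux k F u (i - 1)) - d) \<le> B * h ^ k)"
proof -
  let ?F = "\<lambda>c a b. F a b $ c"
  define ok where "ok c z B d \<longleftrightarrow>
    ((\<lambda>s. ?F c (w (z + s *\<^sub>R e)) (w (z + s *\<^sub>R e))) has_real_derivative d) (at 0) \<and>
    (\<forall>h u i. 0 < h \<longrightarrow> 2 * h \<le> \<delta> \<longrightarrow> (\<forall>m. u m = w (z + (of_int (m - i) * h) *\<^sub>R e)) \<longrightarrow>
      \<bar>(central_flux k (?F c) u i - central_flux k (?F c) u (i - 1)) / h - d\<bar> \<le> B * h ^ k)" for c z B d
  have "\<exists>B. \<forall>z\<in>K. \<exists>d. ok c z B d" for c
    unfolding ok_def
    by (rule central_flux_consistency_scalar[OF Q K \<delta> e k _ F], assumption) (subst sym, rule refl)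
  then obtain B where B: "\<And>c z. z \<in> K \<Longrightarrow> \<exists>d. ok c z (B c) d" by metis
  show ?thesis
  proof (rule exI[of _ "\<Sum>c\<in>UNIV. B c"], rule ballI)
    fix z assume "z \<in> K"
    with B have "\<forall>c. \<exists>d. ok c z (B c) d" by blast
    then obtain d where ok: "\<forall>c. ok c z (B c) (d c)" by metis
    have d: "((\<lambda>s. ?F c (w (z + s *\<^sub>R e)) (w (z + s *\<^sub>R e))) has_real_derivative d c) (at 0)" for c
      using ok unfolding ok_def by blast
    have err: "\<bar>(central_flux k (?F c) u i - central_flux k (?F c) u (i - 1)) / h - d c\<bar> \<le> B c * h ^ k"
      if "0 < h" "2 * h \<le> \<delta>" "\<forall>m. u m = w (z + (of_int (m - i) * h) *\<^sub>R e)" for c h u i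
      using ok that unfolding ok_def by blast
    show "\<exists>d. ((\<lambda>s. F (w (z + s *\<^sub>R e)) (w (z + s *\<^sub>R e))) has_vector_derivative d) (at 0) \<and>
    (\<forall>h u i. 0 < h \<longrightarrow> 2 * h \<le> \<delta> \<longrightarrow> (\<forall>m. u m = w (z + (of_int (m - i) * h) *\<^sub>R e)) \<longrightarrow>
      norm ((1 / h) *\<^sub>R (central_flux k F u i - central_flux k F u (i - 1)) - d) \<le> (\<Sum>c\<in>UNIV. B c) * h ^ k)"
    proof (rule exI[of _ "\<chi> c. d c"], intro conjI allI impI)
      show "((\<lambda>s. F (w (z + s *\<^sub>R e)) (w (z + s *\<^sub>R e))) has_vector_derivative (\<chi> c. d c)) (at 0)"
        by (rule has_vector_derivative_vec_componentwise) (simp add: d)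
      fix h u i assume h: "0 < h" "2 * h \<le> \<delta>" and u: "\<forall>m. u m = w (z + (of_int (m - i) * h) *\<^sub>R e)"
      let ?x = "(1 / h) *\<^sub>R (central_flux k F u i - central_flux k F u (i - 1)) - (\<chi> c. d c)"
      have "norm ?x \<le> (\<Sum>c\<in>UNIV. \<bar>?x $ c\<bar>)" by (rule norm_le_l1_cart)
      also have "\<dots> \<le> (\<Sum>c\<in>UNIV. B c * h ^ k)"
        using err[OF h u] by (intro sum_mono) (simp add: central_flux_nth)
      finally show "norm ?x \<le> (\<Sum>c\<in>UNIV. B c) * h ^ k" by (simp add: sum_distrib_right)
    qed
  qed
qed

section \<open>The entropy-scaled eigenvectors and the diffusion terms\<close>

lemma has_derivative_nth: "((\<lambda>x. x $ c) has_derivative (\<lambda>h. h $ c)) (at (a :: real^'n))"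
  by (rule bounded_linear_imp_has_derivative[OF bounded_linear_vec_nth])

definition prim_jacobian :: "real \<Rightarrow> real \<Rightarrow> state \<Rightarrow> real^5^5" where
  "prim_jacobian ge gi W = vector
    [vector [1, 0, 0, 0, 0],
     vector [W$2, W$1, 0, 0, 0],
     vector [W$3, 0, W$1, 0, 0],
     vector [((W$2)\<^sup>2 + (W$3)\<^sup>2) / 2, W$1 * W$2, W$1 * W$3, 1 / (ge - 1), 1 / (gi - 1)],
     vector [0, 0, 0, 0, 1]]"

lemma jacobian_prim_to_cons: "jacobian (prim_to_cons ge gi) (at W) = prim_jacobian ge gi W"
proof -
  note nth = has_derivative_nth[of _ W]
  define G H where "G = 1 / (ge - 1)" and "H = 1 / (gi - 1)"
  have "((\<lambda>x. x $ 4 * G + x $ 5 * H + x $ 1 * (x $ 2 * x $ 2 + x $ 3 * x $ 3) * (1 / 2)) has_derivative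
     (\<lambda>h. (W $ 2 * W $ 2 + W $ 3 * W $ 3) / 2 * h $ 1 + W $ 1 * W $ 2 * h $ 2 + W $ 1 * W $ 3 * h $ 3
        + G * h $ 4 + H * h $ 5)) (at W)"
    by (rule derivative_eq_intros nth refl)+ (simp add: fun_eq_iff field_simps)
  then have 4: "((\<lambda>x. prim_to_cons ge gi x $ 4) has_derivative (\<lambda>h. (prim_jacobian ge gi W *v h) $ 4)) (at W)"
    by (simp add: prim_to_cons_def prim_jacobian_def matrix_vector_mult_def sum_5 G_def H_def power2_eq_square)
  have 2: "((\<lambda>x. x $ 1 * x $ c) has_derivative (\<lambda>h. W $ c * h $ 1 + W $ 1 * h $ c)) (at W)" for c
    by (rule derivative_eq_intros nth refl)+ (simp add: fun_eq_iff mult.commute)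
  have "(prim_to_cons ge gi has_derivative (\<lambda>h. prim_jacobian ge gi W *v h)) (at W)"
  proof (rule has_derivative_vec_componentwise)
    have "\<forall>c. ((\<lambda>x. prim_to_cons ge gi x $ c) has_derivative (\<lambda>h. (prim_jacobian ge gi W *v h) $ c)) (at W)"
      unfolding forall_5 using 4 nth 2
      by (simp add: prim_to_cons_def prim_jacobian_def matrix_vector_mult_def sum_5)
    then show "((\<lambda>x. prim_to_cons ge gi x $ c) has_derivative (\<lambda>h. (prim_jacobian ge gi W *v h) $ c)) (at W)" for c ..
  qed
  then have "frechet_derivative (prim_to_cons ge gi) (at W) = (*v) (prim_jacobian ge gi W)"
    by (rule frechet_derivative_at[symmetric])
  then show ?thesis by (simp add: jacobian_def matrix_of_matrix_vector_mul)
qed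

lemma invertible_iff_ker:
  fixes A :: "real^'n^'n"
  shows "invertible A \<longleftrightarrow> (\<forall>x. A *v x = 0 \<longrightarrow> x = 0)"
  by (simp add: invertible_left_inverse matrix_left_invertible_ker)

lemma matrix_vector_5:
  "(A *v x) $ i = A$i$1 * x$1 + A$i$2 * x$2 + A$i$3 * x$3 + A$i$4 * x$4 + A$i$5 * x$5"
  for A :: "real^5^'n"
  by (simp add: matrix_vector_mult_def sum_5)

lemma S_y_mult: "S_y ge gi U *v x = swap (S_x ge gi U *v x)"
  by (simp add: vec_eq_5 matrix_vector_5 S_y_def Let_def)

lemma swap_eq_0_iff: "swap x = 0 \<longleftrightarrow> x = 0"
  by (auto simp: vec_eq_5)

context
  fixes ge gi :: real
  assumes ge: "ge > 1" and gi: "gi > 1"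
begin

lemma invertible_prim_jacobian:
  assumes "W $ 1 > 0"
  shows "invertible (prim_jacobian ge gi W)"
  unfolding invertible_iff_ker
proof (intro allI impI)
  fix x assume "prim_jacobian ge gi W *v x = 0"
  then have "\<forall>i. (prim_jacobian ge gi W *v x) $ i = 0" by simp
  then show "x = 0"
    unfolding forall_5 matrix_vector_5 vec_eq_5 prim_jacobian_def vector_5
    using assms ge by auto
qed

lemma Theta_pos:
  assumes "U \<in> admissible ge gi"
  shows "Theta ge gi U > 0" "Theta1 ge gi > 0"
proof -
  note pos = admissible_pos[OF assms]
  show T1: "Theta1 ge gi > 0" using ge gi by (simp add: Theta1_def)
  have "ge + gi - 2 * ge * gi < 0"
  proof -
    have "(ge - 1) * gi > 0" "(gi - 1) * ge > 0" using ge gi by simp_all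
    then show ?thesis by (simp add: algebra_simps)
  qed
  then have "(p_ion U)\<^sup>2 * (ge + gi - 2 * ge * gi) < 0" using pos by (simp add: mult_pos_neg)
  moreover have "2 * p_ion U * dens U * Theta1 ge gi > 0" "(dens U)\<^sup>2 * (ge - 1) > 0"
    using pos T1 ge by simp_all
  ultimately have "2 * p_ion U * dens U * Theta1 ge gi - (p_ion U)\<^sup>2 * (ge + gi - 2 * ge * gi)
      + (dens U)\<^sup>2 * (ge - 1) > 0" by linarith
  then show "Theta ge gi U > 0" using pos ge by (simp add: Theta_def Let_def)
qed

text \<open>
  Rows 2 and 4 force the acoustic components 1 and 5 to vanish, row 3 the shear component. What remains
  is a two by two system for the components 2 and 4, whose determinant is positive because
  \<open>2 \<gamma>\<^sub>e \<gamma>\<^sub>i - \<gamma>\<^sub>e - \<gamma>\<^sub>i > \<gamma>\<^sub>e - 1\<close>.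
\<close>

lemma invertible_S_x:
  assumes "U \<in> admissible ge gi"
  shows "invertible (S_x ge gi U)"
  unfolding invertible_iff_ker
proof (intro allI impI)
  fix x assume x: "S_x ge gi U *v x = 0"
  note pos = admissible_pos[OF assms] Theta_pos[OF assms]
  define r p g T T1 where d: "r = dens U" "p = p_ion U" "g = 2 * ge - 1" "T = Theta ge gi U"
    "T1 = Theta1 ge gi"
  define Q where "Q = - gi + ge * (2 * gi - 1)"
  \<comment> \<open>\<open>e1\<close> and \<open>e2\<close> below are the first and the last row; \<open>det\<close> is their determinant up to factors\<close>
  have p: "r > 0" "p > 0" "g > 0" "T > 0" "T1 > 0" using pos ge by (simp_all add: d)
  have "\<forall>i. (S_x ge gi U *v x) $ i = 0" using x by simp
  then have row: "(S_x ge gi U *v x) $ 1 = 0" "(S_x ge gi U *v x) $ 2 = 0" "(S_x ge gi U *v x) $ 3 = 0"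
    "(S_x ge gi U *v x) $ 4 = 0" "(S_x ge gi U *v x) $ 5 = 0" by blast+
  have "x $ 3 = 0" using row(3) pos unfolding matrix_vector_5 S_x_def Let_def vector_5 by simp
  have "1 / dens U * sqrt (p_el ge gi U / 2) * (x $ 5 - x $ 1) = 0"
    using row(2) unfolding matrix_vector_5 S_x_def Let_def vector_5 by (auto simp: algebra_simps)
  then have "x $ 5 = x $ 1" using pos by simp
  have "p_el ge gi U / 2 * sqrt (g / r) * (x $ 1 + x $ 5) = 0"
    using row(4) unfolding matrix_vector_5 S_x_def Let_def vector_5 d by (auto simp: algebra_simps)
  then have "x $ 1 + x $ 5 = 0" using pos p by simp
  with \<open>x $ 5 = x $ 1\<close> have "x $ 1 = 0" "x $ 5 = 0" by auto
  have "(p * T1 + r * (ge - 1)) / (g * T) * x $ 2 + p * (ge - 1) / (g * T) * x $ 4 = 0"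
    using row(1) \<open>x $ 1 = 0\<close> \<open>x $ 5 = 0\<close> unfolding matrix_vector_5 S_x_def Let_def vector_5 d by simp
  then have "((p * T1 + r * (ge - 1)) * x $ 2 + p * (ge - 1) * x $ 4) / (g * T) = 0"
    by (simp add: add_divide_distrib distrib_right)
  then have e1: "(p * T1 + r * (ge - 1)) * x $ 2 + p * (ge - 1) * x $ 4 = 0"
    using p by simp
  have "p * (ge - 1) / (g * T) * x $ 2 + (p\<^sup>2 * Q + p * r * T1) / (r * g * T) * x $ 4 = 0"
    using row(5) \<open>x $ 1 = 0\<close> \<open>x $ 5 = 0\<close> unfolding matrix_vector_5 S_x_def Let_def vector_5 d Q_def by simp
  then have "(p * (r * (ge - 1) * x $ 2 + (p * Q + r * T1) * x $ 4)) / (r * g * T) = 0"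
  proof -
    have "p * (ge - 1) / (g * T) = p * r * (ge - 1) / (r * g * T)" using p by simp
    with \<open>p * (ge - 1) / (g * T) * x $ 2 + _ = 0\<close>
    have "(p * r * (ge - 1) * x $ 2 + (p\<^sup>2 * Q + p * r * T1) * x $ 4) / (r * g * T) = 0"
      by (simp only: add_divide_distrib times_divide_eq_left distrib_right)
    then show ?thesis by (simp add: algebra_simps power2_eq_square)
  qed
  then have e2: "r * (ge - 1) * x $ 2 + (p * Q + r * T1) * x $ 4 = 0" using p by simp
  have "(gi - 1) * ge > 0" "(ge - 1) * (gi - 1) > 0" using ge gi by simp_all
  then have Q: "Q > ge - 1" by (simp add: Q_def algebra_simps)
  have "r * (ge - 1) * (p * Q) > r * (ge - 1) * (p * (ge - 1))" using p ge Q by simp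
  moreover have "p * Q > 0" using p ge Q by simp
  then have "p * T1 * (p * Q + r * T1) > 0" using p by (simp add: add_pos_pos)
  moreover have "r * (ge - 1) * (r * T1) > 0" using p ge by simp
  ultimately have det: "(p * T1 + r * (ge - 1)) * (p * Q + r * T1) - r * (ge - 1) * (p * (ge - 1)) > 0"
    by (simp add: algebra_simps)
  have "((p * T1 + r * (ge - 1)) * (p * Q + r * T1) - r * (ge - 1) * (p * (ge - 1))) * x $ 2
     = (p * Q + r * T1) * ((p * T1 + r * (ge - 1)) * x $ 2 + p * (ge - 1) * x $ 4)
       - p * (ge - 1) * (r * (ge - 1) * x $ 2 + (p * Q + r * T1) * x $ 4)"
    by (simp add: algebra_simps)
  then have "x $ 2 = 0" using det unfolding e1 e2 by simp
  then have "x $ 4 = 0" using e1 p ge by simp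
  then show "x = 0" using \<open>x $ 1 = 0\<close> \<open>x $ 2 = 0\<close> \<open>x $ 3 = 0\<close> \<open>x $ 5 = 0\<close> by (simp add: vec_eq_5)
qed

lemma invertible_S_y:
  assumes "U \<in> admissible ge gi"
  shows "invertible (S_y ge gi U)"
  using invertible_S_x[OF assms] by (simp add: invertible_iff_ker S_y_mult swap_eq_0_iff)

lemma R_x_eq: "R_x ge gi U = prim_jacobian ge gi (cons_to_prim ge gi U) ** S_x ge gi U"
  and R_y_eq: "R_y ge gi U = prim_jacobian ge gi (cons_to_prim ge gi U) ** S_y ge gi U"
  using ge gi by (simp_all add: R_x_def R_y_def jacobian_prim_to_cons)

lemma invertible_R:
  assumes "U \<in> admissible ge gi"
  shows "invertible (R_x ge gi U)" "invertible (R_y ge gi U)"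
  unfolding R_x_eq R_y_eq using admissible_pos(1)[OF assms]
  by (auto intro!: invertible_mult invertible_prim_jacobian invertible_S_x invertible_S_y assms
      simp: cons_to_prim_def)

end

lemma mat_mult_vec: "mat c *v x = c *s x" for x :: "real^'n"
  by (simp add: vec_eq_iff matrix_vector_mult_def mat_def if_distrib[where f = "\<lambda>a. a * _"] cong: if_cong)

text \<open>
  The reconstructed jump before it is scaled back to the entropy variables.
\<close>

definition scaled_jump :: "nat \<Rightarrow> real \<Rightarrow> real \<Rightarrow> real^5^5 \<Rightarrow> (int \<Rightarrow> state) \<Rightarrow> int \<Rightarrow> state" where
  "scaled_jump k ge gi R u i = (\<chi> c. scalar_jump k (\<lambda>m. (transpose R *v entropy_var ge gi (u m)) $ c) i)"

lemma invertible_transpose: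
  fixes A :: "real^'n^'n"
  assumes "invertible A"
  shows "invertible (transpose A)"
  using assms unfolding invertible_def by (metis matrix_transpose_mul transpose_mat)

text \<open>
  Both one-sided values at an interface are scaled back with the same inverse, so that scaling again
  recovers the componentwise jumps.
\<close>

lemma transpose_recon_jump:
  assumes "invertible R"
  shows "transpose R *v recon_jump k ge gi R u i = scaled_jump k ge gi R u i"
proof -
  have "transpose R ** matrix_inv (transpose R) = mat 1"
    unfolding matrix_inv_def
    using someI_ex[OF invertible_transpose[OF assms, unfolded invertible_def]] by blast
  then have inv: "transpose R *v (matrix_inv (transpose R) *v y) = y" for y
    by (simp add: matrix_vector_mul_assoc)
  show ?thesis
    unfolding recon_jump_def recon_entropy_var_def matrix_vector_mult_diff_distrib inv scaled_jump_def
    by (simp add: vec_eq_iff scalar_jump_def)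
qed

lemma diffusion_jump:
  assumes "invertible R"
  shows "(R ** mat c ** transpose R) *v recon_jump k ge gi R u i = R *v (c *s scaled_jump k ge gi R u i)"
  by (simp only: matrix_vector_mul_assoc[symmetric] transpose_recon_jump[OF assms] mat_mult_vec)

text \<open>
  With \<open>R\<^sup>T\<close> moved to the other factor, the product is \<open>c\<close> times a sum over the scaled components of the
  jump times the reconstructed jump, and \<open>scalar_jump_sign\<close> applies to each term.
\<close>

lemma diffusion_dissipates:
  assumes R: "invertible R" and c: "c \<ge> 0" and k: "k \<in> {2, 3, 4}"
  shows "(entropy_var ge gi (u (i + 1)) - entropy_var ge gi (u i)) \<bullet>
      ((R ** mat c ** transpose R) *v recon_jump k ge gi R u i) \<ge> 0"
proof -
  let ?g = "\<lambda>m. transpose R *v entropy_var ge gi (u m)"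
  have "(entropy_var ge gi (u (i + 1)) - entropy_var ge gi (u i)) \<bullet>
      ((R ** mat c ** transpose R) *v recon_jump k ge gi R u i)
    = (?g (i + 1) - ?g i) \<bullet> (c *s scaled_jump k ge gi R u i)"
    unfolding diffusion_jump[OF R] by (simp only: dot_lmul_matrix[symmetric] transpose_matrix_vector vector_matrix_mult_diff_distrib
     matrix_vector_mult_diff_distrib)
  also have "\<dots> = (\<Sum>a\<in>UNIV. c * ((?g (i + 1) $ a - ?g i $ a) * scalar_jump k (\<lambda>m. ?g m $ a) i))"
    by (simp add: inner_vec_def scaled_jump_def mult_ac)
  also have "\<dots> \<ge> 0"
    by (intro sum_nonneg mult_nonneg_nonneg[OF c] scalar_jump_sign[OF k])
  finally show ?thesis .
qed

lemma norm_matrix_vector_le: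
  fixes A :: "real^5^5"
  assumes "\<And>i j. \<bar>A $ i $ j\<bar> \<le> M" "\<And>j. \<bar>x $ j\<bar> \<le> m"
  shows "norm (A *v x) \<le> 25 * (M * m)"
proof -
  have M: "M \<ge> 0" "m \<ge> 0" using assms(1)[of 1 1] assms(2)[of 1] by auto
  have "\<bar>(A *v x) $ i\<bar> \<le> 5 * (M * m)" for i
  proof -
    have "\<bar>(A *v x) $ i\<bar> \<le> (\<Sum>j\<in>UNIV. \<bar>A $ i $ j * x $ j\<bar>)"
      unfolding matrix_vector_mult_def by (simp add: sum_abs)
    also have "\<dots> \<le> (\<Sum>j\<in>(UNIV::5 set). M * m)"
      unfolding abs_mult using assms M by (intro sum_mono mult_mono) auto
    finally show ?thesis by simp
  qed
  then have "(\<Sum>i\<in>UNIV. \<bar>(A *v x) $ i\<bar>) \<le> (\<Sum>i\<in>(UNIV::5 set). 5 * (M * m))"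
    by (intro sum_mono)
  then show ?thesis using norm_le_l1_cart[of "A *v x"] by simp
qed

lemma undiv_diff_sum: "undiv_diff n (\<lambda>m. \<Sum>r\<in>A. c r * g r m) s = (\<Sum>r\<in>A. c r * undiv_diff n (g r) s)"
  by (induction n arbitrary: s) (simp_all add: sum_subtractf right_diff_distrib)

text \<open>
  The scaling matrix is the same for all cells of the stencil, so it commutes with undivided differences.
\<close>

lemma scaled_jump_le:
  assumes k: "k \<in> {2, 3, 4}" and R: "\<And>a b. \<bar>R $ a $ b\<bar> \<le> C"
    and M: "\<And>r s. s \<in> {i - int k + 1..i} \<Longrightarrow> \<bar>undiv_diff k (\<lambda>m. entropy_var ge gi (u m) $ r) s\<bar> \<le> M"
  shows "\<bar>scaled_jump k ge gi R u i $ c\<bar> \<le> real k * (5 * (C * M))"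
  unfolding scaled_jump_def vec_lambda_beta
proof (rule scalar_jump_le[OF k])
  fix s assume s: "s \<in> {i - int k + 1..i}"
  have C: "C \<ge> 0" using R[of 1 1] by simp
  have "\<bar>undiv_diff k (\<lambda>m. (transpose R *v entropy_var ge gi (u m)) $ c) s\<bar>
     = \<bar>\<Sum>r\<in>UNIV. R $ r $ c * undiv_diff k (\<lambda>m. entropy_var ge gi (u m) $ r) s\<bar>"
    unfolding undiv_diff_sum[symmetric] by (simp add: matrix_vector_mult_def transpose_def)
  also have "\<dots> \<le> (\<Sum>r\<in>UNIV. \<bar>R $ r $ c * undiv_diff k (\<lambda>m. entropy_var ge gi (u m) $ r) s\<bar>)"
    by (rule sum_abs)
  also have "\<dots> \<le> (\<Sum>r\<in>(UNIV::5 set). C * M)"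
    unfolding abs_mult using R M[OF s] C by (intro sum_mono mult_mono) auto
  finally show "\<bar>undiv_diff k (\<lambda>m. (transpose R *v entropy_var ge gi (u m)) $ c) s\<bar> \<le> 5 * (C * M)"
    by simp
qed

lemma max_speed_bounds:
  "0 \<le> max_speed ge gi U v" "max_speed ge gi U v \<le> \<bar>v\<bar> + \<bar>sqrt (2 * p_el ge gi U * (2 * ge - 1) / dens U)\<bar>"
proof -
  show "0 \<le> max_speed ge gi U v" unfolding max_speed_def Let_def
    by (rule order_trans[of _ "\<bar>v\<bar>"]) (auto intro!: Max_ge)
  show "max_speed ge gi U v \<le> \<bar>v\<bar> + \<bar>sqrt (2 * p_el ge gi U * (2 * ge - 1) / dens U)\<bar>"
    unfolding max_speed_def Let_def by (subst Max_le_iff) auto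
qed


lemma smooth_ident: "smooth_field P (\<lambda>z. z)"
  unfolding smooth_field_def
proof
  fix n show "C_n_on n P (\<lambda>z. z)"
  proof (cases n)
    case (Suc m)
    then show ?thesis using C_n_on_SucI[OF has_derivative_ident C_n_on_const] by blast
  qed simp
qed

lemma smooth_imp_continuous: "smooth_field P f \<Longrightarrow> continuous_on P f"
  unfolding smooth_field_def by (auto dest: spec[of _ 0])

lemma continuous_vector_5:
  assumes "continuous_on P a" "continuous_on P b" "continuous_on P c" "continuous_on P d" "continuous_on P e"
  shows "continuous_on P (\<lambda>z. (vector [a z, b z, c z, d z, e z] :: real^5) $ i)"
proof -
  have "\<forall>i. continuous_on P (\<lambda>z. (vector [a z, b z, c z, d z, e z] :: real^5) $ i)"
    using assms unfolding forall_5 vector_5 by blast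
  then show ?thesis ..
qed

context
  fixes ge gi :: real
  assumes ge: "ge > 1" and gi: "gi > 1"
begin

lemma open_admissible: "open (admissible ge gi)"
proof -
  define S where "S = {U. dens U > 0}"
  have S: "open S"
    unfolding S_def dens_def by (intro open_Collect_less continuous_intros)
  have "continuous_on S (\<lambda>U. p_el ge gi U)"
    unfolding p_el_def speed_sq_def vel_x_def vel_y_def energy_def p_ion_def dens_def
    by (intro continuous_intros) (use gi in \<open>auto simp: S_def dens_def\<close>)
  from continuous_open_preimage[OF this S open_greaterThan[of 0]]
  have "open (S \<inter> p_el ge gi -` {0<..})" .
  moreover have "open {U. 0 < p_ion U}"
    unfolding p_ion_def by (intro open_Collect_less continuous_intros)
  ultimately have "open ((S \<inter> p_el ge gi -` {0<..}) \<inter> {U. 0 < p_ion U})" by (rule open_Int)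
  also have "(S \<inter> p_el ge gi -` {0<..}) \<inter> {U. 0 < p_ion U} = admissible ge gi"
    by (auto simp: S_def admissible_def)
  finally show ?thesis .
qed

lemma continuous_R:
  "continuous_on (admissible ge gi) (\<lambda>U. R_x ge gi U $ a $ b)"
  "continuous_on (admissible ge gi) (\<lambda>U. R_y ge gi U $ a $ b)"
proof -
  let ?A = "admissible ge gi"
  note prim = smooth_primitive[OF ge gi open_admissible smooth_ident, THEN smooth_imp_continuous]
  have pos: "dens U > 0" "p_el ge gi U > 0" "p_ion U > 0" "Theta ge gi U > 0" if "U \<in> ?A" for U
    using admissible_pos[OF that] Theta_pos[OF ge gi that] by auto
  have nz: "dens U \<noteq> 0" "Theta ge gi U \<noteq> 0" if "U \<in> ?A" for U using pos[OF that] by auto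
  have g: "2 * ge - 1 \<noteq> 0" "2 * ge \<noteq> 1" "ge \<noteq> 1" "gi \<noteq> 1" using ge gi by simp_all
  have cont_T: "continuous_on ?A (\<lambda>U. Theta ge gi U)"
    unfolding Theta_def Let_def by (intro continuous_intros prim) (auto simp: nz g)
  have "\<forall>a. continuous_on ?A (\<lambda>U. S_x ge gi U $ a $ b)" for b
    unfolding forall_5 S_x_def Let_def vector_5 using g
    by (intro conjI continuous_vector_5 continuous_intros prim cont_T) (auto simp: nz g)
  then have S: "continuous_on ?A (\<lambda>U. S_x ge gi U $ a $ b)" for a b by blast
  have "\<forall>a. continuous_on ?A (\<lambda>U. S_y ge gi U $ a $ b)" for b
    unfolding forall_5 S_y_def Let_def vector_5 by (intro conjI S)
  then have S': "continuous_on ?A (\<lambda>U. S_y ge gi U $ a $ b)" for a b by blast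
  have "\<forall>a. continuous_on ?A (\<lambda>U. prim_jacobian ge gi (cons_to_prim ge gi U) $ a $ b)" for b
    unfolding forall_5 prim_jacobian_def cons_to_prim_def vector_5
    by (intro conjI continuous_vector_5 continuous_intros prim) (auto simp: g)
  then have J: "continuous_on ?A (\<lambda>U. prim_jacobian ge gi (cons_to_prim ge gi U) $ a $ b)" for a b by blast
  show "continuous_on ?A (\<lambda>U. R_x ge gi U $ a $ b)" "continuous_on ?A (\<lambda>U. R_y ge gi U $ a $ b)"
    unfolding R_x_eq[OF ge gi] R_y_eq[OF ge gi] matrix_matrix_mult_def vec_lambda_beta
    by (intro continuous_intros J S S')+
qed

text \<open>
  The single constant for all entries comes from maximizing one continuous function that dominates them.
\<close>

lemma R_max_speed_bounded:
  assumes Ks: "compact Ks" "Ks \<subseteq> admissible ge gi"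
  obtains C where "\<And>s a b. s \<in> Ks \<Longrightarrow> \<bar>R_x ge gi s $ a $ b\<bar> \<le> C"
    "\<And>s a b. s \<in> Ks \<Longrightarrow> \<bar>R_y ge gi s $ a $ b\<bar> \<le> C"
    "\<And>s. s \<in> Ks \<Longrightarrow> max_speed ge gi s (vel_x s) \<le> C" "\<And>s. s \<in> Ks \<Longrightarrow> max_speed ge gi s (vel_y s) \<le> C"
proof -
  let ?A = "admissible ge gi"
  note prim = smooth_primitive[OF ge gi open_admissible smooth_ident, THEN smooth_imp_continuous]
  have nz: "dens U \<noteq> 0" if "U \<in> ?A" for U using admissible_pos(1)[OF that] by auto
  define c where "c U = \<bar>sqrt (2 * p_el ge gi U * (2 * ge - 1) / dens U)\<bar>" for U
  define X Y where "X U = (\<Sum>a\<in>UNIV. \<Sum>b\<in>UNIV. \<bar>R_x ge gi U $ a $ b\<bar>)"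
    and "Y U = (\<Sum>a\<in>UNIV. \<Sum>b\<in>UNIV. \<bar>R_y ge gi U $ a $ b\<bar>)" for U
  define f where "f U = X U + Y U + \<bar>vel_x U\<bar> + \<bar>vel_y U\<bar> + c U" for U
  have "continuous_on ?A f"
    unfolding f_def X_def Y_def c_def by (intro continuous_intros continuous_R prim) (auto simp: nz)
  then have "compact (f ` Ks)" using Ks by (meson compact_continuous_image continuous_on_subset)
  from compact_imp_bounded[OF this] obtain C where C: "\<And>s. s \<in> Ks \<Longrightarrow> \<bar>f s\<bar> \<le> C"
    by (auto simp: bounded_iff)
  have entry: "\<bar>A $ a $ b\<bar> \<le> (\<Sum>a\<in>UNIV. \<Sum>b\<in>UNIV. \<bar>A $ a $ b\<bar>)" for A :: "real^5^5" and a b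
  proof -
    have "\<bar>A $ a $ b\<bar> \<le> (\<Sum>b\<in>UNIV. \<bar>A $ a $ b\<bar>)" by (rule member_le_sum) auto
    also have "\<dots> \<le> (\<Sum>a\<in>UNIV. \<Sum>b\<in>UNIV. \<bar>A $ a $ b\<bar>)"
      by (rule member_le_sum[of a UNIV "\<lambda>a. \<Sum>b\<in>UNIV. \<bar>A $ a $ b\<bar>"]) (auto intro: sum_nonneg)
    finally show ?thesis .
  qed
  have nonneg: "X U \<ge> 0" "Y U \<ge> 0" "c U \<ge> 0" for U
    by (auto simp: X_def Y_def c_def intro!: sum_nonneg)
  show ?thesis
  proof (rule that[of C])
    fix s assume s: "s \<in> Ks"
    have f: "f s \<le> C" using C[OF s] by simp
    show "\<bar>R_x ge gi s $ a $ b\<bar> \<le> C" for a b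
      using entry[of "R_x ge gi s" a b] nonneg[of s] f unfolding f_def X_def[symmetric] by linarith
    show "\<bar>R_y ge gi s $ a $ b\<bar> \<le> C" for a b
      using entry[of "R_y ge gi s" a b] nonneg[of s] f unfolding f_def Y_def[symmetric] by linarith
    show "max_speed ge gi s (vel_x s) \<le> C" "max_speed ge gi s (vel_y s) \<le> C"
      using max_speed_bounds(2)[of ge gi s "vel_x s"] max_speed_bounds(2)[of ge gi s "vel_y s"]
        nonneg[of s] f unfolding f_def c_def[symmetric] by linarith+
  qed
qed

section \<open>The entropy derivative and the central balance\<close>

text \<open>
  The entropy variables are the gradient of the entropy. The pressure differential is
  \<open>dp\<^sub>e = (\<gamma>\<^sub>e - 1) (dE - dp\<^sub>i / (\<gamma>\<^sub>i - 1) - v \<bullet> d(\<rho> v) + \<bar>v\<bar>\<^sup>2 / 2 d\<rho>)\<close>.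
\<close>

lemma entropy_has_derivative:
  assumes U: "U \<in> admissible ge gi"
  shows "(entropy ge gi has_derivative (\<lambda>h. entropy_var ge gi U \<bullet> h)) (at U)"
proof -
  note pos = admissible_pos[OF U]
  define r p q where "r = dens U" and "p = p_el ge gi U" and "q = p_ion U"
  define vx vy where "vx = vel_x U" and "vy = vel_y U"
  have r: "r > 0" "p > 0" "q > 0" using pos by (simp_all add: r_def p_def q_def)
  have U1: "U $ 1 = r" "U $ 2 = r * vx" "U $ 3 = r * vy"
    using pos by (simp_all add: r_def vx_def vy_def vel_x_def vel_y_def dens_def)
  define dp where "dp h = (ge - 1) * (h $ 4 - h $ 5 / (gi - 1)
      - (vx * h $ 2 + vy * h $ 3 - (vx\<^sup>2 + vy\<^sup>2) / 2 * h $ 1))" for h :: state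
  define G H where "G = 1 / (ge - 1)" and "H = 1 / (gi - 1)"
  define S where "S W = (ln (p_el ge gi W) - ge * ln (W $ 1)) * G + (ln (W $ 5) - gi * ln (W $ 1)) * H"
    for W :: state
  have S: "spec_entropy ge gi W = S W" if "W \<in> admissible ge gi" for W
    using admissible_pos[OF that]
    by (simp add: spec_entropy_def S_def G_def H_def dens_def p_ion_def ln_div ln_powr)
  have v: "((\<lambda>W. W $ c / W $ 1) has_derivative (\<lambda>h. (h $ c - U $ c / r * h $ 1) / r)) (at U)" for c
  proof -
    have "U $ 1 \<noteq> 0" using r U1 by simp
    from has_derivative_divide'[OF has_derivative_nth has_derivative_nth this, of c]
    show ?thesis using r by (simp add: U1(1) field_simps)
  qed
  have x: "((\<lambda>W. W $ 2 / W $ 1) has_derivative (\<lambda>h. (h $ 2 - vx * h $ 1) / r)) (at U)"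
    and y: "((\<lambda>W. W $ 3 / W $ 1) has_derivative (\<lambda>h. (h $ 3 - vy * h $ 1) / r)) (at U)"
    using v[of 2] v[of 3] r by (simp_all add: U1)
  have pe: "(p_el ge gi has_derivative dp) (at U)"
  proof -
    have "((\<lambda>W. (ge - 1) * (W $ 4 - W $ 5 * H
        - W $ 1 * (W $ 2 / W $ 1 * (W $ 2 / W $ 1) + W $ 3 / W $ 1 * (W $ 3 / W $ 1)) * (1 / 2)))
      has_derivative (\<lambda>h. (ge - 1) * (h $ 4 - h $ 5 * H
        - (U $ 1 * ((U $ 2 / U $ 1 * ((h $ 2 - vx * h $ 1) / r) + (h $ 2 - vx * h $ 1) / r * (U $ 2 / U $ 1))
            + (U $ 3 / U $ 1 * ((h $ 3 - vy * h $ 1) / r) + (h $ 3 - vy * h $ 1) / r * (U $ 3 / U $ 1)))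
          + h $ 1 * (U $ 2 / U $ 1 * (U $ 2 / U $ 1) + U $ 3 / U $ 1 * (U $ 3 / U $ 1))) * (1 / 2)))) (at U)"
      by (intro has_derivative_mult_right has_derivative_mult_left has_derivative_diff has_derivative_add
          has_derivative_mult x y has_derivative_nth)
    moreover have "(ge - 1) * (h $ 4 - h $ 5 * H
        - (U $ 1 * ((U $ 2 / U $ 1 * ((h $ 2 - vx * h $ 1) / r) + (h $ 2 - vx * h $ 1) / r * (U $ 2 / U $ 1))
            + (U $ 3 / U $ 1 * ((h $ 3 - vy * h $ 1) / r) + (h $ 3 - vy * h $ 1) / r * (U $ 3 / U $ 1)))
          + h $ 1 * (U $ 2 / U $ 1 * (U $ 2 / U $ 1) + U $ 3 / U $ 1 * (U $ 3 / U $ 1))) * (1 / 2)) = dp h" for h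
    proof -
      have e: "U $ 2 / U $ 1 = vx" "U $ 3 / U $ 1 = vy" using r by (simp_all add: U1)
      have f: "r * (a * (b / r)) = a * b" "r * (b / r * a) = a * b" "r * (a + b) = r * a + r * b" for a b
        using r by (simp_all add: distrib_left)
      show ?thesis unfolding e unfolding U1(1) f dp_def H_def by (simp add: algebra_simps power2_eq_square add_divide_distrib)
    qed
    ultimately show ?thesis
      by (simp add: p_el_def[abs_def] energy_def p_ion_def dens_def speed_sq_def vel_x_def vel_y_def
          power2_eq_square H_def cong: if_cong)
  qed
  have lnp: "((\<lambda>W. ln (p_el ge gi W)) has_derivative (\<lambda>h. dp h * inverse p)) (at U)"
    using has_derivative_ln[OF _ pe] r by (simp add: p_def)
  have ln1: "((\<lambda>W. ln (W $ 1)) has_derivative (\<lambda>h. h $ 1 * inverse r)) (at U)"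
    and ln5: "((\<lambda>W. ln (W $ 5)) has_derivative (\<lambda>h. h $ 5 * inverse q)) (at U)"
    using has_derivative_ln[OF _ has_derivative_nth, of U 1] has_derivative_ln[OF _ has_derivative_nth, of U 5] r
    by (simp_all add: U1 q_def p_ion_def)
  have "((\<lambda>W. - (W $ 1 * S W)) has_derivative (\<lambda>h. - (U $ 1 * ((dp h * inverse p - ge * (h $ 1 * inverse r)) * G
      + (h $ 5 * inverse q - gi * (h $ 1 * inverse r)) * H) + h $ 1 * S U))) (at U)"
    unfolding S_def
    by (intro has_derivative_mult_right has_derivative_mult_left has_derivative_diff has_derivative_add
          has_derivative_minus has_derivative_mult lnp ln1 ln5 has_derivative_nth)
  moreover have "- (U $ 1 * ((dp h * inverse p - ge * (h $ 1 * inverse r)) * G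
      + (h $ 5 * inverse q - gi * (h $ 1 * inverse r)) * H) + h $ 1 * S U)
     = entropy_var ge gi U \<bullet> h" for h
  proof -
    have be: "beta_e ge gi U = r * inverse p" "beta_i U = r * inverse q" "speed_sq U = vx\<^sup>2 + vy\<^sup>2"
      by (simp_all add: beta_e_def beta_i_def speed_sq_def r_def p_def q_def vx_def vy_def divide_inverse)
    have dp: "dp h * inverse p * G = inverse p * (h $ 4 - h $ 5 * H
        - (vx * h $ 2 + vy * h $ 3 - (vx\<^sup>2 + vy\<^sup>2) / 2 * h $ 1))"
      using ge by (simp add: dp_def H_def G_def)
    have c: "ge / (ge - 1) = ge * G" "gi / (gi - 1) = gi * H"
      "(r * inverse p - r * inverse q) / (gi - 1) = (r * inverse p - r * inverse q) * H"
      by (simp_all add: G_def H_def)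
    have "r * inverse r = 1" using r by simp
    then have "U $ 1 * ((dp h * inverse p - ge * (h $ 1 * inverse r)) * G
      + (h $ 5 * inverse q - gi * (h $ 1 * inverse r)) * H)
      = r * (dp h * inverse p * G) - ge * h $ 1 * G + r * inverse q * h $ 5 * H - gi * h $ 1 * H"
      unfolding U1(1) by algebra
    then show ?thesis
      unfolding dp inner_5 entropy_var_def vector_5 S[OF U] be c vx_def[symmetric] vy_def[symmetric]
      by (simp add: algebra_simps)
  qed
  ultimately have "((\<lambda>W. - (W $ 1 * S W)) has_derivative (\<lambda>h. entropy_var ge gi U \<bullet> h)) (at U)"
    by simp
  then show ?thesis
    by (rule has_derivative_transform_within_open[OF _ open_admissible U])
      (simp add: entropy_def S dens_def)
qed

end

text \<open>
  The jump condition gives \<open>V a \<bullet> F a b = H a b + \<Phi> a\<close> and \<open>V b \<bullet> F a b = H a b + \<Phi> b\<close>. At the centre the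
  potentials of the right and of the left interface cancel. At fourth order the flux
  between \<open>i - 1\<close> and \<open>i + 1\<close>, in which \<open>i\<close> is not an endpoint, cancels beforehand.
\<close>

lemma line_entropy_balance:
  fixes F :: "state \<Rightarrow> state \<Rightarrow> state" and \<Phi> :: "state \<Rightarrow> real" and V :: "state \<Rightarrow> state"
  assumes k: "k \<in> {2, 3, 4}"
    and jump: "\<And>a b. a \<in> A \<Longrightarrow> b \<in> A \<Longrightarrow> (V b - V a) \<bullet> F a b = \<Phi> b - \<Phi> a"
    and H: "\<And>a b. H a b = midpoint (V a) (V b) \<bullet> F a b - midpoint (\<Phi> a) (\<Phi> b)"
    and u: "\<And>m. m \<in> {i - int k..i + int k} \<Longrightarrow> u m \<in> A"
  shows "V (u i) \<bullet> (central_flux k F u i - central_flux k F u (i - 1))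
    = central_flux k H u i - central_flux k H u (i - 1)"
proof -
  have lr: "V a \<bullet> F a b = H a b + \<Phi> a \<and> V b \<bullet> F a b = H a b + \<Phi> b" if "a \<in> A" "b \<in> A" for a b
    using jump[OF that] unfolding H midpoint_def
    by (simp add: inner_add_left inner_diff_left field_simps)
  have nn: "u i \<in> A" "u (i + 1) \<in> A" "u (i - 1) \<in> A" "u (i + 2) \<in> A" "u (i - 2) \<in> A"
    using k by (auto intro!: u)
  have shift: "i - 1 + 1 = i" "i - 1 - 1 = i - 2" "i - 1 + 2 = i + 1" by simp_all
  note e = lr[OF nn(1) nn(2)] lr[OF nn(3) nn(1)] lr[OF nn(1) nn(4)] lr[OF nn(5) nn(1)]
  show ?thesis
    unfolding central_flux_def shift using e
    by (simp add: inner_diff_right inner_add_right algebra_simps)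
qed

section \<open>Entropy inequality\<close>

text \<open>
  The difference of the two sides is a quarter of the sum of the two products that are assumed to be
  nonnegative, since \<open>V\<close> differs from the interface means by half the jumps.
\<close>

lemma entropy_production_le:
  fixes f f' d d' V V' V'' :: state
  assumes bal: "V \<bullet> (f - f') = q - q'"
    and "(V'' - V) \<bullet> d \<ge> 0" "(V - V') \<bullet> d' \<ge> 0"
  shows "(q - 1/2 * (midpoint V V'' \<bullet> d)) - (q' - 1/2 * (midpoint V' V \<bullet> d'))
     \<le> V \<bullet> ((f - (1/2) *\<^sub>R d) - (f' - (1/2) *\<^sub>R d'))"
  using assms
  by (simp add: midpoint_def inner_diff_left inner_diff_right inner_add_left algebra_simps)

context
  fixes ge gi :: real
  assumes ge: "ge > 1" and gi: "gi > 1"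
begin

lemma ec_flux_y_jump:
  assumes "Ul \<in> admissible ge gi" "Ur \<in> admissible ge gi"
  shows "(entropy_var ge gi Ur - entropy_var ge gi Ul) \<bullet> ec_flux_y ge gi Ul Ur
         = potential_y ge gi Ur - potential_y ge gi Ul"
  using ec_flux_x_jump[OF ge gi, of "swap Ul" "swap Ur"] assms
  by (simp add: ec_flux_y_swap potential_y_swap entropy_var_swap inner_swap_left swap_diff)

lemma entropy_var_C_y:
  assumes "U \<in> admissible ge gi"
  shows "entropy_var ge gi U \<bullet> (C_y ge gi U *v a) = 0"
  using entropy_var_C_x[OF ge gi, of "swap U" "swap a"] assms
  by (simp add: C_y_swap entropy_var_swap inner_swap_left)

lemma es_flux_x_entropy_le:
  assumes k: "k \<in> {2, 3, 4}" and s: "s \<in> admissible ge gi" "s' \<in> admissible ge gi"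
    and U: "\<And>m. m \<in> {i - int k..i + int k} \<Longrightarrow> U m j \<in> admissible ge gi"
  shows "es_entropy_flux_x k ge gi s U i j - es_entropy_flux_x k ge gi s' U (i - 1) j
    \<le> entropy_var ge gi (U i j) \<bullet> (es_flux_x k ge gi s U i j - es_flux_x k ge gi s' U (i - 1) j)"
  unfolding es_flux_x_def es_entropy_flux_x_def diff_add_cancel
proof (rule entropy_production_le)
  show "entropy_var ge gi (U i j) \<bullet> (central_flux k (ec_flux_x ge gi) (\<lambda>m. U m j) i
      - central_flux k (ec_flux_x ge gi) (\<lambda>m. U m j) (i - 1))
    = central_flux k (ec_entropy_flux_x ge gi) (\<lambda>m. U m j) i
      - central_flux k (ec_entropy_flux_x ge gi) (\<lambda>m. U m j) (i - 1)"
    by (rule line_entropy_balance[OF k ec_flux_x_jump[OF ge gi] ec_entropy_flux_x_def, where u = "\<lambda>m. U m j"])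
      (auto intro: U)
  show "0 \<le> (entropy_var ge gi (U (i + 1) j) - entropy_var ge gi (U i j)) \<bullet>
      (D_x ge gi s *v recon_jump k ge gi (R_x ge gi s) (\<lambda>m. U m j) i)"
    unfolding D_x_def
    by (rule diffusion_dissipates[OF invertible_R(1)[OF ge gi s(1)] max_speed_bounds(1) k])
  show "0 \<le> (entropy_var ge gi (U i j) - entropy_var ge gi (U (i - 1) j)) \<bullet>
      (D_x ge gi s' *v recon_jump k ge gi (R_x ge gi s') (\<lambda>m. U m j) (i - 1))"
    using diffusion_dissipates[OF invertible_R(1)[OF ge gi s(2)] max_speed_bounds(1) k,
        where u = "\<lambda>m. U m j" and i = "i - 1"] unfolding D_x_def by simp
qed

lemma es_flux_y_entropy_le:
  assumes k: "k \<in> {2, 3, 4}" and s: "s \<in> admissible ge gi" "s' \<in> admissible ge gi"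
    and U: "\<And>m. m \<in> {j - int k..j + int k} \<Longrightarrow> U i m \<in> admissible ge gi"
  shows "es_entropy_flux_y k ge gi s U i j - es_entropy_flux_y k ge gi s' U i (j - 1)
    \<le> entropy_var ge gi (U i j) \<bullet> (es_flux_y k ge gi s U i j - es_flux_y k ge gi s' U i (j - 1))"
  unfolding es_flux_y_def es_entropy_flux_y_def diff_add_cancel
proof (rule entropy_production_le)
  show "entropy_var ge gi (U i j) \<bullet> (central_flux k (ec_flux_y ge gi) (\<lambda>m. U i m) j
      - central_flux k (ec_flux_y ge gi) (\<lambda>m. U i m) (j - 1))
    = central_flux k (ec_entropy_flux_y ge gi) (\<lambda>m. U i m) j
      - central_flux k (ec_entropy_flux_y ge gi) (\<lambda>m. U i m) (j - 1)"
    by (rule line_entropy_balance[OF k ec_flux_y_jump ec_entropy_flux_y_def, where u = "\<lambda>m. U i m"])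
      (auto intro: U)
  show "0 \<le> (entropy_var ge gi (U i (j + 1)) - entropy_var ge gi (U i j)) \<bullet>
      (D_y ge gi s *v recon_jump k ge gi (R_y ge gi s) (\<lambda>m. U i m) j)"
    unfolding D_y_def
    by (rule diffusion_dissipates[OF invertible_R(2)[OF ge gi s(1)] max_speed_bounds(1) k])
  show "0 \<le> (entropy_var ge gi (U i j) - entropy_var ge gi (U i (j - 1))) \<bullet>
      (D_y ge gi s' *v recon_jump k ge gi (R_y ge gi s') (\<lambda>m. U i m) (j - 1))"
    using diffusion_dissipates[OF invertible_R(2)[OF ge gi s(2)] max_speed_bounds(1) k,
        where u = "\<lambda>m. U i m" and i = "j - 1"] unfolding D_y_def by simp
qed

text \<open>
  If \<open>t\<close> is an isolated time the derivative within \<open>T\<close> is not unique; the chain rule still provides the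
  value \<open>V \<bullet> rhs\<close> that satisfies the inequality.
\<close>

lemma scheme_entropy_inequality:
  assumes k: "k \<in> {2, 3, 4}" and dx: "dx > 0" "dy > 0"
    and sol: "scheme_solution k ge gi dx dy G T sx sy U" and t: "t \<in> T" and st: "stencil k i j \<subseteq> G"
  shows "\<exists>E'. ((\<lambda>\<tau>. entropy ge gi (U \<tau> i j)) has_real_derivative E') (at t within T) \<and>
     E' + 1 / dx * (es_entropy_flux_x k ge gi (sx t i j) (U t) i j
                    - es_entropy_flux_x k ge gi (sx t (i - 1) j) (U t) (i - 1) j)
        + 1 / dy * (es_entropy_flux_y k ge gi (sy t i j) (U t) i j
                    - es_entropy_flux_y k ge gi (sy t i (j - 1)) (U t) i (j - 1)) \<le> 0"
proof -
  have adm: "U t a b \<in> admissible ge gi" if "(a, b) \<in> stencil k i j" for a b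
    using sol t st that unfolding scheme_solution_def by blast
  have s: "sx t a b \<in> admissible ge gi" "sy t a b \<in> admissible ge gi" for a b
    using sol t unfolding scheme_solution_def by blast+
  define rhs where "rhs = scheme_rhs k ge gi dx dy (sx t) (sy t) (U t) i j"
  have der: "((\<lambda>\<tau>. U \<tau> i j) has_vector_derivative rhs) (at t within T)"
    using sol t st unfolding scheme_solution_def rhs_def by blast
  define V where "V = entropy_var ge gi (U t i j)"
  have Uij: "U t i j \<in> admissible ge gi" by (rule adm) (simp add: stencil_def)
  have "((\<lambda>\<tau>. entropy ge gi (U \<tau> i j)) has_derivative (\<lambda>h. V \<bullet> (h *\<^sub>R rhs))) (at t within T)"
    using has_derivative_compose[OF der[unfolded has_vector_derivative_def]
        entropy_has_derivative[OF ge gi Uij]] unfolding V_def .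
  then have E: "((\<lambda>\<tau>. entropy ge gi (U \<tau> i j)) has_real_derivative V \<bullet> rhs) (at t within T)"
    by (simp add: has_field_derivative_def mult.commute[of _ "V \<bullet> rhs"])
  define fx where "fx = es_flux_x k ge gi (sx t i j) (U t) i j - es_flux_x k ge gi (sx t (i - 1) j) (U t) (i - 1) j"
  define fy where "fy = es_flux_y k ge gi (sy t i j) (U t) i j - es_flux_y k ge gi (sy t i (j - 1)) (U t) i (j - 1)"
  have "V \<bullet> rhs = - (1 / dx * (V \<bullet> fx)) - 1 / dy * (V \<bullet> fy)"
    unfolding rhs_def scheme_rhs_def V_def fx_def[symmetric] fy_def[symmetric]
    by (simp add: inner_diff_right entropy_var_C_x[OF ge gi Uij] entropy_var_C_y[OF Uij])
  moreover have "1 / dx * (es_entropy_flux_x k ge gi (sx t i j) (U t) i j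
                    - es_entropy_flux_x k ge gi (sx t (i - 1) j) (U t) (i - 1) j) \<le> 1 / dx * (V \<bullet> fx)"
    unfolding V_def fx_def using dx s
    by (intro mult_left_mono es_flux_x_entropy_le k adm) (auto simp: stencil_def)
  moreover have "1 / dy * (es_entropy_flux_y k ge gi (sy t i j) (U t) i j
                    - es_entropy_flux_y k ge gi (sy t i (j - 1)) (U t) i (j - 1)) \<le> 1 / dy * (V \<bullet> fy)"
    unfolding V_def fy_def using dx s
    by (intro mult_left_mono es_flux_y_entropy_le k adm) (auto simp: stencil_def)
  ultimately show ?thesis using E by (intro exI[of _ "V \<bullet> rhs"]) auto
qed

section \<open>Consistency of the entropy fluxes\<close>

lemma ec_entropy_flux_consistent:
  assumes "u \<in> admissible ge gi"
  shows "ec_entropy_flux_x ge gi u u = entropy_flux_x ge gi u"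
    "ec_entropy_flux_y ge gi u u = entropy_flux_y ge gi u"
proof -
  have x: "ec_entropy_flux_x ge gi u u = entropy_flux_x ge gi u" if "u \<in> admissible ge gi" for u
    using that by (simp add: ec_entropy_flux_x_def ec_flux_x_consistent[OF ge gi] potential_x_def)
  show "ec_entropy_flux_x ge gi u u = entropy_flux_x ge gi u" by (rule x[OF assms])
  show "ec_entropy_flux_y ge gi u u = entropy_flux_y ge gi u"
    using x[of "swap u"] assms by (simp add: ec_entropy_flux_y_swap entropy_flux_y_swap)
qed

end

lemma undiv_diff_const: "(\<And>m. m \<in> {s..s + int (Suc n)} \<Longrightarrow> g m = c) \<Longrightarrow> undiv_diff (Suc n) g s = 0"
proof (induction n arbitrary: s)
  case (Suc n)
  have "undiv_diff (Suc n) g s = 0" "undiv_diff (Suc n) g (s + 1) = 0"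
    by (rule Suc.IH; rule Suc.prems; simp)+
  then show ?case unfolding undiv_diff.simps(2)[of "Suc n"] by simp
qed simp

text \<open>
  The undivided differences that bound the jump use the cells \<open>i + 1 - k\<close> to \<open>i + k\<close> only.
\<close>

lemma recon_jump_const:
  assumes k: "k \<in> {2, 3, 4}" and u: "\<And>m. m \<in> {i + 1 - int k..i + int k} \<Longrightarrow> u m = v"
  shows "recon_jump k ge gi R u i = 0"
proof -
  have "scalar_jump k (\<lambda>m. (transpose R *v entropy_var ge gi (u m)) $ c) i = 0" for c
  proof -
    let ?g = "\<lambda>m. (transpose R *v entropy_var ge gi (u m)) $ c"
    have "undiv_diff (Suc (k - 1)) ?g s = 0" if "s \<in> {i - int k + 1..i}" for s
      by (rule undiv_diff_const[where c = "(transpose R *v entropy_var ge gi v) $ c"])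
        (use that k in \<open>auto simp: u\<close>)
    then have "\<bar>undiv_diff k ?g s\<bar> \<le> 0" if "s \<in> {i - int k + 1..i}" for s using that k by auto
    from scalar_jump_le[OF k this] show ?thesis by simp
  qed
  then have "(\<chi> c. poly (recon_poly k (\<lambda>m. (transpose R *v entropy_var ge gi (u m)) $ c) (i + 1)) (of_int i + 1/2))
    - (\<chi> c. poly (recon_poly k (\<lambda>m. (transpose R *v entropy_var ge gi (u m)) $ c) i) (of_int i + 1/2)) = 0"
    by (simp add: vec_eq_iff scalar_jump_def)
  then show ?thesis
    unfolding recon_jump_def recon_entropy_var_def matrix_vector_mult_diff_distrib[symmetric] by simp
qed

lemma central_flux_const:
  fixes F :: "state \<Rightarrow> state \<Rightarrow> real"
  assumes "k \<in> {2, 3, 4}" and u: "\<And>m. m \<in> {i + 1 - int k..i + int k} \<Longrightarrow> u m = v"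
  shows "central_flux k F u i = F v v"
  using assms(1) by (auto simp: central_flux_def u)

lemma es_entropy_flux_consistent:
  assumes "ge > 1" "gi > 1" "k \<in> {2, 3, 4}" "u \<in> admissible ge gi"
  shows "(\<forall>m\<in>{i + 1 - int k..i + int k}. U m j = u) \<Longrightarrow>
           es_entropy_flux_x k ge gi s U i j = entropy_flux_x ge gi u"
    "(\<forall>m\<in>{j + 1 - int k..j + int k}. U i m = u) \<Longrightarrow>
           es_entropy_flux_y k ge gi s U i j = entropy_flux_y ge gi u"
proof -
  note ec = ec_entropy_flux_consistent[OF assms(1,2,4)]
  have "recon_jump k ge gi R v l = 0" "central_flux k F v l = F u u"
    if "\<forall>m\<in>{l + 1 - int k..l + int k}. v m = u" for R v l and F :: "state \<Rightarrow> state \<Rightarrow> real"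
    using recon_jump_const[OF assms(3)] central_flux_const[OF assms(3)] that by blast+
  note const = this
  show "es_entropy_flux_x k ge gi s U i j = entropy_flux_x ge gi u"
    if "\<forall>m\<in>{i + 1 - int k..i + int k}. U m j = u"
    using const[of i "\<lambda>m. U m j"] that by (simp add: es_entropy_flux_x_def ec)
  show "es_entropy_flux_y k ge gi s U i j = entropy_flux_y ge gi u"
    if "\<forall>m\<in>{j + 1 - int k..j + int k}. U i m = u"
    using const[of j "\<lambda>m. U i m"] that by (simp add: es_entropy_flux_y_def ec)
qed

section \<open>Order of accuracy\<close>

lemma undiv_diff_smooth_uniform:
  fixes v :: "'a::real_normed_vector \<Rightarrow> real^5"
  assumes Q: "open Q" and v: "\<And>r. smooth_field Q (\<lambda>z. v z $ r)" and K: "compact K"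
    and \<delta>: "\<And>z. z \<in> K \<Longrightarrow> cball z \<delta> \<subseteq> Q" and e: "norm e = 1"
  shows "\<exists>M\<ge>0. \<forall>z\<in>K. \<forall>h i s r. 0 < h \<longrightarrow> real k * h \<le> \<delta> \<longrightarrow> s \<in> {i - int k..i} \<longrightarrow>
    \<bar>undiv_diff k (\<lambda>m. v (z + (of_int (m - i) * h) *\<^sub>R e) $ r) s\<bar> \<le> M * h ^ k"
proof -
  have "\<forall>r. \<exists>M. \<forall>z\<in>K. \<forall>h i s. 0 < h \<longrightarrow> real k * h \<le> \<delta> \<longrightarrow> s \<in> {i - int k..i} \<longrightarrow>
    \<bar>undiv_diff k (\<lambda>m. v (z + (of_int (m - i) * h) *\<^sub>R e) $ r) s\<bar> \<le> M * h ^ k"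
    using undiv_diff_smooth[OF Q v K \<delta> e] by blast
  from choice[OF this] obtain M where M: "\<And>r z h i s. z \<in> K \<Longrightarrow> 0 < h \<Longrightarrow> real k * h \<le> \<delta> \<Longrightarrow> s \<in> {i - int k..i} \<Longrightarrow>
    \<bar>undiv_diff k (\<lambda>m. v (z + (of_int (m - i) * h) *\<^sub>R e) $ r) s\<bar> \<le> M r * h ^ k" by blast
  have "\<bar>undiv_diff k (\<lambda>m. v (z + (of_int (m - i) * h) *\<^sub>R e) $ r) s\<bar> \<le> (\<Sum>r\<in>UNIV. \<bar>M r\<bar>) * h ^ k"
    if "z \<in> K" "0 < h" "real k * h \<le> \<delta>" "s \<in> {i - int k..i}" for r z h i s
  proof -
    have "M r \<le> \<bar>M r\<bar>" by simp
    also have "\<dots> \<le> (\<Sum>r\<in>UNIV. \<bar>M r\<bar>)" by (rule member_le_sum) auto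
    finally have "M r * h ^ k \<le> (\<Sum>r\<in>UNIV. \<bar>M r\<bar>) * h ^ k" using that by (intro mult_right_mono) auto
    with M[OF that, of r] show ?thesis by linarith
  qed
  then show ?thesis by (intro exI[of _ "\<Sum>r\<in>UNIV. \<bar>M r\<bar>"]) (auto intro: sum_nonneg)
qed

text \<open>
  The inverse of \<open>R\<close> cancels, so bounds on \<open>R\<close> and on the speed suffice.
\<close>

lemma norm_diffusion_le:
  assumes k: "k \<in> {2, 3, 4}" and R: "invertible R" "\<And>a b. \<bar>R $ a $ b\<bar> \<le> C" and c: "0 \<le> c" "c \<le> C"
    and M: "\<And>r s. s \<in> {i - int k + 1..i} \<Longrightarrow> \<bar>undiv_diff k (\<lambda>m. entropy_var ge gi (u m) $ r) s\<bar> \<le> M"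
  shows "norm ((R ** mat c ** transpose R) *v recon_jump k ge gi R u i) \<le> 125 * real k * C ^ 3 * M"
proof -
  let ?J = "scaled_jump k ge gi R u i"
  have "\<bar>(c *s ?J) $ j\<bar> \<le> C * (real k * (5 * (C * M)))" for j
    using scaled_jump_le[OF k R(2) M, where c = j] c by (simp add: abs_mult mult_mono)
  then have "norm (R *v (c *s ?J)) \<le> 25 * (C * (C * (real k * (5 * (C * M)))))"
    by (intro norm_matrix_vector_le R(2))
  then show ?thesis unfolding diffusion_jump[OF R(1)] by (simp add: power3_eq_cube mult_ac)
qed

lemma vector_derivative_along_line:
  fixes f :: "'a::real_normed_vector \<Rightarrow> 'b::real_normed_vector"
  assumes d: "((\<lambda>s. g (z + s *\<^sub>R e)) has_vector_derivative d) (at 0)"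
    and Q: "open Q" "z \<in> Q" and g: "\<And>q. q \<in> Q \<Longrightarrow> g q = f q" and p: "\<And>\<xi>. p \<xi> = z + (\<xi> - x) *\<^sub>R e"
  shows "vector_derivative (\<lambda>\<xi>. f (p \<xi>)) (at x) = d"
proof -
  have "((\<lambda>\<xi>. \<xi> - x) has_vector_derivative 1) (at x)"
    by (auto intro!: derivative_eq_intros)
  from vector_diff_chain_at[OF this, of "\<lambda>s. g (z + s *\<^sub>R e)" d] d
  have "((\<lambda>\<xi>. g (p \<xi>)) has_vector_derivative d) (at x)" by (simp add: o_def p)
  moreover have "open (p -` Q)" "x \<in> p -` Q"
    using Q by (auto simp: p intro!: open_vimage continuous_intros)
  ultimately have "((\<lambda>\<xi>. f (p \<xi>)) has_vector_derivative d) (at x)"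
    by (rule has_vector_derivative_transform_within_open) (auto simp: g)
  then show ?thesis by (rule vector_derivative_at)
qed

text \<open>
  The central differences are the flux differences of the arithmetic mean, regarded as a symmetric
  two-point flux for the identity.
\<close>

lemma central_diff_eq_central_flux:
  "central_diff k h u i = (1 / h) *\<^sub>R (central_flux k midpoint u i - central_flux k midpoint u (i - 1))"
proof -
  have shift: "i - 1 + 1 = i" "i - 1 - 1 = i - 2" "i - 1 + 2 = i + 1" by simp_all
  show ?thesis
    unfolding central_diff_def central_flux_def midpoint_def shift
    by (simp add: vec_eq_iff algebra_simps add_divide_distrib diff_divide_distrib)
qed


text \<open>
  The bound covers the interfaces on both sides of the centre \<open>i\<close>; the data they use extend at most four
  mesh widths away from it.
\<close>

lemma line_diffusion_bound:
  fixes w :: "'a::real_normed_vector \<Rightarrow> state"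
  assumes gg: "ge > 1" "gi > 1" and k: "k \<in> {2, 3, 4}"
    and Q: "open Q" and w: "smooth_field Q w" "\<And>z. z \<in> Q \<Longrightarrow> w z \<in> admissible ge gi" and K: "compact K"
    and \<delta>: "\<And>z. z \<in> K \<Longrightarrow> cball z \<delta> \<subseteq> Q" and e: "norm e = 1"
  shows "\<exists>M\<ge>0. \<forall>z\<in>K. \<forall>h u i l R c. 0 < h \<longrightarrow> 4 * h \<le> \<delta> \<longrightarrow>
    (\<forall>m. u m = w (z + (of_int (m - i) * h) *\<^sub>R e)) \<longrightarrow> l \<in> {i - 1, i} \<longrightarrow>
    invertible R \<longrightarrow> (\<forall>a b. \<bar>R $ a $ b\<bar> \<le> C) \<longrightarrow> 0 \<le> c \<longrightarrow> c \<le> C \<longrightarrow>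
    norm ((R ** mat c ** transpose R) *v recon_jump k ge gi R u l) \<le> M * h ^ k"
proof -
  have V: "smooth_field Q (\<lambda>z. entropy_var ge gi (w z) $ r)" for r
    by (rule smooth_entropy_var[OF gg Q w])
  obtain M where M: "M \<ge> 0" "\<And>z h i s r. z \<in> K \<Longrightarrow> 0 < h \<Longrightarrow> real k * h \<le> \<delta> \<Longrightarrow> s \<in> {i - int k..i} \<Longrightarrow>
    \<bar>undiv_diff k (\<lambda>m. entropy_var ge gi (w (z + (of_int (m - i) * h) *\<^sub>R e)) $ r) s\<bar> \<le> M * h ^ k"
    using undiv_diff_smooth_uniform[OF Q V K \<delta> e, of k] by blast
  have "norm ((R ** mat c ** transpose R) *v recon_jump k ge gi R u l) \<le> 125 * real k * \<bar>C\<bar> ^ 3 * M * h ^ k"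
    if z: "z \<in> K" and h: "0 < h" "4 * h \<le> \<delta>" and u: "\<forall>m. u m = w (z + (of_int (m - i) * h) *\<^sub>R e)"
      and l: "l \<in> {i - 1, i}" and R: "invertible R" "\<forall>a b. \<bar>R $ a $ b\<bar> \<le> C" and c: "0 \<le> c" "c \<le> C"
    for z h u i l R c
  proof -
    have "real k * h \<le> 4 * h" using k h by auto
    then have kh: "real k * h \<le> \<delta>" using h by linarith
    have "\<bar>undiv_diff k (\<lambda>m. entropy_var ge gi (u m) $ r) s\<bar> \<le> M * h ^ k" if s: "s \<in> {l - int k + 1..l}" for r s
    proof -
      have "s \<in> {i - int k..i}" using s l by auto
      from M(2)[OF z h(1) kh this, of r] show ?thesis using u by simp
    qed
    then have "norm ((R ** mat c ** transpose R) *v recon_jump k ge gi R u l) \<le> 125 * real k * C ^ 3 * (M * h ^ k)"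
      by (intro norm_diffusion_le[OF k R(1)]) (use R c in auto)
    then show ?thesis using c by (simp add: mult_ac)
  qed
  moreover have "125 * real k * \<bar>C\<bar> ^ 3 * M \<ge> 0" using M(1) by simp
  ultimately show ?thesis by blast
qed


lemma nonconservative_bounded:
  fixes w :: "'a::real_normed_vector \<Rightarrow> state"
  assumes gg: "ge > 1" "gi > 1" and Q: "open Q" and w: "smooth_field Q w" "\<And>z. z \<in> Q \<Longrightarrow> w z \<in> admissible ge gi"
    and K: "compact K" "K \<subseteq> Q"
  shows "\<exists>b\<ge>0. \<forall>z\<in>K. \<forall>x. norm (C_x ge gi (w z) *v x) \<le> b * norm x"
    "\<exists>b\<ge>0. \<forall>z\<in>K. \<forall>x. norm (C_y ge gi (w z) *v x) \<le> b * norm x"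
proof -
  have x: "\<exists>b\<ge>0. \<forall>z\<in>K. \<forall>x. norm (C_x ge gi (w z) *v x) \<le> b * norm x"
    if w: "smooth_field Q w" "\<And>z. z \<in> Q \<Longrightarrow> w z \<in> admissible ge gi" for w :: "'a \<Rightarrow> state"
  proof -
    have "\<exists>M. \<forall>z\<in>K. norm (C_x ge gi (w z) $ i $ j) \<le> M" for i j
      by (rule smooth_field_bounded[OF smooth_C_x[OF gg Q w] K])
    then obtain M where M: "\<And>i j z. z \<in> K \<Longrightarrow> \<bar>C_x ge gi (w z) $ i $ j\<bar> \<le> M i j"
      unfolding real_norm_def by metis
    define b where "b = (\<Sum>i\<in>UNIV. \<Sum>j\<in>UNIV. \<bar>M i j\<bar>)"
    have "\<bar>M i j\<bar> \<le> b" for i j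
    proof -
      have "\<bar>M i j\<bar> \<le> (\<Sum>j\<in>UNIV. \<bar>M i j\<bar>)" by (rule member_le_sum) auto
      also have "\<dots> \<le> b"
        unfolding b_def by (rule member_le_sum[of i UNIV "\<lambda>i. \<Sum>j\<in>UNIV. \<bar>M i j\<bar>"]) (auto intro: sum_nonneg)
      finally show ?thesis .
    qed
    then have "\<bar>C_x ge gi (w z) $ i $ j\<bar> \<le> b" if "z \<in> K" for z i j
      using M[OF that, of i j] by (meson abs_ge_self order_trans)
    then have "norm (C_x ge gi (w z) *v x) \<le> 25 * (b * norm x)" if "z \<in> K" for z x
      using that by (intro norm_matrix_vector_le component_le_norm_cart) auto
    moreover have "b \<ge> 0" by (auto simp: b_def intro!: sum_nonneg)
    ultimately show ?thesis by (intro exI[of _ "25 * b"]) (auto simp: mult.assoc)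
  qed
  show "\<exists>b\<ge>0. \<forall>z\<in>K. \<forall>x. norm (C_x ge gi (w z) *v x) \<le> b * norm x"
    by (rule x[OF w])
  show "\<exists>b\<ge>0. \<forall>z\<in>K. \<forall>x. norm (C_y ge gi (w z) *v x) \<le> b * norm x"
    using x[of "\<lambda>z. swap (w z)"] w smooth_swap[OF w(1)]
    by (simp add: C_y_swap norm_swap) (metis norm_swap)
qed

text \<open>
  \<open>B\<close> bounds the truncation error of the central part of the scheme along the direction \<open>e\<close>. The curve \<open>p\<close>
  parametrizes the grid line by the coordinate in which the differential equation is stated.
\<close>

definition line_truncation_le where
  "line_truncation_le k F f C w K \<delta> e B \<longleftrightarrow> (\<forall>z\<in>K. \<forall>h u i x p. 0 < h \<longrightarrow> 2 * h \<le> \<delta> \<longrightarrow>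
    (\<forall>m. u m = w (z + (of_int (m - i) * h) *\<^sub>R e)) \<longrightarrow> (\<forall>\<xi>. p \<xi> = z + (\<xi> - x) *\<^sub>R e) \<longrightarrow>
    norm ((1 / h) *\<^sub>R (central_flux k F u i - central_flux k F u (i - 1)) + C (w z) *v central_diff k h u i
      - (vector_derivative (\<lambda>\<xi>. f (w (p \<xi>))) (at x) + C (w z) *v vector_derivative (\<lambda>\<xi>. w (p \<xi>)) (at x)))
    \<le> B * h ^ k)"

lemma line_truncation:
  fixes w :: "'a::real_normed_vector \<Rightarrow> state" and F :: "state \<Rightarrow> state \<Rightarrow> state" and f :: "state \<Rightarrow> state"
  assumes k: "k \<in> {2, 3, 4}"
    and Q: "open Q" and w: "smooth_field Q w" and K: "compact K"
    and \<delta>: "\<And>z. z \<in> K \<Longrightarrow> cball z \<delta> \<subseteq> Q" "0 < \<delta>" "\<delta> \<le> 1" and e: "norm e = 1"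
    and F: "\<And>a b. F a b = F b a"
      "\<And>c. smooth_field (shift_domain e Q) (\<lambda>p. F (w (fst p)) (w (fst p + snd p *\<^sub>R e)) $ c)"
      "\<And>z. z \<in> Q \<Longrightarrow> F (w z) (w z) = f (w z)"
    and C: "\<exists>b\<ge>0. \<forall>z\<in>K. \<forall>x. norm (C (w z) *v x) \<le> b * norm x"
  shows "\<exists>B\<ge>0. line_truncation_le k F f C w K \<delta> e B"
proof -
  obtain B1 where B1: "\<And>z. z \<in> K \<Longrightarrow> \<exists>d. ((\<lambda>s. F (w (z + s *\<^sub>R e)) (w (z + s *\<^sub>R e))) has_vector_derivative d) (at 0) \<and>
    (\<forall>h u i. 0 < h \<longrightarrow> 2 * h \<le> \<delta> \<longrightarrow> (\<forall>m. u m = w (z + (of_int (m - i) * h) *\<^sub>R e)) \<longrightarrow>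
      norm ((1 / h) *\<^sub>R (central_flux k F u i - central_flux k F u (i - 1)) - d) \<le> B1 * h ^ k)"
    using central_flux_consistency[OF Q K \<delta> e k F(1,2)] by blast
  have "smooth_field (shift_domain e Q) (\<lambda>p. midpoint (w (fst p)) (w (fst p + snd p *\<^sub>R e)) $ c)" for c
  proof -
    have "midpoint a b $ c = midpoint (a $ c) (b $ c)" for a b :: state by (simp add: midpoint_def)
    then show ?thesis
      using smooth_midpoint[OF smooth_nth[OF smooth_shifted(1)[OF w]] smooth_nth[OF smooth_shifted(2)[OF w]]]
      by simp
  qed
  from central_flux_consistency[OF Q K \<delta> e k midpoint_sym this]
  obtain B2 where B2: "\<And>z. z \<in> K \<Longrightarrow> \<exists>d. ((\<lambda>s. midpoint (w (z + s *\<^sub>R e)) (w (z + s *\<^sub>R e))) has_vector_derivative d) (at 0) \<and>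
    (\<forall>h u i. 0 < h \<longrightarrow> 2 * h \<le> \<delta> \<longrightarrow> (\<forall>m. u m = w (z + (of_int (m - i) * h) *\<^sub>R e)) \<longrightarrow>
      norm ((1 / h) *\<^sub>R (central_flux k midpoint u i - central_flux k midpoint u (i - 1)) - d) \<le> B2 * h ^ k)"
    by blast
  obtain b where b: "b \<ge> 0" "\<And>z x. z \<in> K \<Longrightarrow> norm (C (w z) *v x) \<le> b * norm x" using C by blast
  have "norm ((1 / h) *\<^sub>R (central_flux k F u i - central_flux k F u (i - 1)) + C (w z) *v central_diff k h u i
      - (vector_derivative (\<lambda>\<xi>. f (w (p \<xi>))) (at x) + C (w z) *v vector_derivative (\<lambda>\<xi>. w (p \<xi>)) (at x)))
    \<le> (\<bar>B1\<bar> + b * \<bar>B2\<bar>) * h ^ k"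
    if z: "z \<in> K" and h: "0 < h" "2 * h \<le> \<delta>" and u: "\<forall>m. u m = w (z + (of_int (m - i) * h) *\<^sub>R e)"
      and p: "\<And>\<xi>. p \<xi> = z + (\<xi> - x) *\<^sub>R e" for z h u i x p
  proof -
    have zQ: "z \<in> Q" using \<delta>(1)[OF z] \<delta>(2) by auto
    obtain df where df: "((\<lambda>s. F (w (z + s *\<^sub>R e)) (w (z + s *\<^sub>R e))) has_vector_derivative df) (at 0)"
      "norm ((1 / h) *\<^sub>R (central_flux k F u i - central_flux k F u (i - 1)) - df) \<le> B1 * h ^ k"
      using B1[OF z] h u by blast
    obtain dw where dw: "((\<lambda>s. midpoint (w (z + s *\<^sub>R e)) (w (z + s *\<^sub>R e))) has_vector_derivative dw) (at 0)"
      "norm ((1 / h) *\<^sub>R (central_flux k midpoint u i - central_flux k midpoint u (i - 1)) - dw) \<le> B2 * h ^ k"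
      using B2[OF z] h u by blast
    have vf: "vector_derivative (\<lambda>\<xi>. f (w (p \<xi>))) (at x) = df"
      by (rule vector_derivative_along_line[where g = "\<lambda>z. F (w z) (w z)" and f = "\<lambda>z. f (w z)", OF df(1) Q zQ F(3) p])
    have vw: "vector_derivative (\<lambda>\<xi>. w (p \<xi>)) (at x) = dw"
      by (rule vector_derivative_along_line[where g = "\<lambda>z. midpoint (w z) (w z)" and f = w, OF dw(1) Q zQ _ p]) simp
    let ?X = "(1 / h) *\<^sub>R (central_flux k F u i - central_flux k F u (i - 1)) - df"
    let ?Y = "central_diff k h u i - dw"
    have eq: "(1 / h) *\<^sub>R (central_flux k F u i - central_flux k F u (i - 1)) + C (w z) *v central_diff k h u i
      - (df + C (w z) *v dw) = ?X + C (w z) *v ?Y"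
      by (simp add: matrix_vector_mult_diff_distrib)
    have "norm (?X + C (w z) *v ?Y) \<le> norm ?X + norm (C (w z) *v ?Y)" by (rule norm_triangle_ineq)
    moreover have "norm (C (w z) *v ?Y) \<le> b * (B2 * h ^ k)"
      using b(2)[OF z, of ?Y] mult_left_mono[OF dw(2) b(1)]
      unfolding central_diff_eq_central_flux by linarith
    moreover have "B1 * h ^ k \<le> \<bar>B1\<bar> * h ^ k" using h by (intro mult_right_mono) auto
    moreover have "b * (B2 * h ^ k) \<le> b * (\<bar>B2\<bar> * h ^ k)" using h b by (intro mult_left_mono mult_right_mono) auto
    ultimately have "norm (?X + C (w z) *v ?Y) \<le> \<bar>B1\<bar> * h ^ k + b * (\<bar>B2\<bar> * h ^ k)"
      using df(2) by linarith
    then show ?thesis unfolding vf vw eq by (simp only: distrib_right mult.assoc)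
  qed
  then have "line_truncation_le k F f C w K \<delta> e (\<bar>B1\<bar> + b * \<bar>B2\<bar>)"
    unfolding line_truncation_le_def by blast
  moreover have "\<bar>B1\<bar> + b * \<bar>B2\<bar> \<ge> 0" using b by simp
  ultimately show ?thesis by blast
qed

text \<open>
  The flux errors are the diffusion terms at the interfaces. What is left of the truncation error is
  the error of the central part in each direction.
\<close>

lemma scheme_accurate:
  assumes gg: "ge > 1" "gi > 1" and k: "k \<in> {2, 3, 4}"
  shows "accurate_of_order k ge gi"
  unfolding accurate_of_order_def
proof (intro allI impI, elim conjE)
  fix Q :: "(real \<times> real \<times> real) set" and w :: "real \<times> real \<times> real \<Rightarrow> state" and K Ks
  assume Q: "open Q" and w: "smooth_field Q w" and adm: "w ` Q \<subseteq> admissible ge gi"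
    and K: "compact K" "K \<subseteq> Q" and Ks: "compact Ks" "Ks \<subseteq> admissible ge gi"
  have wadm: "w z \<in> admissible ge gi" if "z \<in> Q" for z using adm that by blast
  obtain \<delta> where \<delta>: "0 < \<delta>" "\<delta> \<le> 1" "\<And>z. z \<in> K \<Longrightarrow> cball z \<delta> \<subseteq> Q"
    using compact_margin[OF K(1) Q K(2)] by blast
  define ex ey :: "real \<times> real \<times> real" where "ex = (0, 1, 0)" and "ey = (0, 0, 1)"
  have e: "norm ex = 1" "norm ey = 1" by (simp_all add: ex_def ey_def norm_Pair)
  obtain C where C: "\<And>s a b. s \<in> Ks \<Longrightarrow> \<bar>R_x ge gi s $ a $ b\<bar> \<le> C"
    "\<And>s a b. s \<in> Ks \<Longrightarrow> \<bar>R_y ge gi s $ a $ b\<bar> \<le> C"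
    "\<And>s. s \<in> Ks \<Longrightarrow> max_speed ge gi s (vel_x s) \<le> C" "\<And>s. s \<in> Ks \<Longrightarrow> max_speed ge gi s (vel_y s) \<le> C"
    using R_max_speed_bounded[OF gg Ks] by blast
  have shifted: "w (fst p) \<in> admissible ge gi" "w (fst p + snd p *\<^sub>R e) \<in> admissible ge gi"
    if "p \<in> shift_domain e Q" for p e using that wadm by (auto simp: shift_domain_def)
  have smooth_x: "smooth_field (shift_domain e Q) (\<lambda>p. ec_flux_x ge gi (w (fst p)) (w (fst p + snd p *\<^sub>R e)) $ c)"
    and smooth_y: "smooth_field (shift_domain e Q) (\<lambda>p. ec_flux_y ge gi (w (fst p)) (w (fst p + snd p *\<^sub>R e)) $ c)"
    for e c
    by (intro smooth_ec_flux_x[OF gg] smooth_ec_flux_y[OF gg] open_shift_domain Q smooth_shifted w shifted; assumption)+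
  have consistent_y: "ec_flux_y ge gi (w z) (w z) = flux_y ge gi (w z)" if "z \<in> Q" for z
    using wadm[OF that] by (simp add: ec_flux_y_swap flux_y_swap ec_flux_x_consistent[OF gg])
  have sym_y: "ec_flux_y ge gi a b = ec_flux_y ge gi b a" for a b
    by (simp add: ec_flux_y_swap ec_flux_x_commute[of ge gi "swap a"])
  have "\<exists>B\<ge>0. line_truncation_le k (ec_flux_x ge gi) (flux_x ge gi) (C_x ge gi) w K \<delta> ex B"
    by (rule line_truncation[OF k Q w K(1) _ \<delta>(1,2) e(1)])
      (erule \<delta>(3), rule ec_flux_x_commute, rule smooth_x, erule ec_flux_x_consistent[OF gg wadm],
        rule nonconservative_bounded(1)[OF gg Q w wadm K], assumption)
  then obtain Bx where Bx: "Bx \<ge> 0" "line_truncation_le k (ec_flux_x ge gi) (flux_x ge gi) (C_x ge gi) w K \<delta> ex Bx"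
    by blast
  have "\<exists>B\<ge>0. line_truncation_le k (ec_flux_y ge gi) (flux_y ge gi) (C_y ge gi) w K \<delta> ey B"
    by (rule line_truncation[OF k Q w K(1) _ \<delta>(1,2) e(2)])
      (erule \<delta>(3), rule sym_y, rule smooth_y, erule consistent_y,
        rule nonconservative_bounded(2)[OF gg Q w wadm K], assumption)
  then obtain By where By: "By \<ge> 0" "line_truncation_le k (ec_flux_y ge gi) (flux_y ge gi) (C_y ge gi) w K \<delta> ey By"
    by blast
  define bounds where "bounds M e \<longleftrightarrow> (\<forall>z\<in>K. \<forall>h u i l R c. 0 < h \<longrightarrow> 4 * h \<le> \<delta> \<longrightarrow>
    (\<forall>m. u m = w (z + (of_int (m - i) * h) *\<^sub>R e)) \<longrightarrow> l \<in> {i - 1, i} \<longrightarrow>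
    invertible R \<longrightarrow> (\<forall>a b. \<bar>R $ a $ b\<bar> \<le> C) \<longrightarrow> 0 \<le> c \<longrightarrow> c \<le> C \<longrightarrow>
    norm ((R ** mat c ** transpose R) *v recon_jump k ge gi R u l) \<le> M * h ^ k)" for M e
  obtain Mx My where M: "Mx \<ge> 0" "My \<ge> 0" "bounds Mx ex" "bounds My ey"
    using line_diffusion_bound[OF gg k Q w wadm K(1) \<delta>(3) e(1), of C]
      line_diffusion_bound[OF gg k Q w wadm K(1) \<delta>(3) e(2), of C]
    unfolding bounds_def by blast
  define B where "B = Bx + By + Mx + My"
  have B: "B \<ge> 0" "Bx \<le> B" "By \<le> B" "Mx \<le> B" "My \<le> B" using Bx(1) By(1) M(1,2) by (simp_all add: B_def)
  show "\<exists>B h0. h0 > 0 \<and>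
          (\<forall>dx dy x0 y0 t sx sy. 0 < dx \<and> dx < h0 \<and> 0 < dy \<and> dy < h0 \<and>
             (\<forall>i j. sx i j \<in> Ks \<and> sy i j \<in> Ks) \<longrightarrow>
             (\<exists>ax ay :: grid. \<forall>i j. (t, x0 + of_int i * dx, y0 + of_int j * dy) \<in> K \<longrightarrow>
                norm (ax i j) \<le> B * dx ^ k \<and> norm (ax (i - 1) j) \<le> B * dx ^ k \<and>
                norm (ay i j) \<le> B * dy ^ k \<and> norm (ay i (j - 1)) \<le> B * dy ^ k \<and>
                norm (truncation_error k ge gi dx dy x0 y0 sx sy w t i j
                      - (1 / dx) *\<^sub>R (ax i j - ax (i - 1) j)
                      - (1 / dy) *\<^sub>R (ay i j - ay i (j - 1)))
                  \<le> B * (dx ^ k + dy ^ k)))"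
  proof (rule exI[of _ B], rule exI[of _ "\<delta> / 4"], intro conjI allI impI, goal_cases)
    case 1
    then show ?case using \<delta>(1) by simp
  next
    case (2 dx dy x0 y0 t sx sy)
    then have h: "0 < dx" "4 * dx \<le> \<delta>" "0 < dy" "4 * dy \<le> \<delta>" and s: "\<And>i j. sx i j \<in> Ks" "\<And>i j. sy i j \<in> Ks"
      by auto
    define X Y where "X m = x0 + of_int m * dx" and "Y m = y0 + of_int m * dy" for m :: int
    define W where "W = (\<lambda>i j. w (t, X i, Y j))"
    define dX where "dX i j = D_x ge gi (sx i j) *v recon_jump k ge gi (R_x ge gi (sx i j)) (\<lambda>m. W m j) i" for i j
    define dY where "dY i j = D_y ge gi (sy i j) *v recon_jump k ge gi (R_y ge gi (sy i j)) (\<lambda>m. W i m) j" for i j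
    define ax ay where "ax i j = - (1/2) *\<^sub>R dX i j" and "ay i j = - (1/2) *\<^sub>R dY i j" for i j
    have "norm (ax i j) \<le> B * dx ^ k \<and> norm (ax (i - 1) j) \<le> B * dx ^ k \<and>
                norm (ay i j) \<le> B * dy ^ k \<and> norm (ay i (j - 1)) \<le> B * dy ^ k \<and>
                norm (truncation_error k ge gi dx dy x0 y0 sx sy w t i j
                      - (1 / dx) *\<^sub>R (ax i j - ax (i - 1) j)
                      - (1 / dy) *\<^sub>R (ay i j - ay i (j - 1)))
                  \<le> B * (dx ^ k + dy ^ k)"
      if "(t, x0 + of_int i * dx, y0 + of_int j * dy) \<in> K" for i j
    proof -
      define z where "z = (t, X i, Y j)"
      have z: "z \<in> K" using that by (simp add: z_def X_def Y_def)
      have ux: "\<forall>m. W m j = w (z + (of_int (m - i) * dx) *\<^sub>R ex)"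
        and uy: "\<forall>m. W i m = w (z + (of_int (m - j) * dy) *\<^sub>R ey)"
        by (simp_all add: W_def z_def ex_def ey_def X_def Y_def algebra_simps)
      have px: "\<forall>\<xi>. (t, \<xi>, Y j) = z + (\<xi> - X i) *\<^sub>R ex" and py: "\<forall>\<eta>. (t, X i, \<eta>) = z + (\<eta> - Y j) *\<^sub>R ey"
        by (simp_all add: z_def ex_def ey_def)
      have sa: "sx i j \<in> admissible ge gi" "sy i j \<in> admissible ge gi" for i j using s Ks by auto
      have dX: "norm (dX l j) \<le> Mx * dx ^ k" if "l \<in> {i - 1, i}" for l
        unfolding dX_def D_x_def
        by (rule M(3)[unfolded bounds_def, rule_format, where u = "\<lambda>m. W m j" and i = i, OF z h(1,2)
              _ that invertible_R(1)[OF gg sa(1)] C(1)[OF s(1)] max_speed_bounds(1) C(3)[OF s(1)]])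
          (rule ux[rule_format])
      have dY: "norm (dY i l) \<le> My * dy ^ k" if "l \<in> {j - 1, j}" for l
        unfolding dY_def D_y_def
        by (rule M(4)[unfolded bounds_def, rule_format, where u = "\<lambda>m. W i m" and i = j, OF z h(3,4)
              _ that invertible_R(2)[OF gg sa(2)] C(2)[OF s(2)] max_speed_bounds(1) C(4)[OF s(2)]])
          (rule uy[rule_format])
      have pow: "dx ^ k \<ge> 0" "dy ^ k \<ge> 0" using h by simp_all
      have Mle: "1 / 2 * (Mx * dx ^ k) \<le> B * dx ^ k" "1 / 2 * (My * dy ^ k) \<le> B * dy ^ k"
        using mult_right_mono[OF B(4) pow(1)] mult_right_mono[OF B(5) pow(2)]
          mult_nonneg_nonneg[OF M(1) pow(1)] mult_nonneg_nonneg[OF M(2) pow(2)] by linarith+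
      have a: "norm (ax l j) \<le> B * dx ^ k" if "l \<in> {i - 1, i}" for l
        using dX[OF that] Mle(1) by (simp add: ax_def)
      have b: "norm (ay i l) \<le> B * dy ^ k" if "l \<in> {j - 1, j}" for l
        using dY[OF that] Mle(2) by (simp add: ay_def)
      let ?Fx = "\<lambda>l. central_flux k (ec_flux_x ge gi) (\<lambda>m. W m j) l"
      let ?Fy = "\<lambda>l. central_flux k (ec_flux_y ge gi) (\<lambda>m. W i m) l"
      define Ex where "Ex = (1 / dx) *\<^sub>R (?Fx i - ?Fx (i - 1)) + C_x ge gi (w z) *v central_diff k dx (\<lambda>m. W m j) i
        - (vector_derivative (\<lambda>\<xi>. flux_x ge gi (w (t, \<xi>, Y j))) (at (X i))
           + C_x ge gi (w z) *v vector_derivative (\<lambda>\<xi>. w (t, \<xi>, Y j)) (at (X i)))"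
      define Ey where "Ey = (1 / dy) *\<^sub>R (?Fy j - ?Fy (j - 1)) + C_y ge gi (w z) *v central_diff k dy (\<lambda>m. W i m) j
        - (vector_derivative (\<lambda>\<eta>. flux_y ge gi (w (t, X i, \<eta>))) (at (Y j))
           + C_y ge gi (w z) *v vector_derivative (\<lambda>\<eta>. w (t, X i, \<eta>)) (at (Y j)))"
      have "norm Ex \<le> Bx * dx ^ k" unfolding Ex_def
        using h by (intro Bx(2)[unfolded line_truncation_le_def, rule_format, OF z]) (use ux px in auto)
      moreover have "norm Ey \<le> By * dy ^ k" unfolding Ey_def
        using h by (intro By(2)[unfolded line_truncation_le_def, rule_format, OF z]) (use uy py in auto)
      moreover have "Bx * dx ^ k \<le> B * dx ^ k" "By * dy ^ k \<le> B * dy ^ k"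
        using B pow by (simp_all add: mult_right_mono)
      moreover have "truncation_error k ge gi dx dy x0 y0 sx sy w t i j
                      - (1 / dx) *\<^sub>R (ax i j - ax (i - 1) j)
                      - (1 / dy) *\<^sub>R (ay i j - ay i (j - 1)) = Ex + Ey"
      proof -
        have W: "W i j = w z" by (simp add: W_def z_def)
        have rhs: "scheme_rhs k ge gi dx dy sx sy W i j =
          - ((1 / dx) *\<^sub>R ((?Fx i + ax i j) - (?Fx (i - 1) + ax (i - 1) j)))
          - (1 / dy) *\<^sub>R ((?Fy j + ay i j) - (?Fy (j - 1) + ay i (j - 1)))
          - C_x ge gi (w z) *v central_diff k dx (\<lambda>m. W m j) i
          - C_y ge gi (w z) *v central_diff k dy (\<lambda>m. W i m) j"
          unfolding scheme_rhs_def es_flux_x_def es_flux_y_def W ax_def ay_def dX_def dY_def by simp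
        have te: "truncation_error k ge gi dx dy x0 y0 sx sy w t i j =
          vector_derivative (\<lambda>\<tau>. w (\<tau>, X i, Y j)) (at t) - scheme_rhs k ge gi dx dy sx sy W i j
            - pde_lhs ge gi w t (X i) (Y j)"
          by (simp add: truncation_error_def Let_def X_def Y_def W_def)
        show ?thesis
          unfolding te rhs Ex_def Ey_def pde_lhs_def z_def by (simp add: algebra_simps)
      qed
      moreover have "norm (Ex + Ey) \<le> norm Ex + norm Ey" by (rule norm_triangle_ineq)
      ultimately have "norm (truncation_error k ge gi dx dy x0 y0 sx sy w t i j
                      - (1 / dx) *\<^sub>R (ax i j - ax (i - 1) j)
                      - (1 / dy) *\<^sub>R (ay i j - ay i (j - 1))) \<le> B * (dx ^ k + dy ^ k)"
        by (simp add: distrib_left)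
      then show ?thesis using a b by simp
    qed
    then show ?case by blast
  qed
qed

theorem theorem4p1:
  fixes ge gi :: real and k :: nat
  assumes "ge > 1" and "gi > 1" and "k \<in> {2, 3, 4}"
  shows
    "accurate_of_order k ge gi
     \<and>
     (\<forall>dx dy G T sx sy U. dx > 0 \<and> dy > 0 \<and> scheme_solution k ge gi dx dy G T sx sy U \<longrightarrow>
        (\<forall>t\<in>T. \<forall>i j. stencil k i j \<subseteq> G \<longrightarrow>
           (\<exists>E'. ((\<lambda>\<tau>. entropy ge gi (U \<tau> i j)) has_real_derivative E') (at t within T) \<and>
              E' + 1 / dx * (es_entropy_flux_x k ge gi (sx t i j) (U t) i j
                             - es_entropy_flux_x k ge gi (sx t (i - 1) j) (U t) (i - 1) j)
                 + 1 / dy * (es_entropy_flux_y k ge gi (sy t i j) (U t) i j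
                             - es_entropy_flux_y k ge gi (sy t i (j - 1)) (U t) i (j - 1))
              \<le> 0)))
     \<and>
     (\<forall>u s U i j. u \<in> admissible ge gi \<and> s \<in> admissible ge gi \<longrightarrow>
        ((\<forall>m\<in>{i + 1 - int k..i + int k}. U m j = u) \<longrightarrow>
           es_entropy_flux_x k ge gi s U i j = entropy_flux_x ge gi u) \<and>
        ((\<forall>m\<in>{j + 1 - int k..j + int k}. U i m = u) \<longrightarrow>
           es_entropy_flux_y k ge gi s U i j = entropy_flux_y ge gi u))"
  using scheme_accurate[OF assms] scheme_entropy_inequality[OF assms(1,2,3)]
    es_entropy_flux_consistent[OF assms]
  by (intro conjI allI impI ballI) blast+

end
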